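(* Let $n\in\mathbb N$, let $\mathcal G$ be the star graph with $n$ edges, let $M=(A,B)$ satisfy (A1) and (A2), let $\lambda\in\{1,-1\}$, $0<p<1$ and $u_0\in L^2(\mathcal G)$. Let $u$ be a global solution of $$i\partial_t u+\Delta_M u+\lambda|u|^p u=0 \ \text{ on } \mathbb R\times\mathcal G,\qquad u(0)=u_0 .$$ Suppose that there exist $u_+\in L^2(\mathcal G)$, $1\le q<2$ and $l\in L^\infty((0,\infty);L^2(\mathcal G)\cap L^q(\mathcal G))$ such that $$\|u(t)-(e^{it\Delta_K}u_+ + l(t))\|_{L^2(\mathcal G)}\to 0\quad (t\to\infty).$$ Then $u_+\equiv 0$. The analogous result holds in the negative time direction: if there exist $u_-\in L^2(\mathcal G)$, $1\le q<2$ and $l\in L^\infty((-\infty,0);L^2(\mathcal G)\cap L^q(\mathcal G))$ such that $\|u(t)-(e^{it\Delta_K}u_- + l(t))\|_{L^2(\mathcal G)}\to 0$ as $t\to-\infty$, then $u_-\equiv 0$.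
   Context: The star graph $\mathcal G$ consists of $n$ half-lines $e_1,\dots,e_n$, each identified with $[0,\infty)$, joined at the vertex $0$. A function on $\mathcal G$ is a vector $f=(f_1,\dots,f_n)^T$ with $f_j:e_j\to\mathbb C$. $L^2(\mathcal G)=\bigoplus_j L^2(e_j)$ with $\langle f,g\rangle=\sum_j\int_0^\infty f_j\overline{g_j}\,dx$, and $\|f\|_{L^r(\mathcal G)}=(\sum_j\|f_j\|_{L^r(e_j)}^r)^{1/r}$ for $1\le r<\infty$, $\|f\|_{L^\infty(\mathcal G)}=\max_j\|f_j\|_{L^\infty(e_j)}$. $A,B$ are complex $n\times n$ matrices, and $M=(A,B)$ satisfies: (A1) the $n\times 2n$ matrix $(A,B)$ has rank $n$; (A2) $AB^*$ is self-adjoint. The Laplacian $\Delta_M$ on $L^2(\mathcal G)$ is $\Delta_M f=(f_1'',\dots,f_n'')^T$ with domain the set of $f=(f_j)_j$ such that $f_j\in L^2(e_j)$, $f_j,f_j'$ are absolutely continuous, $f_j''\in L^2(e_j)$ for all $j$, and $Af(0)+Bf'(0+)=0$. It is self-adjoint, and $e^{it\Delta_M}$ is the unitary group it generates. $\Delta_K$ is the Kirchhoff Laplacian, i.e. the one with vertex conditions $f_j(0)=f_k(0)$ for all $j,k$ and $\sum_{j=1}^n f_j'(0+)=0$. The nonlinearity $|u|^pu$ acts componentwise. A pair $(q,r)$ is admissible if $2/q=1/2-1/r$ and $2\le q,r\le\infty$. For a time interval $I\ni 0$, an $L^2$-solution on $I$ with data $u_0$ is $u\in C(I;L^2(\mathcal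 G))\cap\bigcap_{(q,r)\text{ admissible}}L^q(I;L^r(\mathcal G))$ with $u(t)=e^{it\Delta_M}u_0+i\lambda\int_0^t e^{i(t-s)\Delta_M}(|u|^pu)(s)\,ds$ for all $t\in I$. A global solution is a function $u:\mathbb R\to L^2(\mathcal G)$ whose restriction to every compact interval containing $0$ is an $L^2$-solution. *)

theory Defs
  imports "HOL-Analysis.Analysis" "HOL-Probability.Essential_Supremum"
begin

section \<open>The Hilbert space \<open>L\<^sup>2\<close> of an edge\<close>

abbreviation half_line :: "real measure" where
  "half_line \<equiv> lebesgue_on {0..}"

text \<open>Elements are classes of almost everywhere equal, square integrable, Lebesgue measurable
  functions on \<open>[0,\<infinity>)\<close>; the values of a function on the negative half-line are irrelevant.\<close>

definition L2_fun :: "(real \<Rightarrow> complex) \<Rightarrow> bool" where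
  "L2_fun f \<longleftrightarrow> f \<in> borel_measurable half_line \<and> integrable half_line (\<lambda>x. (norm (f x))\<^sup>2)"

definition L2_eq :: "(real \<Rightarrow> complex) \<Rightarrow> (real \<Rightarrow> complex) \<Rightarrow> bool" where
  "L2_eq f g \<longleftrightarrow> L2_fun f \<and> L2_fun g \<and> (AE x in half_line. f x = g x)"

lemma measurable_cnj [measurable]: "cnj \<in> borel_measurable borel"
  by (intro borel_measurable_continuous_onI continuous_intros)

lemma AE_trans_eq: "AE x in M. f x = g x \<Longrightarrow> AE x in M. g x = h x \<Longrightarrow> AE x in M. f x = h x"
  by (elim AE_mp) simp

lemma L2_fun_zero: "L2_fun (\<lambda>x. 0)"
  by (simp add: L2_fun_def)

lemma L2_fun_add:
  assumes "L2_fun f" "L2_fun g"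
  shows "L2_fun (\<lambda>x. f x + g x)"
proof -
  have [measurable]: "f \<in> borel_measurable half_line" "g \<in> borel_measurable half_line"
    using assms by (auto simp: L2_fun_def)
  have "integrable half_line (\<lambda>x. 2 * (norm (f x))\<^sup>2 + 2 * (norm (g x))\<^sup>2)"
    using assms by (auto simp: L2_fun_def)
  then have "integrable half_line (\<lambda>x. (norm (f x + g x))\<^sup>2)"
  proof (rule Bochner_Integration.integrable_bound)
    show "AE x in half_line. norm ((norm (f x + g x))\<^sup>2)
            \<le> norm (2 * (norm (f x))\<^sup>2 + 2 * (norm (g x))\<^sup>2)"
    proof (rule AE_I2)
      fix x
      have "(norm (f x + g x))\<^sup>2 \<le> (norm (f x) + norm (g x))\<^sup>2"
        by (simp add: norm_triangle_ineq power_mono)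
      also have "\<dots> \<le> 2 * (norm (f x))\<^sup>2 + 2 * (norm (g x))\<^sup>2"
        using sum_squares_bound[of "norm (f x)" "norm (g x)"] by (simp add: power2_sum)
      finally show "norm ((norm (f x + g x))\<^sup>2)
            \<le> norm (2 * (norm (f x))\<^sup>2 + 2 * (norm (g x))\<^sup>2)" by simp
    qed
  qed measurable
  then show ?thesis by (auto simp: L2_fun_def)
qed

lemma L2_fun_scale: "L2_fun f \<Longrightarrow> L2_fun (\<lambda>x. c * f x)"
  by (auto simp: L2_fun_def norm_mult power_mult_distrib)

lemma L2_fun_mult_integrable:
  assumes "L2_fun f" "L2_fun g"
  shows "integrable half_line (\<lambda>x. f x * cnj (g x))"
proof -
  have [measurable]: "f \<in> borel_measurable half_line" "g \<in> borel_measurable half_line"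
    using assms by (auto simp: L2_fun_def)
  have "integrable half_line (\<lambda>x. (norm (f x))\<^sup>2 + (norm (g x))\<^sup>2)"
    using assms by (auto simp: L2_fun_def)
  then show ?thesis
  proof (rule Bochner_Integration.integrable_bound)
    show "AE x in half_line. norm (f x * cnj (g x)) \<le> norm ((norm (f x))\<^sup>2 + (norm (g x))\<^sup>2)"
    proof (rule AE_I2)
      fix x
      have "2 * (norm (f x) * norm (g x)) \<le> (norm (f x))\<^sup>2 + (norm (g x))\<^sup>2"
        using sum_squares_bound[of "norm (f x)" "norm (g x)"] by simp
      moreover have "0 \<le> norm (f x) * norm (g x)" by simp
      ultimately have "norm (f x) * norm (g x) \<le> (norm (f x))\<^sup>2 + (norm (g x))\<^sup>2" by linarith
      then show "norm (f x * cnj (g x)) \<le> norm ((norm (f x))\<^sup>2 + (norm (g x))\<^sup>2)"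
        by (simp add: norm_mult)
    qed
  qed measurable
qed

quotient_type half_line_L2 = "real \<Rightarrow> complex" / partial: L2_eq
proof (rule part_equivpI)
  show "\<exists>f. L2_eq f f"
    using L2_fun_zero by (auto simp: L2_eq_def)
  show "symp L2_eq"
    by (auto simp: symp_def L2_eq_def)
  show "transp L2_eq"
    unfolding transp_def L2_eq_def by (blast intro: AE_trans_eq)
qed

instantiation half_line_L2 :: real_vector
begin

lift_definition zero_half_line_L2 :: half_line_L2 is "\<lambda>x. 0"
  by (simp add: L2_eq_def L2_fun_zero)

lift_definition plus_half_line_L2 :: "half_line_L2 \<Rightarrow> half_line_L2 \<Rightarrow> half_line_L2"
  is "\<lambda>f g x. f x + g x"
  by (auto simp: L2_eq_def L2_fun_add)

lift_definition uminus_half_line_L2 :: "half_line_L2 \<Rightarrow> half_line_L2"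
  is "\<lambda>f x. - f x"
  using L2_fun_scale[of _ "-1"] by (auto simp: L2_eq_def)

lift_definition scaleR_half_line_L2 :: "real \<Rightarrow> half_line_L2 \<Rightarrow> half_line_L2"
  is "\<lambda>r f x. complex_of_real r * f x"
  by (auto simp: L2_eq_def L2_fun_scale)

definition minus_half_line_L2 :: "half_line_L2 \<Rightarrow> half_line_L2 \<Rightarrow> half_line_L2" where
  "f - g = f + - (g :: half_line_L2)"

instance
proof
  fix a b c :: half_line_L2 and r s :: real
  show "a - b = a + - b" by (rule minus_half_line_L2_def)
  show "a + b + c = a + (b + c)"
    by transfer (simp add: L2_eq_def L2_fun_add add.assoc)
  show "a + b = b + a"
    by transfer (simp add: L2_eq_def L2_fun_add add.commute)
  show "0 + a = a"
    by transfer (simp add: L2_eq_def)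
  show "- a + a = 0"
    by transfer (simp add: L2_eq_def L2_fun_zero)
  show "r *\<^sub>R (a + b) = r *\<^sub>R a + r *\<^sub>R b"
    by transfer (simp add: L2_eq_def L2_fun_add L2_fun_scale distrib_left)
  show "(r + s) *\<^sub>R a = r *\<^sub>R a + s *\<^sub>R a"
    by transfer (simp add: L2_eq_def L2_fun_add L2_fun_scale distrib_right)
  show "r *\<^sub>R s *\<^sub>R a = (r * s) *\<^sub>R a"
    by transfer (simp add: L2_eq_def L2_fun_scale mult.assoc)
  show "1 *\<^sub>R a = a"
    by transfer (simp add: L2_eq_def)
qed

end

text \<open>There is no class of complex vector spaces in the library; scalar multiplication by complex
  numbers and the complex inner product (linear in the first argument) are separate operations.\<close>

lift_definition scaleC_half_line :: "complex \<Rightarrow> half_line_L2 \<Rightarrow> half_line_L2"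
  is "\<lambda>c f x. c * f x"
  by (auto simp: L2_eq_def L2_fun_scale)

lift_definition cinner_half_line :: "half_line_L2 \<Rightarrow> half_line_L2 \<Rightarrow> complex"
  is "\<lambda>f g. LINT x|half_line. f x * cnj (g x)"
proof -
  fix f f' g g' assume "L2_eq f f'" "L2_eq g g'"
  then have [measurable]: "f \<in> borel_measurable half_line" "f' \<in> borel_measurable half_line"
    "g \<in> borel_measurable half_line" "g' \<in> borel_measurable half_line"
    and "AE x in half_line. f x = f' x" "AE x in half_line. g x = g' x"
    by (auto simp: L2_eq_def L2_fun_def)
  from this(5,6) have "AE x in half_line. f x * cnj (g x) = f' x * cnj (g' x)"
    by eventually_elim simp
  from integral_cong_AE[OF _ _ this]
  show "(LINT x|half_line. f x * cnj (g x)) = (LINT x|half_line. f' x * cnj (g' x))"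
    by simp
qed

lemma mult_cnj_self: "z * cnj z = complex_of_real ((norm z)\<^sup>2)"
  by (rule complex_norm_square[symmetric])

lemma L2_fun_AE_zero:
  assumes "L2_fun f" "(LINT x|half_line. (norm (f x))\<^sup>2) = 0"
  shows "AE x in half_line. f x = 0"
  using assms integral_nonneg_eq_0_iff_AE[of half_line "\<lambda>x. (norm (f x))\<^sup>2"]
  by (auto simp: L2_fun_def)

lemma L2_fun_rep: "L2_fun (rep_half_line_L2 f)"
  using Quotient_half_line_L2 by (auto simp: Quotient_def L2_eq_def)

lemma abs_rep_half_line_L2: "abs_half_line_L2 (rep_half_line_L2 f) = f"
  using Quotient_half_line_L2 by (auto simp: Quotient_def)

text \<open>The real inner product is the real part of the complex one, so the norm is the usual one.\<close>

instantiation half_line_L2 :: real_inner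
begin

definition inner_half_line_L2 :: "half_line_L2 \<Rightarrow> half_line_L2 \<Rightarrow> real" where
  "inner_half_line_L2 f g = Re (cinner_half_line f g)"

definition norm_half_line_L2 :: "half_line_L2 \<Rightarrow> real" where
  "norm_half_line_L2 f = sqrt (inner f f)"

definition sgn_half_line_L2 :: "half_line_L2 \<Rightarrow> half_line_L2" where
  "sgn_half_line_L2 f = f /\<^sub>R norm f"

definition dist_half_line_L2 :: "half_line_L2 \<Rightarrow> half_line_L2 \<Rightarrow> real" where
  "dist_half_line_L2 f g = norm (f - g)"

definition uniformity_half_line_L2 :: "(half_line_L2 \<times> half_line_L2) filter" where
  "uniformity_half_line_L2 = (INF e\<in>{0<..}. principal {(f, g). dist f g < e})"

definition open_half_line_L2 :: "half_line_L2 set \<Rightarrow> bool" where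
  "open_half_line_L2 U \<longleftrightarrow> (\<forall>f\<in>U. \<forall>\<^sub>F (f', g) in uniformity. f' = f \<longrightarrow> g \<in> U)"

instance
proof
  fix f g h :: half_line_L2 and r :: real and U :: "half_line_L2 set"
  show "sgn f = f /\<^sub>R norm f" by (rule sgn_half_line_L2_def)
  show "dist f g = norm (f - g)" by (rule dist_half_line_L2_def)
  show "(uniformity :: (half_line_L2 \<times> half_line_L2) filter)
      = (INF e\<in>{0<..}. principal {(f, g). dist f g < e})"
    by (rule uniformity_half_line_L2_def)
  show "open U \<longleftrightarrow> (\<forall>f\<in>U. \<forall>\<^sub>F (f', g) in uniformity. f' = f \<longrightarrow> g \<in> U)"
    by (rule open_half_line_L2_def)
  show "norm f = sqrt (inner f f)" by (rule norm_half_line_L2_def)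
  have "cinner_half_line g f = cnj (cinner_half_line f g)"
    by transfer (subst Bochner_Integration.integral_cnj[symmetric], simp only: complex_cnj_mult complex_cnj_cnj mult.commute)
  then show "inner f g = inner g f"
    by (simp add: inner_half_line_L2_def)
  have "cinner_half_line (f + g) h = cinner_half_line f h + cinner_half_line g h"
    by transfer (simp add: L2_eq_def L2_fun_mult_integrable distrib_right)
  then show "inner (f + g) h = inner f h + inner g h"
    by (simp add: inner_half_line_L2_def)
  have "cinner_half_line (r *\<^sub>R f) g = of_real r * cinner_half_line f g"
    by transfer (simp add: mult.assoc)
  then show "inner (r *\<^sub>R f) g = r * inner f g"
    by (simp add: inner_half_line_L2_def)
  have self: "inner f f = (LINT x|half_line. (norm (rep_half_line_L2 f x))\<^sup>2)"
    unfolding inner_half_line_L2_def cinner_half_line_def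
    by (simp add: mult_cnj_self del: of_real_power)
  then show "0 \<le> inner f f" by simp
  show "inner f f = 0 \<longleftrightarrow> f = 0"
  proof
    assume "inner f f = 0"
    then have "L2_eq (rep_half_line_L2 f) (\<lambda>x. 0)"
      using L2_fun_AE_zero[OF L2_fun_rep] by (simp add: self L2_eq_def L2_fun_rep L2_fun_zero)
    then have "abs_half_line_L2 (rep_half_line_L2 f) = abs_half_line_L2 (\<lambda>x. 0)"
      using Quotient_rel_abs[OF Quotient_half_line_L2] by blast
    then show "f = 0"
      by (simp add: abs_rep_half_line_L2 zero_half_line_L2_def)
  next
    assume "f = 0"
    moreover have "cinner_half_line 0 0 = 0" by transfer simp
    ultimately show "inner f f = 0" by (simp add: inner_half_line_L2_def)
  qed
qed

end

lemma rep_abs_half_line_L2: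
  assumes "L2_fun f"
  shows "AE x in half_line. rep_half_line_L2 (abs_half_line_L2 f) x = f x"
proof -
  have "L2_eq f f" using assms by (simp add: L2_eq_def)
  then have "L2_eq (rep_half_line_L2 (abs_half_line_L2 f)) f"
    using Quotient_rep_abs[OF Quotient_half_line_L2] by blast
  then show ?thesis by (simp add: L2_eq_def)
qed

lemma L2_fun_diff: "L2_fun f \<Longrightarrow> L2_fun g \<Longrightarrow> L2_fun (\<lambda>x. f x - g x)"
  using L2_fun_add[of f "\<lambda>x. - 1 * g x"] L2_fun_scale[of g "- 1"] by simp

lemma abs_diff_half_line_L2:
  assumes "L2_fun f" "L2_fun g"
  shows "abs_half_line_L2 f - abs_half_line_L2 g = abs_half_line_L2 (\<lambda>x. f x - g x)"
proof -
  have eq: "L2_eq f f" "L2_eq g g" "L2_eq (\<lambda>x. - g x) (\<lambda>x. - g x)"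
    using assms L2_fun_scale[of g "- 1"] by (auto simp: L2_eq_def)
  show ?thesis
    unfolding minus_half_line_L2_def
    by (simp add: uminus_half_line_L2.abs_eq[OF eq(2)] plus_half_line_L2.abs_eq[OF eq(1,3)])
qed

lemma norm_abs_half_line_L2:
  assumes "L2_fun f"
  shows "(norm (abs_half_line_L2 f))\<^sup>2 = (LINT x|half_line. (norm (f x))\<^sup>2)"
proof -
  have eq: "L2_eq f f" using assms by (simp add: L2_eq_def)
  show ?thesis
    unfolding norm_half_line_L2_def inner_half_line_L2_def cinner_half_line.abs_eq[OF eq eq]
      mult_cnj_self by (simp del: of_real_power)
qed

lemma dist_abs_half_line_L2:
  assumes "L2_fun f" "L2_fun g"
  shows "(dist (abs_half_line_L2 f) (abs_half_line_L2 g))\<^sup>2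
       = (LINT x|half_line. (norm (f x - g x))\<^sup>2)"
  using assms
  by (simp add: dist_norm abs_diff_half_line_L2 norm_abs_half_line_L2 L2_fun_diff)

lemma nn_dist_half_line_L2:
  "(\<integral>\<^sup>+x. ennreal ((norm (rep_half_line_L2 f x - rep_half_line_L2 g x))\<^sup>2) \<partial>half_line)
     = ennreal ((dist f g)\<^sup>2)"
proof -
  have "(dist f g)\<^sup>2 = (LINT x|half_line. (norm (rep_half_line_L2 f x - rep_half_line_L2 g x))\<^sup>2)"
    using dist_abs_half_line_L2[OF L2_fun_rep[of f] L2_fun_rep[of g]]
    by (simp add: abs_rep_half_line_L2)
  then show ?thesis
    using L2_fun_diff[OF L2_fun_rep[of f] L2_fun_rep[of g]]
    by (simp add: nn_integral_eq_integral L2_fun_def)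
qed

subsection \<open>Completeness (Riesz--Fischer)\<close>

lemma convergent_if_fast:
  fixes a :: "nat \<Rightarrow> complex"
  assumes "(\<Sum>k. ennreal (2 ^ k * (norm (a (Suc k) - a k))\<^sup>2)) \<noteq> \<infinity>"
  shows "convergent a"
proof -
  have sm: "summable (\<lambda>k. 2 ^ k * (norm (a (Suc k) - a k))\<^sup>2)"
    using assms by (intro summable_suminf_not_top) auto
  define C where "C = (\<Sum>k. 2 ^ k * (norm (a (Suc k) - a k))\<^sup>2)"
  have "summable (\<lambda>k. norm (a (Suc k) - a k))"
  proof (rule summable_comparison_test')
    have "summable (\<lambda>k. (1 / sqrt 2) ^ k)"
      by (intro summable_geometric) (simp add: real_less_rsqrt)
    then show "summable (\<lambda>k. sqrt C * (1 / sqrt 2) ^ k)"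
      by (rule summable_mult)
    fix k :: nat
    have "2 ^ k * (norm (a (Suc k) - a k))\<^sup>2 \<le> C"
      unfolding C_def using sum_le_suminf[OF sm, of "{k}"] by simp
    then have "sqrt (2 ^ k * (norm (a (Suc k) - a k))\<^sup>2) \<le> sqrt C" by simp
    then have "sqrt 2 ^ k * norm (a (Suc k) - a k) \<le> sqrt C"
      by (simp add: real_sqrt_mult real_sqrt_power)
    then show "norm (norm (a (Suc k) - a k)) \<le> sqrt C * (1 / sqrt 2) ^ k"
      by (simp add: field_simps)
  qed
  then have "summable (\<lambda>k. a (Suc k) - a k)" by (rule summable_norm_cancel)
  then obtain s where "(\<lambda>n. \<Sum>k<n. a (Suc k) - a k) \<longlonglongrightarrow> s"
    by (auto simp: summable_def sums_def)
  then have "(\<lambda>n. a n - a 0) \<longlonglongrightarrow> s" by (simp add: sum_lessThan_telescope)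
  then have "(\<lambda>n. a n - a 0 + a 0) \<longlonglongrightarrow> s + a 0" by (intro tendsto_add) auto
  then show ?thesis by (auto simp: convergent_def)
qed

instance half_line_L2 :: complete_space
proof
  fix X :: "nat \<Rightarrow> half_line_L2" assume X: "Cauchy X"
  define F where "F n = rep_half_line_L2 (X n)" for n
  have [measurable]: "F n \<in> borel_measurable half_line" for n
    using L2_fun_rep by (auto simp: F_def L2_fun_def)
  have "\<exists>N. \<forall>m\<ge>N. \<forall>n\<ge>N. dist (X m) (X n) < (1/4) ^ k" for k :: nat
    using X by (intro metric_CauchyD) auto
  then obtain N where N: "\<And>k m n. m \<ge> N k \<Longrightarrow> n \<ge> N k \<Longrightarrow> dist (X m) (X n) < (1/4) ^ k"
    by metis
  define r where "r k = (\<Sum>i\<le>k. N i)" for k :: nat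
  have r_ge: "N k \<le> r m" if "k \<le> m" for k m
    unfolding r_def using that by (intro member_le_sum) auto
  have nn: "(\<integral>\<^sup>+x. ennreal ((norm (F m x - F n x))\<^sup>2) \<partial>half_line) = ennreal ((dist (X m) (X n))\<^sup>2)"
    for m n unfolding F_def by (rule nn_dist_half_line_L2)
  let ?G = "\<lambda>x. \<Sum>k. ennreal (2 ^ k * (norm (F (r (Suc k)) x - F (r k) x))\<^sup>2)"
  have "(\<integral>\<^sup>+x. ?G x \<partial>half_line)
      = (\<Sum>k. \<integral>\<^sup>+x. ennreal (2 ^ k * (norm (F (r (Suc k)) x - F (r k) x))\<^sup>2) \<partial>half_line)"
    by (intro nn_integral_suminf) measurable
  also have "\<dots> = (\<Sum>k. ennreal (2 ^ k * (dist (X (r (Suc k))) (X (r k)))\<^sup>2))"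
    by (intro suminf_cong) (simp add: ennreal_mult' nn_integral_cmult nn)
  also have "\<dots> \<le> (\<Sum>k. ennreal ((1/8) ^ k))"
  proof (intro suminf_le)
    fix k :: nat
    have "dist (X (r (Suc k))) (X (r k)) \<le> (1/4) ^ k"
      using N[of k "r (Suc k)" "r k"] r_ge by (simp add: less_imp_le)
    then have "2 ^ k * (dist (X (r (Suc k))) (X (r k)))\<^sup>2 \<le> 2 ^ k * ((1/4) ^ k)\<^sup>2"
      by (intro mult_left_mono power_mono) auto
    also have "(2::real) ^ k * ((1/4) ^ k)\<^sup>2 = (2 * (1/4)\<^sup>2) ^ k"
      by (simp only: power_mult_distrib power_commutes flip: power_mult) (simp add: mult.commute)
    also have "(2 * (1/4)\<^sup>2 :: real) = 1/8" by (simp add: power2_eq_square)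
    finally show "ennreal (2 ^ k * (dist (X (r (Suc k))) (X (r k)))\<^sup>2) \<le> ennreal ((1/8) ^ k)"
      by (rule ennreal_leI)
  qed auto
  also have "\<dots> = ennreal (\<Sum>k. (1/8) ^ k)"
    by (intro suminf_ennreal2) (auto intro: summable_geometric)
  also have "\<dots> < \<infinity>" by simp
  finally have "AE x in half_line. ?G x \<noteq> \<infinity>"
    by (intro nn_integral_PInf_AE) auto
  then have conv: "AE x in half_line. convergent (\<lambda>k. F (r k) x)"
    by eventually_elim (rule convergent_if_fast)
  define f where "f x = lim (\<lambda>k. F (r k) x)" for x
  have [measurable]: "f \<in> borel_measurable half_line"
    unfolding f_def by measurable
  have lim: "AE x in half_line. (\<lambda>k. F (r k) x) \<longlonglongrightarrow> f x"
    using conv by eventually_elim (simp add: f_def convergent_LIMSEQ_iff)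
  have fatou: "(\<integral>\<^sup>+x. ennreal ((norm (f x - F n x))\<^sup>2) \<partial>half_line) \<le> ennreal (((1/4) ^ k)\<^sup>2)"
    if n: "n \<ge> N k" for n k
  proof -
    have "(\<integral>\<^sup>+x. ennreal ((norm (f x - F n x))\<^sup>2) \<partial>half_line)
        = (\<integral>\<^sup>+x. liminf (\<lambda>m. ennreal ((norm (F (r m) x - F n x))\<^sup>2)) \<partial>half_line)"
    proof (rule nn_integral_cong_AE)
      show "AE x in half_line. ennreal ((norm (f x - F n x))\<^sup>2)
          = liminf (\<lambda>m. ennreal ((norm (F (r m) x - F n x))\<^sup>2))"
        using lim
      proof eventually_elim
        case (elim x)
        then have "(\<lambda>m. ennreal ((norm (F (r m) x - F n x))\<^sup>2)) \<longlonglongrightarrow> ennreal ((norm (f x - F n x))\<^sup>2)"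
          by (intro tendsto_intros)
        then show ?case by (intro lim_imp_Liminf[symmetric]) auto
      qed
    qed
    also have "\<dots> \<le> liminf (\<lambda>m. \<integral>\<^sup>+x. ennreal ((norm (F (r m) x - F n x))\<^sup>2) \<partial>half_line)"
      by (intro nn_integral_liminf) measurable
    also have "\<dots> = liminf (\<lambda>m. ennreal ((dist (X (r m)) (X n))\<^sup>2))"
      by (simp add: nn)
    also have "\<dots> \<le> limsup (\<lambda>m. ennreal ((dist (X (r m)) (X n))\<^sup>2))"
      by (intro Liminf_le_Limsup) auto
    also have "\<dots> \<le> ennreal (((1/4) ^ k)\<^sup>2)"
    proof (rule Limsup_bounded)
      show "\<forall>\<^sub>F m in sequentially. ennreal ((dist (X (r m)) (X n))\<^sup>2) \<le> ennreal (((1/4) ^ k)\<^sup>2)"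
        using eventually_ge_at_top[of k]
      proof eventually_elim
        case (elim m)
        then have "dist (X (r m)) (X n) < (1/4) ^ k"
          using N[OF r_ge n] by blast
        then show ?case by (intro ennreal_leI power_mono) auto
      qed
    qed
    finally show ?thesis .
  qed
  have diff: "L2_fun (\<lambda>x. f x - F n x)" if "n \<ge> N k" for n k
    unfolding L2_fun_def
  proof
    have "(\<integral>\<^sup>+x. ennreal ((norm (f x - F n x))\<^sup>2) \<partial>half_line) < \<infinity>"
      using fatou[OF that] by (auto intro: le_less_trans)
    then show "integrable half_line (\<lambda>x. (norm (f x - F n x))\<^sup>2)"
      by (intro integrableI_bounded) auto
  qed measurable
  have Fl2: "L2_fun (F n)" for n by (simp add: F_def L2_fun_rep)
  have f: "L2_fun f"
    using L2_fun_add[OF diff[of 0 "N 0"] Fl2[of "N 0"]] by simp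
  have d: "dist (X n) (abs_half_line_L2 f) \<le> (1/4) ^ k" if "n \<ge> N k" for n k
  proof -
    have Xn: "X n = abs_half_line_L2 (F n)" by (simp add: F_def abs_rep_half_line_L2)
    have "ennreal ((dist (abs_half_line_L2 f) (X n))\<^sup>2)
        = (\<integral>\<^sup>+x. ennreal ((norm (f x - F n x))\<^sup>2) \<partial>half_line)"
      unfolding Xn dist_abs_half_line_L2[OF f Fl2]
      using diff[OF that] by (intro nn_integral_eq_integral[symmetric]) (auto simp: L2_fun_def)
    then have "ennreal ((dist (abs_half_line_L2 f) (X n))\<^sup>2) \<le> ennreal (((1/4) ^ k)\<^sup>2)"
      using fatou[OF that] by simp
    then have "(dist (abs_half_line_L2 f) (X n))\<^sup>2 \<le> ((1/4) ^ k)\<^sup>2"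
      by (subst (asm) ennreal_le_iff) auto
    then have "dist (abs_half_line_L2 f) (X n) \<le> (1/4) ^ k"
      by (rule power2_le_imp_le) simp
    then show ?thesis by (simp add: dist_commute)
  qed
  have "X \<longlonglongrightarrow> abs_half_line_L2 f"
  proof (rule metric_LIMSEQ_I)
    fix e :: real assume "e > 0"
    then obtain k :: nat where "(1/4) ^ k < e"
      using real_arch_pow_inv[of e "1/4"] by auto
    then show "\<exists>no. \<forall>n\<ge>no. dist (X n) (abs_half_line_L2 f) < e"
      using d[of k] by (meson le_less_trans)
  qed
  then show "convergent X" by (auto simp: convergent_def)
qed

instance half_line_L2 :: banach ..

subsection \<open>Separability\<close>

lemma second_countable_if_separable:
  fixes D :: "'a::metric_space set"
  assumes "countable D" and dense: "\<And>x e. e > 0 \<Longrightarrow> \<exists>d\<in>D. dist x d < e"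
  shows "\<exists>B::'a set set. countable B \<and> open = generate_topology B"
proof -
  define B where "B = (\<lambda>(d, n). ball d (1 / real (Suc n))) ` (D \<times> (UNIV :: nat set))"
  have "topological_basis B"
  proof (rule topological_basisI)
    show "open b" if "b \<in> B" for b using that by (auto simp: B_def)
    fix U and x :: 'a assume "open U" "x \<in> U"
    then obtain e where e: "e > 0" "ball x e \<subseteq> U" by (auto simp: open_contains_ball)
    obtain n :: nat where n: "1 / real (Suc n) < e / 2"
      using e(1) nat_approx_posE[of "e / 2"] by auto
    obtain d where d: "d \<in> D" "dist x d < 1 / real (Suc n)"
      using dense[of "1 / real (Suc n)" x] by auto
    have "ball d (1 / real (Suc n)) \<subseteq> ball x e"
    proof
      fix y assume "y \<in> ball d (1 / real (Suc n))"
      then have "dist d y < 1 / real (Suc n)" by simp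
      then show "y \<in> ball x e" using d(2) n dist_triangle[of x y d] by simp
    qed
    then show "\<exists>b\<in>B. x \<in> b \<and> b \<subseteq> U"
      using d e by (intro bexI[of _ "ball d (1 / real (Suc n))"])
        (auto simp: B_def dist_commute)
  qed
  moreover have "countable B" using assms(1) by (auto simp: B_def)
  ultimately show ?thesis using topological_basis_imp_subbasis by blast
qed

definition step_fun :: "nat \<Rightarrow> nat \<Rightarrow> complex list \<Rightarrow> real \<Rightarrow> complex" where
  "step_fun K m cs x =
     (if 0 \<le> x \<and> x < real K \<and> nat \<lfloor>real m * x\<rfloor> < length cs then cs ! nat \<lfloor>real m * x\<rfloor> else 0)"

lemma borel_imp_half_line:
  "f \<in> borel_measurable borel \<Longrightarrow> f \<in> borel_measurable half_line"
  by (simp add: measurable_completion measurable_restrict_space1)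

lemma integrable_indicator_half_line: "integrable half_line (indicat_real {0..<K::real})"
proof -
  have "integrable lebesgue (indicat_real {0..<K})"
    by (intro integrable_real_indicator) (cases "0 \<le> K"; simp)+
  moreover have "(\<lambda>x. indicat_real {0..} x *\<^sub>R indicat_real {0..<K} x) = indicat_real {0..<K}"
    by (auto simp: indicator_def)
  ultimately show ?thesis by (subst integrable_restrict_space) auto
qed

lemma L2_fun_bounded:
  assumes [measurable]: "f \<in> borel_measurable half_line"
    and "\<And>x. x \<ge> 0 \<Longrightarrow> norm (f x) \<le> C * indicat_real {0..<K} x"
  shows "L2_fun f"
  unfolding L2_fun_def
proof
  have "integrable half_line (\<lambda>x. C\<^sup>2 * indicat_real {0..<K} x)"
    using integrable_indicator_half_line by simp
  then show "integrable half_line (\<lambda>x. (norm (f x))\<^sup>2)"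
  proof (rule Bochner_Integration.integrable_bound)
    show "AE x in half_line. norm ((norm (f x))\<^sup>2) \<le> norm (C\<^sup>2 * indicat_real {0..<K} x)"
    proof (rule AE_I2)
      fix x assume "x \<in> space half_line"
      then have "(norm (f x))\<^sup>2 \<le> (C * indicat_real {0..<K} x)\<^sup>2"
        using assms(2) by (intro power_mono) auto
      then show "norm ((norm (f x))\<^sup>2) \<le> norm (C\<^sup>2 * indicat_real {0..<K} x)"
        by (auto simp: indicator_def split: if_splits)
    qed
  qed measurable
qed (rule assms(1))

lemma step_fun_measurable: "step_fun K m cs \<in> borel_measurable borel"
proof -
  define g where "g i = (if i < length cs then cs ! i else 0)" for i
  have [measurable]: "(\<lambda>x::real. g (nat \<lfloor>real m * x\<rfloor>)) \<in> borel_measurable borel"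
    by measurable
  have "step_fun K m cs = (\<lambda>x. indicat_real {0..<real K} x *\<^sub>R g (nat \<lfloor>real m * x\<rfloor>))"
    by (auto simp: step_fun_def g_def indicator_def)
  then show ?thesis by simp
qed

lemma L2_fun_step_fun: "L2_fun (step_fun K m cs)"
proof (rule L2_fun_bounded[where C = "Max (insert 0 (norm ` set cs))" and K = K])
  show "step_fun K m cs \<in> borel_measurable half_line"
    by (rule borel_imp_half_line[OF step_fun_measurable])
  fix x :: real assume "x \<ge> 0"
  then show "norm (step_fun K m cs x) \<le> Max (insert 0 (norm ` set cs)) * indicat_real {0..<real K} x"
    by (auto simp: step_fun_def indicator_def)
qed

lemma half_line_L2_LIMSEQ:
  assumes f: "L2_fun f" and g: "\<And>n. L2_fun (g n)" and w: "integrable half_line w"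
    and lim: "AE x in half_line. (\<lambda>n. g n x) \<longlonglongrightarrow> f x"
    and bound: "\<And>n. AE x in half_line. (norm (g n x - f x))\<^sup>2 \<le> w x"
  shows "(\<lambda>n. abs_half_line_L2 (g n)) \<longlonglongrightarrow> abs_half_line_L2 f"
proof -
  have [measurable]: "f \<in> borel_measurable half_line" "g n \<in> borel_measurable half_line" for n
    using f g by (auto simp: L2_fun_def)
  have "(\<lambda>n. LINT x|half_line. (norm (g n x - f x))\<^sup>2) \<longlonglongrightarrow> (LINT x|half_line. 0)"
  proof (rule integral_dominated_convergence[OF _ _ w])
    show "AE x in half_line. (\<lambda>n. (norm (g n x - f x))\<^sup>2) \<longlonglongrightarrow> 0"
      using lim
    proof eventually_elim
      case (elim x)
      then have "(\<lambda>n. (norm (g n x - f x))\<^sup>2) \<longlonglongrightarrow> (norm (f x - f x))\<^sup>2"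
        by (intro tendsto_intros)
      then show ?case by simp
    qed
  qed (use bound in auto)
  then have "(\<lambda>n. (dist (abs_half_line_L2 (g n)) (abs_half_line_L2 f))\<^sup>2) \<longlonglongrightarrow> 0"
    by (simp add: dist_abs_half_line_L2 f g)
  then have "(\<lambda>n. sqrt ((dist (abs_half_line_L2 (g n)) (abs_half_line_L2 f))\<^sup>2)) \<longlonglongrightarrow> sqrt 0"
    by (rule tendsto_real_sqrt)
  then show ?thesis by (subst tendsto_dist_iff) simp
qed

lemma half_line_L2_truncate:
  fixes f :: "real \<Rightarrow> complex"
  assumes f: "L2_fun f"
  shows "(\<lambda>n. abs_half_line_L2 (\<lambda>x. indicat_real {x. x < real n \<and> norm (f x) \<le> real n} x *\<^sub>R f x))
           \<longlonglongrightarrow> abs_half_line_L2 f"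
    (is "(\<lambda>n. abs_half_line_L2 (?g n)) \<longlonglongrightarrow> _")
proof (rule half_line_L2_LIMSEQ[OF f])
  have fm [measurable]: "f \<in> borel_measurable half_line" using f by (auto simp: L2_fun_def)
  have id [measurable]: "(\<lambda>x::real. x) \<in> borel_measurable half_line"
    by (rule borel_imp_half_line) simp
  show "L2_fun (?g n)" for n
  proof (rule L2_fun_bounded[where C = n and K = n])
    have "(\<lambda>x. if x < real n \<and> norm (f x) \<le> real n then f x else 0) \<in> borel_measurable half_line"
      by measurable
    moreover have "(\<lambda>x. if x < real n \<and> norm (f x) \<le> real n then f x else 0) = ?g n"
      by (auto simp: indicator_def)
    ultimately show "?g n \<in> borel_measurable half_line" by simp
  qed (auto simp: indicator_def)
  show "integrable half_line (\<lambda>x. (norm (f x))\<^sup>2)" using f by (simp add: L2_fun_def)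
  show "AE x in half_line. (\<lambda>n. ?g n x) \<longlonglongrightarrow> f x"
  proof (rule AE_I2)
    fix x
    obtain N :: nat where N: "max x (norm (f x)) < real N" using reals_Archimedean2 by blast
    have "\<forall>\<^sub>F n in sequentially. ?g n x = f x"
      using eventually_ge_at_top[of N]
    proof eventually_elim
      case (elim n)
      then have "real N \<le> real n" by simp
      then have "x < real n" "norm (f x) \<le> real n" using N by linarith+
      then show ?case by simp
    qed
    then show "(\<lambda>n. ?g n x) \<longlonglongrightarrow> f x" by (rule tendsto_eventually)
  qed
  show "AE x in half_line. (norm (?g n x - f x))\<^sup>2 \<le> (norm (f x))\<^sup>2" for n
    by (rule AE_I2) (auto simp: indicator_def)
qed

text \<open>A bounded function supported in \<open>[0,K)\<close> is a limit of bounded continuous functions cut off at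
  \<open>K\<close>.\<close>

lemma half_line_L2_continuous:
  fixes f :: "real \<Rightarrow> complex" and K :: nat
  assumes fm [measurable]: "f \<in> borel_measurable half_line" and K: "K > 0"
    and bd: "\<And>x. norm (f x) \<le> K * indicat_real {..<real K} x"
  obtains h :: "nat \<Rightarrow> real \<Rightarrow> complex"
  where "\<And>n. continuous_on UNIV (h n)" "\<And>n x. norm (h n x) \<le> K"
    "(\<lambda>n. abs_half_line_L2 (\<lambda>x. indicat_real {..<real K} x *\<^sub>R h n x)) \<longlonglongrightarrow> abs_half_line_L2 f"
proof -
  have "f measurable_on {0..}"
    using fm by (subst measurable_on_iff_borel_measurable) auto
  then obtain N g where N: "negligible N" and g: "\<And>n. continuous_on UNIV (g n)"
    and lim: "\<And>x. x \<notin> N \<Longrightarrow> (\<lambda>n. g n x) \<longlonglongrightarrow> (if x \<in> {0..} then f x else 0)"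
    unfolding measurable_on_def by blast
  define clamp where "clamp z = (real K / max (real K) (norm z)) *\<^sub>R z" for z :: complex
  have pos: "max (real K) (norm z) > 0" for z :: complex using K by (simp add: less_max_iff_disj)
  have clamp_cont: "continuous_on UNIV clamp"
    unfolding clamp_def
  proof (intro continuous_intros ballI)
    show "max (real K) (norm z) \<noteq> 0" for z :: complex
      using pos[of z] by (rule less_imp_neq[symmetric])
  qed
  have clamp_le: "norm (clamp z) \<le> K" for z
  proof -
    have "norm (clamp z) = real K * (norm z / max (real K) (norm z))"
      using pos[of z] by (simp add: clamp_def)
    also have "\<dots> \<le> real K * 1"
      using pos[of z] by (intro mult_left_mono) auto
    finally show ?thesis by simp
  qed
  have clamp_id: "clamp z = z" if "norm z \<le> K" for z
    using that K by (simp add: clamp_def max_def)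
  define h where "h n x = clamp (g n x)" for n x
  show ?thesis
  proof (rule that[of h])
    show cont: "continuous_on UNIV (h n)" for n
      unfolding h_def by (rule continuous_on_compose2[OF clamp_cont g]) auto
    show h_le: "norm (h n x) \<le> K" for n x by (simp add: h_def clamp_le)
    show "(\<lambda>n. abs_half_line_L2 (\<lambda>x. indicat_real {..<real K} x *\<^sub>R h n x)) \<longlonglongrightarrow> abs_half_line_L2 f"
    proof (rule half_line_L2_LIMSEQ)
      show "L2_fun f"
        by (rule L2_fun_bounded[where C = K and K = K, OF fm])
           (use bd in \<open>auto simp: indicator_def split: if_splits\<close>)
      show "L2_fun (\<lambda>x. indicat_real {..<real K} x *\<^sub>R h n x)" for n
      proof (rule L2_fun_bounded[where C = K and K = K])
        have [measurable]: "h n \<in> borel_measurable borel"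
          using cont by (rule borel_measurable_continuous_onI)
        show "(\<lambda>x. indicat_real {..<real K} x *\<^sub>R h n x) \<in> borel_measurable half_line"
          by (rule borel_imp_half_line) measurable
      qed (use h_le in \<open>auto simp: indicator_def\<close>)
      show "integrable half_line (\<lambda>x. (2 * K)\<^sup>2 * indicat_real {0..<real K} x)"
        using integrable_indicator_half_line by simp
      have "AE x in lebesgue. x \<notin> N"
        using N by (intro AE_not_in) (simp add: negligible_iff_null_sets)
      then have "AE x in half_line. x \<notin> N"
        by (subst AE_restrict_space_iff) auto
      moreover have "AE x in half_line. x \<ge> 0" by (rule AE_I2) auto
      ultimately show "AE x in half_line. (\<lambda>n. indicat_real {..<real K} x *\<^sub>R h n x) \<longlonglongrightarrow> f x"
      proof eventually_elim
        case (elim x)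
        then have "(\<lambda>n. g n x) \<longlonglongrightarrow> f x" using lim[of x] by simp
        moreover have "isCont clamp (f x)"
          using clamp_cont by (simp add: continuous_on_eq_continuous_at)
        ultimately have "(\<lambda>n. h n x) \<longlonglongrightarrow> clamp (f x)"
          unfolding h_def by (rule isCont_tendsto_compose[rotated])
        moreover have "norm (f x) \<le> K"
          using bd[of x] by (cases "x < real K") auto
        ultimately have "(\<lambda>n. indicat_real {..<real K} x *\<^sub>R h n x) \<longlonglongrightarrow> indicat_real {..<real K} x *\<^sub>R f x"
          by (intro tendsto_intros) (simp add: clamp_id)
        moreover have "indicat_real {..<real K} x *\<^sub>R f x = f x"
          using bd[of x] by (auto simp: indicator_def split: if_splits)
        ultimately show ?case by simp
      qed
      show "AE x in half_line. (norm (indicat_real {..<real K} x *\<^sub>R h n x - f x))\<^sup>2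
              \<le> (2 * K)\<^sup>2 * indicat_real {0..<real K} x" for n
      proof (rule AE_I2)
        fix x assume "x \<in> space half_line"
        then have x: "x \<ge> 0" by simp
        have "norm (indicat_real {..<real K} x *\<^sub>R h n x - f x)
            \<le> norm (indicat_real {..<real K} x *\<^sub>R h n x) + norm (f x)"
          by (rule norm_triangle_ineq4)
        also have "\<dots> \<le> 2 * K * indicat_real {0..<real K} x"
          using bd[of x] h_le[of n x] x by (auto simp: indicator_def split: if_splits)
        finally have "(norm (indicat_real {..<real K} x *\<^sub>R h n x - f x))\<^sup>2
            \<le> (2 * K * indicat_real {0..<real K} x)\<^sup>2"
          by (intro power_mono) auto
        also have "\<dots> = (2 * K)\<^sup>2 * indicat_real {0..<real K} x"
          by (auto simp: indicator_def)
        finally show "(norm (indicat_real {..<real K} x *\<^sub>R h n x - f x))\<^sup>2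
              \<le> (2 * K)\<^sup>2 * indicat_real {0..<real K} x" .
      qed
    qed
  qed
qed

lemma half_line_L2_step:
  fixes h :: "real \<Rightarrow> complex" and K :: nat
  assumes h: "continuous_on UNIV h" and hb: "\<And>x. norm (h x) \<le> C" and "e > 0"
    and E: "\<And>(z::complex) d. d > 0 \<Longrightarrow> \<exists>c\<in>E. dist z c < d"
  obtains m cs where "set cs \<subseteq> E"
    "dist (abs_half_line_L2 (\<lambda>x. indicat_real {..<real K} x *\<^sub>R h x))
          (abs_half_line_L2 (step_fun K m cs)) < e"
proof -
  define d where "d = e / (2 * (real K + 1))"
  have d: "d > 0" using assms(3) by (simp add: d_def)
  have "uniformly_continuous_on {0..real K} h"
    by (intro compact_uniformly_continuous continuous_on_subset[OF h]) auto
  then obtain r where r: "r > 0"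
    and uc: "\<And>x y. x \<in> {0..real K} \<Longrightarrow> y \<in> {0..real K} \<Longrightarrow> dist x y < r \<Longrightarrow> dist (h x) (h y) < d / 2"
    unfolding uniformly_continuous_on_def using d by (metis half_gt_zero)
  obtain m0 :: nat where m0: "1 / real (Suc m0) < r" using r nat_approx_posE by blast
  define m where "m = Suc m0"
  have m: "m > 0" "1 / real m < r" using m0 by (auto simp: m_def)
  have "\<forall>i. \<exists>c. c \<in> E \<and> dist (h (real i / real m)) c < d / 2"
    using E[of "d / 2"] d by fastforce
  then obtain c where c: "\<And>i. c i \<in> E" "\<And>i::nat. dist (h (real i / real m)) (c i) < d / 2"
    by metis
  define cs where "cs = map c [0..<m * K]"
  have close: "norm (indicat_real {..<real K} x *\<^sub>R h x - step_fun K m cs x)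
      \<le> d * indicat_real {0..<real K} x" if x: "x \<ge> 0" for x
  proof (cases "x < real K")
    case True
    define i where "i = nat \<lfloor>real m * x\<rfloor>"
    have i: "real i \<le> real m * x" "real m * x < real i + 1"
      using x by (auto simp: i_def)
    have "real i < real (m * K)"
      using i(1) True m(1) by (simp add: le_less_trans)
    then have "i < m * K" by linarith
    then have st: "step_fun K m cs x = c i"
      using x True by (simp add: step_fun_def cs_def flip: i_def)
    have "real i / real m \<le> x"
      using i(1) m(1) by (simp add: pos_divide_le_eq mult.commute)
    moreover have "(real m * x - real i) / real m < 1 / real m"
      using i(2) m(1) by (intro divide_strict_right_mono) auto
    then have "x - real i / real m < 1 / real m"
      using m(1) by (simp add: diff_divide_distrib)
    ultimately have "dist x (real i / real m) < r" "real i / real m \<in> {0..real K}"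
      using m(2) True by (auto simp: dist_real_def)
    then have "dist (h x) (h (real i / real m)) < d / 2"
      using uc[of x "real i / real m"] x True by auto
    then have "dist (h x) (c i) < d"
      using c(2)[of i] dist_triangle[of "h x" "c i" "h (real i / real m)"] by simp
    then show ?thesis using x True by (simp add: st dist_norm)
  next
    case False
    then show ?thesis by (simp add: step_fun_def)
  qed
  have hK: "L2_fun (\<lambda>x. indicat_real {..<real K} x *\<^sub>R h x)"
  proof (rule L2_fun_bounded[where C = C and K = K])
    have [measurable]: "h \<in> borel_measurable borel"
      using h by (rule borel_measurable_continuous_onI)
    show "(\<lambda>x. indicat_real {..<real K} x *\<^sub>R h x) \<in> borel_measurable half_line"
      by (rule borel_imp_half_line) measurable
  qed (use hb in \<open>auto simp: indicator_def\<close>)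
  have "(dist (abs_half_line_L2 (\<lambda>x. indicat_real {..<real K} x *\<^sub>R h x))
          (abs_half_line_L2 (step_fun K m cs)))\<^sup>2
      = (LINT x|half_line. (norm (indicat_real {..<real K} x *\<^sub>R h x - step_fun K m cs x))\<^sup>2)"
    by (rule dist_abs_half_line_L2[OF hK L2_fun_step_fun])
  also have "\<dots> \<le> (LINT x|half_line. d\<^sup>2 * indicat_real {0..<real K} x)"
  proof (rule integral_mono)
    show "integrable half_line (\<lambda>x. (norm (indicat_real {..<real K} x *\<^sub>R h x - step_fun K m cs x))\<^sup>2)"
      using L2_fun_diff[OF hK L2_fun_step_fun] by (simp add: L2_fun_def)
    show "integrable half_line (\<lambda>x. d\<^sup>2 * indicat_real {0..<real K} x)"
      using integrable_indicator_half_line by simp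
    fix x assume "x \<in> space half_line"
    then have "(norm (indicat_real {..<real K} x *\<^sub>R h x - step_fun K m cs x))\<^sup>2
        \<le> (d * indicat_real {0..<real K} x)\<^sup>2"
      using close by (intro power_mono) auto
    then show "(norm (indicat_real {..<real K} x *\<^sub>R h x - step_fun K m cs x))\<^sup>2
        \<le> d\<^sup>2 * indicat_real {0..<real K} x"
      by (auto simp: indicator_def split: if_splits)
  qed
  also have "\<dots> = d\<^sup>2 * real K"
  proof -
    have "(LINT x|half_line. indicat_real {0..<real K} x) = measure half_line {0..<real K}"
      by simp (simp add: Int_absorb2 subset_eq)
    also have "\<dots> = real K"
      by (subst measure_restrict_space) auto
    finally show ?thesis by simp
  qed
  also have "\<dots> \<le> (d * (real K + 1))\<^sup>2"
  proof -
    have "real K \<le> (real K + 1)\<^sup>2" by (simp add: power2_eq_square algebra_simps)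
    then show ?thesis by (simp add: power_mult_distrib mult_left_mono)
  qed
  finally have "dist (abs_half_line_L2 (\<lambda>x. indicat_real {..<real K} x *\<^sub>R h x))
          (abs_half_line_L2 (step_fun K m cs)) \<le> d * (real K + 1)"
    by (rule power2_le_imp_le) (use d in auto)
  also have "\<dots> = e / 2" by (simp add: d_def field_simps)
  also have "\<dots> < e" using assms(3) by simp
  finally show ?thesis using that[of cs m] c(1) by (auto simp: cs_def)
qed

instance half_line_L2 :: second_countable_topology
proof
  obtain E :: "complex set" where E: "countable E" "\<And>X. open X \<Longrightarrow> X \<noteq> {} \<Longrightarrow> \<exists>c\<in>E. c \<in> X"
    using countable_dense_setE by blast
  have dense: "\<exists>c\<in>E. dist z c < d" if "d > 0" for z d
    using E(2)[of "ball z d"] that by auto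
  define D where "D = (\<lambda>(K, m, cs). abs_half_line_L2 (step_fun K m cs)) ` (UNIV \<times> UNIV \<times> lists E)"
  show "\<exists>B::half_line_L2 set set. countable B \<and> open = generate_topology B"
  proof (rule second_countable_if_separable)
    show "countable D" using E(1) by (auto simp: D_def)
    fix Y :: half_line_L2 and e :: real assume e: "e > 0"
    define f where "f = rep_half_line_L2 Y"
    have f: "L2_fun f" "Y = abs_half_line_L2 f" by (simp_all add: f_def L2_fun_rep abs_rep_half_line_L2)
    define g where "g n x = indicat_real {x. x < real n \<and> norm (f x) \<le> real n} x *\<^sub>R f x" for n x
    have lim: "(\<lambda>n. abs_half_line_L2 (g n)) \<longlonglongrightarrow> Y"
      unfolding g_def f(2) by (rule half_line_L2_truncate[OF f(1)])
    have "\<forall>\<^sub>F n in sequentially. dist (abs_half_line_L2 (g n)) Y < e / 3 \<and> n > 0"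
      using tendstoD[OF lim, of "e / 3"] e eventually_gt_at_top[of 0] by (simp add: eventually_conj)
    then obtain K where K: "dist (abs_half_line_L2 (g K)) Y < e / 3" "K > 0"
      by (auto simp: eventually_sequentially)
    have fm [measurable]: "f \<in> borel_measurable half_line" using f by (auto simp: L2_fun_def)
    have id [measurable]: "(\<lambda>x::real. x) \<in> borel_measurable half_line"
      by (rule borel_imp_half_line) simp
    have "(\<lambda>x. if x < real K \<and> norm (f x) \<le> real K then f x else 0) \<in> borel_measurable half_line"
      by measurable
    moreover have "(\<lambda>x. if x < real K \<and> norm (f x) \<le> real K then f x else 0) = g K"
      by (auto simp: g_def indicator_def)
    ultimately have gm: "g K \<in> borel_measurable half_line" by simp
    have gb: "norm (g K x) \<le> K * indicat_real {..<real K} x" for x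
      by (auto simp: g_def indicator_def)
    obtain h where h: "\<And>n. continuous_on UNIV (h n)" "\<And>n x. norm (h n x) \<le> K"
      and hl: "(\<lambda>n. abs_half_line_L2 (\<lambda>x. indicat_real {..<real K} x *\<^sub>R h n x)) \<longlonglongrightarrow> abs_half_line_L2 (g K)"
      by (rule half_line_L2_continuous[OF gm K(2) gb]) blast
    obtain n where n: "dist (abs_half_line_L2 (\<lambda>x. indicat_real {..<real K} x *\<^sub>R h n x)) (abs_half_line_L2 (g K)) < e / 3"
      using tendstoD[OF hl, of "e / 3"] e by (auto simp: eventually_sequentially)
    obtain m cs where cs: "set cs \<subseteq> E"
      "dist (abs_half_line_L2 (\<lambda>x. indicat_real {..<real K} x *\<^sub>R h n x))
            (abs_half_line_L2 (step_fun K m cs)) < e / 3"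
    proof (rule half_line_L2_step[OF h(1)[of n] h(2)[of n]])
      show "e / 3 > 0" using e by simp
      show "\<exists>c\<in>E. dist z c < d" if "d > 0" for z d using dense that .
    qed blast
    have "dist Y (abs_half_line_L2 (step_fun K m cs)) < e"
      using K(1) n cs(2)
        dist_triangle[of Y "abs_half_line_L2 (step_fun K m cs)" "abs_half_line_L2 (g K)"]
        dist_triangle[of "abs_half_line_L2 (g K)" "abs_half_line_L2 (step_fun K m cs)"
          "abs_half_line_L2 (\<lambda>x. indicat_real {..<real K} x *\<^sub>R h n x)"]
      by (simp add: dist_commute)
    then show "\<exists>d\<in>D. dist Y d < e" using cs(1) by (force simp: D_def)
  qed
qed

instance vec :: ("{metric_space, second_countable_topology}", finite) second_countable_topology
proof
  obtain B :: "'a set set" where B: "countable B" "topological_basis B"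
    using ex_countable_basis by blast
  define C where "C = (\<lambda>A. {x::'a^'b. \<forall>i. x $ i \<in> A i}) ` (UNIV \<rightarrow>\<^sub>E B)"
  have "topological_basis C"
  proof (rule topological_basisI)
    show "open U" if U: "U \<in> C" for U
    proof -
      obtain A where A: "A \<in> UNIV \<rightarrow>\<^sub>E B" "U = {x. \<forall>i. x $ i \<in> A i}" using U by (auto simp: C_def)
      then have "open (A i)" for i using B(2) by (auto simp: topological_basis_def PiE_iff)
      then show ?thesis unfolding A(2) open_vec_def by (intro ballI exI[of _ A]) auto
    qed
    fix U and x :: "'a^'b" assume "open U" "x \<in> U"
    then obtain V where "\<forall>i. open (V i) \<and> x $ i \<in> V i" and V3: "\<forall>y. (\<forall>i. y $ i \<in> V i) \<longrightarrow> y \<in> U"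
      unfolding open_vec_def by blast
    then have V: "open (V i)" "x $ i \<in> V i" for i by auto
    have "\<exists>A\<in>B. x $ i \<in> A \<and> A \<subseteq> V i" for i
      by (rule topological_basisE[OF B(2) V]) blast
    then obtain A where A: "\<And>i. A i \<in> B" "\<And>i. x $ i \<in> A i" "\<And>i. A i \<subseteq> V i" by metis
    have "{x. \<forall>i. x $ i \<in> A i} \<subseteq> U" using V3 A(3) by blast
    then show "\<exists>W\<in>C. x \<in> W \<and> W \<subseteq> U"
      using A by (intro bexI[of _ "{x. \<forall>i. x $ i \<in> A i}"]) (auto simp: C_def)
  qed
  moreover have "countable C"
    unfolding C_def using B(1) by (intro countable_image countable_PiE) auto
  ultimately show "\<exists>B::('a^'b) set set. countable B \<and> open = generate_topology B"
    using topological_basis_imp_subbasis by blast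
qed

section \<open>The star graph\<close>

text \<open>The edges are indexed by the finite type \<open>'n\<close>, and \<open>L\<^sup>2(\<G>)\<close> is the direct sum of the spaces
  \<open>L\<^sup>2(e\<^sub>j)\<close>; the library norm on \<open>_ ^ 'n\<close> is the Euclidean one.\<close>

type_synonym 'n star_L2 = "half_line_L2 ^ 'n"

definition scaleC_star :: "complex \<Rightarrow> 'n::finite star_L2 \<Rightarrow> 'n star_L2" where
  "scaleC_star c f = (\<chi> j. scaleC_half_line c (f $ j))"

definition cinner_star :: "'n::finite star_L2 \<Rightarrow> 'n star_L2 \<Rightarrow> complex" where
  "cinner_star f g = (\<Sum>j\<in>UNIV. cinner_half_line (f $ j) (g $ j))"

subsection \<open>Lebesgue norms of elements of \<open>L\<^sup>2(\<G>)\<close>\<close>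

definition edge_in_Lp :: "ereal \<Rightarrow> half_line_L2 \<Rightarrow> bool" where
  "edge_in_Lp r f \<longleftrightarrow>
     (if r = \<infinity> then esssup half_line (\<lambda>x. ereal (norm (rep_half_line_L2 f x))) < \<infinity>
      else integrable half_line (\<lambda>x. norm (rep_half_line_L2 f x) powr real_of_ereal r))"

definition edge_Lp_norm :: "ereal \<Rightarrow> half_line_L2 \<Rightarrow> real" where
  "edge_Lp_norm r f =
     (if r = \<infinity> then real_of_ereal (esssup half_line (\<lambda>x. ereal (norm (rep_half_line_L2 f x))))
      else (LINT x|half_line. norm (rep_half_line_L2 f x) powr real_of_ereal r)
             powr (1 / real_of_ereal r))"

definition star_in_Lp :: "ereal \<Rightarrow> 'n::finite star_L2 \<Rightarrow> bool" where
  "star_in_Lp r f \<longleftrightarrow> (\<forall>j. edge_in_Lp r (f $ j))"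

definition star_Lp_norm :: "ereal \<Rightarrow> 'n::finite star_L2 \<Rightarrow> real" where
  "star_Lp_norm r f =
     (if r = \<infinity> then Max (range (\<lambda>j. edge_Lp_norm \<infinity> (f $ j)))
      else (\<Sum>j\<in>UNIV. edge_Lp_norm r (f $ j) powr real_of_ereal r) powr (1 / real_of_ereal r))"

text \<open>\<open>L\<^sup>q(I; L\<^sup>r(\<G>))\<close> for functions with values in \<open>L\<^sup>2(\<G>)\<close>. Measurability refers to \<open>L\<^sup>2(\<G>)\<close>; the
  \<open>L\<^sup>r\<close> norm is lower semicontinuous on \<open>L\<^sup>2(\<G>)\<close>, so \<open>t \<mapsto> \<parallel>u(t)\<parallel>\<^sub>r\<close> is then measurable too.\<close>

definition in_LqLr :: "ereal \<Rightarrow> ereal \<Rightarrow> real set \<Rightarrow> (real \<Rightarrow> 'n::finite star_L2) \<Rightarrow> bool" where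
  "in_LqLr q r I u \<longleftrightarrow>
     u \<in> borel_measurable (lebesgue_on I) \<and>
     (AE t in lebesgue_on I. star_in_Lp r (u t)) \<and>
     (if q = \<infinity> then \<exists>C. AE t in lebesgue_on I. star_Lp_norm r (u t) \<le> C
      else integrable (lebesgue_on I) (\<lambda>t. star_Lp_norm r (u t) powr real_of_ereal q))"

subsection \<open>Laplacians and the unitary groups they generate\<close>

definition absolutely_continuous_fun_on :: "real set \<Rightarrow> (real \<Rightarrow> complex) \<Rightarrow> bool" where
  "absolutely_continuous_fun_on S f \<longleftrightarrow>
     (\<forall>e>0. \<exists>d>0. \<forall>(m::nat) a b.
        (\<forall>k<m. a k \<le> b k \<and> {a k..b k} \<subseteq> S) \<and>
        disjoint_family_on (\<lambda>k. {a k<..<b k}) {..<m} \<and> (\<Sum>k<m. b k - a k) < d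
        \<longrightarrow> (\<Sum>k<m. norm (f (b k) - f (a k))) < e)"

text \<open>\<open>star_laplacian bc f g\<close>: \<open>f\<close> is in the domain of the Laplacian with vertex condition \<open>bc\<close>
  (a relation between \<open>f(0)\<close> and \<open>f'(0+)\<close>), and \<open>g = (f\<^sub>1'', \<dots>, f\<^sub>n'')\<close>. Here \<open>\<phi> j\<close> is the absolutely
  continuous representative of \<open>f\<^sub>j\<close> and \<open>\<psi> j\<close> is \<open>f\<^sub>j'\<close>, extended continuously to the vertex, so that
  \<open>\<psi> j 0 = f\<^sub>j'(0+)\<close>. That \<open>f\<^sub>j''\<close> is in \<open>L\<^sup>2(e\<^sub>j)\<close> is expressed by the type of \<open>g\<close>.\<close>

definition star_laplacian ::
  "(complex^'n \<Rightarrow> complex^'n \<Rightarrow> bool) \<Rightarrow> 'n::finite star_L2 \<Rightarrow> 'n star_L2 \<Rightarrow> bool" where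
  "star_laplacian bc f g \<longleftrightarrow>
     (\<exists>\<phi> \<psi> :: 'n \<Rightarrow> real \<Rightarrow> complex.
        (\<forall>j. (AE x in half_line. rep_half_line_L2 (f $ j) x = \<phi> j x) \<and>
             (\<forall>R>0. absolutely_continuous_fun_on {0..R} (\<phi> j)) \<and>
             (\<forall>R>0. absolutely_continuous_fun_on {0..R} (\<psi> j)) \<and>
             (\<forall>x>0. (\<phi> j has_vector_derivative \<psi> j x) (at x)) \<and>
             (AE x in half_line. (\<psi> j has_vector_derivative rep_half_line_L2 (g $ j) x) (at x))) \<and>
        bc (\<chi> j. \<phi> j 0) (\<chi> j. \<psi> j 0))"

definition matrix_bc :: "complex^'n^'n \<Rightarrow> complex^'n^'n \<Rightarrow> complex^'n \<Rightarrow> complex^'n \<Rightarrow> bool" where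
  "matrix_bc A B v w \<longleftrightarrow> A *v v + B *v w = 0"

definition kirchhoff_bc :: "complex^'n \<Rightarrow> complex^'n \<Rightarrow> bool" where
  "kirchhoff_bc v w \<longleftrightarrow> (\<forall>j k. v $ j = v $ k) \<and> (\<Sum>j\<in>UNIV. w $ j) = 0"

definition conj_transpose :: "complex^'n^'m \<Rightarrow> complex^'m^'n" where
  "conj_transpose M = (\<chi> i j. cnj (M $ j $ i))"

definition hcat :: "complex^'n^'n \<Rightarrow> complex^'n^'n \<Rightarrow> complex^('n + 'n)^'n" where
  "hcat A B = (\<chi> i k. case k of Inl j \<Rightarrow> A $ i $ j | Inr j \<Rightarrow> B $ i $ j)"

definition condition_A1 :: "complex^'n^'n \<Rightarrow> complex^'n^'n \<Rightarrow> bool" where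
  "condition_A1 A B \<longleftrightarrow> rank (hcat A B) = CARD('n)"

definition condition_A2 :: "complex^'n^'n \<Rightarrow> complex^'n^'n \<Rightarrow> bool" where
  "condition_A2 A B \<longleftrightarrow> conj_transpose (A ** conj_transpose B) = A ** conj_transpose B"

text \<open>\<open>U t = e\<^bsup>itT\<^esup>\<close>: \<open>U\<close> is a strongly continuous unitary group whose infinitesimal generator, including
  its domain, is \<open>iT\<close> (\<open>T\<close> given by its graph). For self-adjoint \<open>T\<close> there is exactly one such \<open>U\<close>.\<close>

definition generates_unitary_group ::
  "('n::finite star_L2 \<Rightarrow> 'n star_L2 \<Rightarrow> bool) \<Rightarrow> (real \<Rightarrow> 'n star_L2 \<Rightarrow> 'n star_L2) \<Rightarrow> bool" where
  "generates_unitary_group T U \<longleftrightarrow>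
     (\<forall>t f g. U t (f + g) = U t f + U t g) \<and>
     (\<forall>t c f. U t (scaleC_star c f) = scaleC_star c (U t f)) \<and>
     (\<forall>t f g. cinner_star (U t f) (U t g) = cinner_star f g) \<and>
     (\<forall>t. surj (U t)) \<and>
     U 0 = id \<and>
     (\<forall>s t. U (s + t) = U s \<circ> U t) \<and>
     (\<forall>f. continuous_on UNIV (\<lambda>t. U t f)) \<and>
     (\<forall>f g. ((\<lambda>h. (U h f - f) /\<^sub>R h) \<longlongrightarrow> scaleC_star \<i> g) (at 0) \<longleftrightarrow> T f g)"

subsection \<open>Solutions of the nonlinear equation\<close>

definition edge_nonlinearity :: "real \<Rightarrow> half_line_L2 \<Rightarrow> half_line_L2" where
  "edge_nonlinearity p f =
     (let h = (\<lambda>x. complex_of_real (norm (rep_half_line_L2 f x) powr p) * rep_half_line_L2 f x)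
      in if L2_fun h then abs_half_line_L2 h else 0)"

text \<open>\<open>|f|\<^sup>pf\<close>, with the value 0 if it is not in \<open>L\<^sup>2(\<G>)\<close>. For an \<open>L\<^sup>2\<close>-solution \<open>u\<close> and \<open>0 < p < 1\<close> this
  exception concerns only a null set of times, since \<open>u\<close> is in \<open>L\<^sup>q(I; L\<^bsup>2p+2\<^esup>(\<G>))\<close> for an admissible
  pair \<open>(q, 2p+2)\<close>. Moreover \<open>q > p + 1\<close>, so the Duhamel integral below is a Bochner integral in
  \<open>L\<^sup>2(\<G>)\<close>.\<close>

definition nonlinearity :: "real \<Rightarrow> 'n::finite star_L2 \<Rightarrow> 'n star_L2" where
  "nonlinearity p f = (\<chi> j. edge_nonlinearity p (f $ j))"

definition admissible :: "ereal \<Rightarrow> ereal \<Rightarrow> bool" where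
  "admissible q r \<longleftrightarrow> 2 \<le> q \<and> 2 \<le> r \<and> 2 / q = 1 / 2 - 1 / r"

definition L2_solution ::
  "(real \<Rightarrow> 'n::finite star_L2 \<Rightarrow> 'n star_L2) \<Rightarrow> real \<Rightarrow> real \<Rightarrow> 'n star_L2 \<Rightarrow> real set
     \<Rightarrow> (real \<Rightarrow> 'n star_L2) \<Rightarrow> bool" where
  "L2_solution U lam p u0 I u \<longleftrightarrow>
     continuous_on I u \<and>
     (\<forall>q r. admissible q r \<longrightarrow> in_LqLr q r I u) \<and>
     (\<forall>t\<in>I.
        interval_lebesgue_integrable lborel (ereal 0) (ereal t)
          (\<lambda>s. U (t - s) (nonlinearity p (u s))) \<and>
        u t = U t u0 + scaleC_star (\<i> * complex_of_real lam)
          (LBINT s=ereal 0..ereal t. U (t - s) (nonlinearity p (u s))))"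

definition global_solution ::
  "(real \<Rightarrow> 'n::finite star_L2 \<Rightarrow> 'n star_L2) \<Rightarrow> real \<Rightarrow> real \<Rightarrow> 'n star_L2
     \<Rightarrow> (real \<Rightarrow> 'n star_L2) \<Rightarrow> bool" where
  "global_solution U lam p u0 u \<longleftrightarrow>
     (\<forall>a b. a \<le> 0 \<and> 0 \<le> b \<longrightarrow> L2_solution U lam p u0 {a..b} u)"

end

theory Submission
  imports Defs "HOL-Probability.Distributions"
begin

text \<open>The proof follows an idea of Glassey. Let \<open>\<sigma> = 1\<close> for the future and \<open>\<sigma> = -1\<close> for the past. The
  unitary map \<open>f \<mapsto> (2t)\<^bsup>1/2\<^esup> exp (- i\<sigma>ty\<^sup>2) f(2ty)\<close>, called the profile of \<open>f\<close> at the time \<open>\<sigma>t\<close>, undoes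
  the spreading and the oscillation of linear waves. Seen through it, a Kirchhoff wave with the
  initial value \<open>u\<^sub>+\<close> converges in \<open>L\<^sup>2\<close> to some \<open>\<Phi>\<close> with \<open>\<parallel>\<Phi>\<parallel> = \<parallel>u\<^sub>+\<parallel>\<close> (\<open>kirchhoff_has_profile\<close>), whereas
  the remainder \<open>l\<close> fades out, because for \<open>q < 2\<close> the scaling multiplies \<open>\<parallel>l\<parallel>\<^sub>q\<^sup>q\<close> by
  \<open>(2t)\<^bsup>q/2-1\<^esup> \<rightarrow> 0\<close>. So the profiles of \<open>u(t)\<close> are bounded in \<open>L\<^sup>2\<close> and, but for a null set of times, converge
  to \<open>\<Phi>\<close> locally in \<open>L\<^sup>1\<close>.

  The solution is tested with waves \<open>v\<close> that have the constant profile \<open>\<eta>(y) = c y\<^sup>2 exp (- k y\<^sup>2)\<close>. These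
  solve the linear equation up to an error of size \<open>t\<^bsup>-2\<^esup>\<close> in \<open>L\<^sup>2\<close> and vanish to second order at the vertex,
  so they are in the domain of the Laplacian for every linear vertex condition (\<open>test_wave\<close>). As \<open>u\<close> is
  bounded in \<open>L\<^sup>2\<close> for large times, the product rule \<open>inner_increment\<close> shows that the integral of
  \<open>Re \<langle>\<bar>u\<bar>\<^sup>pu, v\<rangle>\<close> over \<open>(S,T)\<close> stays bounded as \<open>T \<rightarrow> \<infinity>\<close>. On the other hand \<open>\<langle>\<bar>u\<bar>\<^sup>pu, v\<rangle>\<close> is
  \<open>(2t)\<^bsup>-p/2\<^esup>\<close> times the pairing of \<open>\<bar>z\<bar>\<^sup>pz\<close> with \<open>\<eta>\<close>, where \<open>z\<close> is the profile of \<open>u(t)\<close>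
  (\<open>inner_nonlinearity\<close>), and this pairing tends to that of \<open>\<bar>\<Phi>\<bar>\<^sup>p\<Phi>\<close> with \<open>\<eta>\<close> (\<open>pairing_tendsto\<close>); here
  \<open>p < 1\<close> makes the \<open>L\<^sup>2\<close> bound control the nonlinearity. Since \<open>t\<^bsup>-p/2\<^esup>\<close> is not integrable at
  infinity, the limit is zero for all \<open>c\<close> and \<open>k\<close>. Gaussian moments determine a function, so
  \<open>\<bar>\<Phi>\<bar>\<^sup>p\<Phi> = 0\<close>, whence \<open>\<Phi> = 0\<close> and \<open>u\<^sub>+ = 0\<close>.

  No integral kernel of a group is computed. All explicit waves have the form
  \<open>\<alpha>(t) x\<^sup>m exp (- \<beta>(t) x\<^sup>2)\<close> on each edge: \<open>m = 2\<close> for the test waves; \<open>m = 0\<close> with equal weights and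
  \<open>m = 1\<close> with weights of sum zero for exact Kirchhoff waves, which are total in \<open>L\<^sup>2\<close> and determine the
  asymptotics of all others by density.\<close>

section \<open>Integrals over the half-line\<close>

lemma half_line_integrable_scale:
  fixes f :: "real \<Rightarrow> 'a::euclidean_space"
  assumes "c > 0"
  shows "integrable half_line (\<lambda>x. f (c * x)) \<longleftrightarrow> integrable half_line f"
proof -
  have "(\<lambda>x. indicat_real {0..} x *\<^sub>R f (c * x))
      = (\<lambda>x. indicat_real {0..} (0 + c * x) *\<^sub>R f (0 + c * x))"
    using assms by (auto simp: fun_eq_iff indicator_def zero_le_mult_iff)
  then show ?thesis
    using lebesgue_integrable_real_affine_iff[of c "\<lambda>x. indicat_real {0..} x *\<^sub>R f x" 0] assms
    by (simp add: integrable_restrict_space)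
qed

lemma half_line_integral_scale:
  fixes f :: "real \<Rightarrow> 'a::euclidean_space"
  assumes "c > 0"
  shows "(LINT x|half_line. f x) = c *\<^sub>R (LINT x|half_line. f (c * x))"
proof -
  have "(\<lambda>x. indicat_real {0..} x *\<^sub>R f (c * x))
      = (\<lambda>x. indicat_real {0..} (0 + c * x) *\<^sub>R f (0 + c * x))"
    using assms by (auto simp: fun_eq_iff indicator_def zero_le_mult_iff)
  then show ?thesis
    using lebesgue_integral_real_affine[of c "\<lambda>x. indicat_real {0..} x *\<^sub>R f x" 0] assms
    by (simp add: integral_restrict_space)
qed

lemma half_line_measurable_scale:
  assumes "c > 0" "f \<in> borel_measurable half_line"
  shows "(\<lambda>x. f (c * x)) \<in> borel_measurable half_line"
proof -
  have "(\<lambda>x. c *\<^sub>R x) \<in> half_line \<rightarrow>\<^sub>M half_line"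
  proof (rule measurable_restrict_space3[OF lebesgue_measurable_scaling])
    show "(\<lambda>x. c *\<^sub>R x) \<in> {0::real..} \<rightarrow> {0..}" using assms(1) by auto
  qed
  from measurable_compose[OF this assms(2)] show ?thesis by simp
qed

lemma AE_half_line_iff: "(AE x in half_line. P x) \<longleftrightarrow> negligible {x. 0 \<le> x \<and> \<not> P x}"
proof -
  have "(AE x in half_line. P x) \<longleftrightarrow> (AE x in lebesgue. 0 \<le> x \<longrightarrow> P x)"
    by (subst AE_restrict_space_iff) auto
  also have "\<dots> \<longleftrightarrow> (\<exists>N. negligible N \<and> {x. 0 \<le> x \<and> \<not> P x} \<subseteq> N)"
    by (auto simp: eventually_ae_filter negligible_iff_null_sets)
  also have "\<dots> \<longleftrightarrow> negligible {x. 0 \<le> x \<and> \<not> P x}"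
    by (auto intro: negligible_subset)
  finally show ?thesis .
qed

lemma AE_half_line_scale:
  assumes "c > 0" "AE x in half_line. P x"
  shows "AE x in half_line. P (c * x)"
proof -
  have "negligible ((\<lambda>x. (1 / c) *\<^sub>R x) ` {x. 0 \<le> x \<and> \<not> P x})"
    using assms(2)
    by (intro negligible_differentiable_image_negligible linear_imp_differentiable_on linear_scaleR)
       (auto simp: AE_half_line_iff)
  moreover have "{x. 0 \<le> x \<and> \<not> P (c * x)} \<subseteq> (\<lambda>x. (1 / c) *\<^sub>R x) ` {x. 0 \<le> x \<and> \<not> P x}"
  proof
    fix x assume "x \<in> {x. 0 \<le> x \<and> \<not> P (c * x)}"
    then show "x \<in> (\<lambda>x. (1 / c) *\<^sub>R x) ` {x. 0 \<le> x \<and> \<not> P x}"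
      using assms(1) by (intro image_eqI[of _ _ "c * x"]) auto
  qed
  ultimately show ?thesis
    unfolding AE_half_line_iff by (rule negligible_subset)
qed

lemma AE_half_line_nonneg: "AE x in half_line. 0 \<le> x"
  by (rule AE_I2) simp

text \<open>Under \<open>y \<mapsto> exp (- y\<^sup>2)\<close> the half-line becomes \<open>(0,1]\<close> and the Gaussians \<open>exp (- k y\<^sup>2)\<close> become the
  monomials, so the Weierstrass approximation theorem applies.\<close>

lemma integral_gaussian_polynomial_zero:
  fixes H :: "real \<Rightarrow> real"
  assumes H: "integrable half_line H"
    and zero: "\<And>k::nat. (LINT y|half_line. H y * exp (- (real k * y\<^sup>2))) = 0"
    and g: "continuous_on {0..1} g"
  shows "(LINT y|half_line. H y * g (exp (- y\<^sup>2))) = 0"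
proof (rule ccontr)
  let ?I = "LINT y|half_line. H y * g (exp (- y\<^sup>2))"
  let ?N = "LINT y|half_line. \<bar>H y\<bar>"
  assume "?I \<noteq> 0"
  define e where "e = \<bar>?I\<bar> / (2 * (?N + 1))"
  have N: "?N \<ge> 0" by simp
  then have N2: "2 * (?N + 1) > 0" by (intro mult_pos_pos add_nonneg_pos) auto
  then have e: "e > 0" using \<open>?I \<noteq> 0\<close> unfolding e_def by (intro divide_pos_pos) auto
  obtain P where P: "real_polynomial_function P" "\<And>x. x \<in> {0..1} \<Longrightarrow> \<bar>g x - P x\<bar> < e"
    using Stone_Weierstrass_real_polynomial_function[of "{0..1::real}" g e] g e by auto
  obtain a n where Pa: "P = (\<lambda>x. \<Sum>i\<le>n. a i * x ^ i)"
    using real_polynomial_function_imp_sum[OF P(1)] by blast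
  have [measurable]: "H \<in> borel_measurable half_line" using H by auto
  have [measurable]: "(\<lambda>y. g (exp (- y\<^sup>2))) \<in> borel_measurable half_line"
    by (intro borel_imp_half_line borel_measurable_continuous_onI continuous_on_compose2[OF g])
       (auto intro!: continuous_intros)
  have em [measurable]: "(\<lambda>y::real. exp (- (real k * y\<^sup>2))) \<in> borel_measurable half_line" for k
    by (rule borel_imp_half_line) measurable
  have intk: "integrable half_line (\<lambda>y. H y * exp (- (real k * y\<^sup>2)))" for k
    by (rule Bochner_Integration.integrable_bound[OF H])
       (auto simp: abs_mult intro!: AE_I2 mult_left_le)
  have Pexp: "H y * P (exp (- y\<^sup>2)) = (\<Sum>k\<le>n. a k * (H y * exp (- (real k * y\<^sup>2))))" for y
    unfolding Pa sum_distrib_left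
    by (intro sum.cong refl) (simp add: exp_of_nat_mult[symmetric])
  have intP: "integrable half_line (\<lambda>y. H y * P (exp (- y\<^sup>2)))"
    unfolding Pexp by (intro Bochner_Integration.integrable_sum integrable_mult_right intk)
  have zP: "(LINT y|half_line. H y * P (exp (- y\<^sup>2))) = 0"
    unfolding Pexp
    by (subst Bochner_Integration.integral_sum) (auto intro!: integrable_mult_right intk simp: zero)
  have "compact (g ` {0..1})" using g by (intro compact_continuous_image) auto
  then obtain B where B: "\<And>x. x \<in> {0..1} \<Longrightarrow> \<bar>g x\<bar> \<le> B"
    by (metis bounded_iff compact_imp_bounded image_eqI real_norm_def)
  have intg: "integrable half_line (\<lambda>y. H y * g (exp (- y\<^sup>2)))"
  proof (rule Bochner_Integration.integrable_bound)
    show "integrable half_line (\<lambda>y. B * H y)" using H by simp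
    show "AE y in half_line. norm (H y * g (exp (- y\<^sup>2))) \<le> norm (B * H y)"
    proof (rule AE_I2)
      fix y :: real
      have "\<bar>g (exp (- y\<^sup>2))\<bar> \<le> B" using B by auto
      then have "\<bar>g (exp (- y\<^sup>2))\<bar> \<le> \<bar>B\<bar>" by simp
      then have "\<bar>H y\<bar> * \<bar>g (exp (- y\<^sup>2))\<bar> \<le> \<bar>H y\<bar> * \<bar>B\<bar>" by (rule mult_left_mono) simp
      then show "norm (H y * g (exp (- y\<^sup>2))) \<le> norm (B * H y)" by (simp add: abs_mult mult.commute)
    qed
  qed measurable
  have "?I = (LINT y|half_line. H y * g (exp (- y\<^sup>2)) - H y * P (exp (- y\<^sup>2)))"
    by (subst Bochner_Integration.integral_diff[OF intg intP]) (simp add: zP)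
  also have "\<bar>\<dots>\<bar> \<le> (LINT y|half_line. e * \<bar>H y\<bar>)"
  proof (rule order_trans[OF integral_abs_bound], rule integral_mono)
    show "integrable half_line (\<lambda>y. \<bar>H y * g (exp (- y\<^sup>2)) - H y * P (exp (- y\<^sup>2))\<bar>)"
      using intg intP by auto
    show "integrable half_line (\<lambda>y. e * \<bar>H y\<bar>)" using H by auto
    fix y :: real
    have "\<bar>g (exp (- y\<^sup>2)) - P (exp (- y\<^sup>2))\<bar> \<le> e" using P(2)[of "exp (- y\<^sup>2)"] by auto
    then have "\<bar>g (exp (- y\<^sup>2)) - P (exp (- y\<^sup>2))\<bar> * \<bar>H y\<bar> \<le> e * \<bar>H y\<bar>"
      by (rule mult_right_mono) simp
    then show "\<bar>H y * g (exp (- y\<^sup>2)) - H y * P (exp (- y\<^sup>2))\<bar> \<le> e * \<bar>H y\<bar>"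
      by (simp add: abs_mult[symmetric] algebra_simps)
  qed
  also have "\<dots> = e * ?N" by simp
  also have "\<dots> = \<bar>?I\<bar> * (?N / (2 * (?N + 1)))" by (simp add: e_def)
  also have "\<dots> < \<bar>?I\<bar> * 1"
  proof (rule mult_strict_left_mono)
    have "?N < 2 * (?N + 1)" using N by (simp only: distrib_left)
    with N2 show "?N / (2 * (?N + 1)) < 1" by (simp only: divide_less_eq_1_pos)
  qed (use \<open>?I \<noteq> 0\<close> in simp)
  finally show False by simp
qed

text \<open>Injectivity of the Laplace transform in \<open>y\<^sup>2\<close>. The sign of \<open>H\<close> is an almost everywhere limit of
  continuous functions; clamped to \<open>[-1,1]\<close> and cut off at infinity, these are continuous functions of
  \<open>exp (- y\<^sup>2)\<close> on all of \<open>[0,1]\<close>, and testing \<open>H\<close> against them gives \<open>\<integral> \<bar>H\<bar> = 0\<close> in the limit.\<close>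

lemma gaussian_moments_zero_imp_AE_zero:
  fixes H :: "real \<Rightarrow> real"
  assumes H: "integrable half_line H"
    and zero: "\<And>k::nat. (LINT y|half_line. H y * exp (- (real k * y\<^sup>2))) = 0"
  shows "AE y in half_line. H y = 0"
proof -
  have Hm [measurable]: "H \<in> borel_measurable half_line" using H by auto
  have "(\<lambda>y. sgn (H y)) measurable_on {0..}"
    by (subst measurable_on_iff_borel_measurable) (simp_all, measurable)
  then obtain N g where N: "negligible N" and g: "\<And>n. continuous_on UNIV (g n)"
    and lim: "\<And>x. x \<notin> N \<Longrightarrow> (\<lambda>n. g n x) \<longlonglongrightarrow> (if x \<in> {0..} then sgn (H x) else 0)"
    unfolding measurable_on_def by blast
  define h where "h n y = max (- 1) (min 1 (g n y)) * max 0 (min 1 (real n - y))" for n y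
  have h_cont: "continuous_on UNIV (h n)" for n
    unfolding h_def by (intro continuous_intros g)
  have [measurable]: "h n \<in> borel_measurable half_line" for n
    using h_cont by (intro borel_imp_half_line borel_measurable_continuous_onI)
  have h_le: "\<bar>h n y\<bar> \<le> 1" for n y
  proof -
    have "\<bar>h n y\<bar> \<le> 1 * 1" unfolding h_def abs_mult by (intro mult_mono) auto
    then show ?thesis by simp
  qed
  have h_zero: "h n y = 0" if "y \<ge> real n" for n y
    using that by (simp add: h_def)
  have int0: "(LINT y|half_line. H y * h n y) = 0" for n
  proof -
    \<comment> \<open>The maximum keeps the logarithm away from 0; it changes nothing, as \<open>h n\<close> vanishes beyond \<open>n\<close>.\<close>
    define G where "G x = h n (sqrt (- ln (max x (exp (- (real n)\<^sup>2)))))" for x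
    have "continuous_on {0..1} G"
      unfolding G_def
      by (intro continuous_on_compose2[OF h_cont] continuous_intros ballI)
         (auto simp: max_def not_le intro: less_le_trans[OF exp_gt_zero])
    then have "(LINT y|half_line. H y * G (exp (- y\<^sup>2))) = 0"
      by (rule integral_gaussian_polynomial_zero[OF assms])
    moreover have "G (exp (- y\<^sup>2)) = h n y" if "y \<ge> 0" for y
    proof (cases "y \<le> real n")
      case True
      then have "y\<^sup>2 \<le> (real n)\<^sup>2" using that by (intro power_mono) auto
      then show ?thesis using that by (simp add: G_def max_def)
    next
      case False
      then have "(real n)\<^sup>2 < y\<^sup>2" by (intro power_strict_mono) auto
      then show ?thesis using False h_zero[of n y] h_zero[of n n] by (simp add: G_def max_def)
    qed
    ultimately show ?thesis
      by (subst (asm) Bochner_Integration.integral_cong[where g = "\<lambda>y. H y * h n y"]) auto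
  qed
  have "(\<lambda>n. LINT y|half_line. H y * h n y) \<longlonglongrightarrow> (LINT y|half_line. \<bar>H y\<bar>)"
  proof (rule integral_dominated_convergence[where w = "\<lambda>y. \<bar>H y\<bar>"])
    have "AE x in half_line. x \<notin> N"
      using N unfolding AE_half_line_iff by (rule negligible_subset) auto
    with AE_half_line_nonneg show "AE y in half_line. (\<lambda>n. H y * h n y) \<longlonglongrightarrow> \<bar>H y\<bar>"
    proof eventually_elim
      case (elim y)
      have "(\<lambda>n. max 0 (min 1 (real n - y))) \<longlonglongrightarrow> 1"
      proof (rule tendsto_eventually)
        obtain m :: nat where m: "y + 1 \<le> real m" using real_arch_simple by blast
        show "\<forall>\<^sub>F n in sequentially. max 0 (min 1 (real n - y)) = 1"
          using eventually_ge_at_top[of m]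
          proof eventually_elim
            case (elim n)
            then have "real m \<le> real n" by simp
            with m have "1 \<le> real n - y" by linarith
            then show ?case by simp
          qed
      qed
      then have "(\<lambda>n. H y * h n y) \<longlonglongrightarrow> H y * (max (- 1) (min 1 (sgn (H y))) * 1)"
        unfolding h_def using lim[of y] elim by (intro tendsto_intros) auto
      also have "H y * (max (- 1) (min 1 (sgn (H y))) * 1) = \<bar>H y\<bar>"
        by (auto simp: sgn_if)
      finally show ?case .
    qed
    show "AE y in half_line. norm (H y * h n y) \<le> \<bar>H y\<bar>" for n
      using h_le by (intro AE_I2) (auto simp: abs_mult intro!: mult_left_le)
  qed (use H in auto)
  then have "(LINT y|half_line. \<bar>H y\<bar>) = 0"
    using int0 LIMSEQ_unique[OF _ tendsto_const] by simp
  then show ?thesis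
    using integral_nonneg_eq_0_iff_AE[of half_line "\<lambda>y. \<bar>H y\<bar>"] H by auto
qed

lemma complex_gaussian_moments_zero_imp_AE_zero:
  fixes H :: "real \<Rightarrow> complex"
  assumes H: "integrable half_line H"
    and zero: "\<And>k::nat. (LINT y|half_line. H y * complex_of_real (exp (- (real k * y\<^sup>2)))) = 0"
  shows "AE y in half_line. H y = 0"
proof -
  have int: "integrable half_line (\<lambda>y. H y * complex_of_real (exp (- (real k * y\<^sup>2))))" for k
  proof (rule Bochner_Integration.integrable_bound[OF H])
    have [measurable]: "(\<lambda>y::real. exp (- (real k * y\<^sup>2))) \<in> borel_measurable half_line"
      by (rule borel_imp_half_line) measurable
    have [measurable]: "H \<in> borel_measurable half_line" using H by auto
    show "(\<lambda>y. H y * complex_of_real (exp (- (real k * y\<^sup>2)))) \<in> borel_measurable half_line"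
      by measurable
  qed (auto simp: norm_mult simp del: of_real_exp intro!: AE_I2 mult_left_le)
  have "AE y in half_line. Re (H y) = 0"
  proof (rule gaussian_moments_zero_imp_AE_zero)
    show "integrable half_line (\<lambda>y. Re (H y))" using H by auto
    show "(LINT y|half_line. Re (H y) * exp (- (real k * y\<^sup>2))) = 0" for k
      using arg_cong[OF zero[of k], of Re] integral_Re[OF int[of k]]
      by (simp del: of_real_exp)
  qed
  moreover have "AE y in half_line. Im (H y) = 0"
  proof (rule gaussian_moments_zero_imp_AE_zero)
    show "integrable half_line (\<lambda>y. Im (H y))" using H by auto
    show "(LINT y|half_line. Im (H y) * exp (- (real k * y\<^sup>2))) = 0" for k
      using arg_cong[OF zero[of k], of Im] integral_Im[OF int[of k]]
      by (simp del: of_real_exp)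
  qed
  ultimately show ?thesis by eventually_elim (simp add: complex_eq_iff)
qed

section \<open>Representatives and complex scalars\<close>

lemma half_line_L2_eqI:
  assumes "AE x in half_line. rep_half_line_L2 f x = rep_half_line_L2 g x"
  shows "f = g"
proof -
  have "L2_eq (rep_half_line_L2 f) (rep_half_line_L2 g)"
    using assms by (simp add: L2_eq_def L2_fun_rep)
  then have "abs_half_line_L2 (rep_half_line_L2 f) = abs_half_line_L2 (rep_half_line_L2 g)"
    using Quotient_rel_abs[OF Quotient_half_line_L2] by blast
  then show ?thesis by (simp add: abs_rep_half_line_L2)
qed

lemma abs_half_line_L2_cong:
  assumes "L2_fun f" "L2_fun g" "AE x in half_line. f x = g x"
  shows "abs_half_line_L2 f = abs_half_line_L2 g"
  using Quotient_rel_abs[OF Quotient_half_line_L2] assms by (auto simp: L2_eq_def)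

lemma plus_abs_half_line_L2:
  assumes "L2_fun f" "L2_fun g"
  shows "abs_half_line_L2 f + abs_half_line_L2 g = abs_half_line_L2 (\<lambda>x. f x + g x)"
  using assms by (intro plus_half_line_L2.abs_eq) (auto simp: L2_eq_def)

lemma scaleC_abs_half_line_L2:
  assumes "L2_fun f"
  shows "scaleC_half_line c (abs_half_line_L2 f) = abs_half_line_L2 (\<lambda>x. c * f x)"
  using assms by (intro scaleC_half_line.abs_eq) (auto simp: L2_eq_def)

lemma AE_rep_add: "AE x in half_line. rep_half_line_L2 (f + g) x = rep_half_line_L2 f x + rep_half_line_L2 g x"
  using rep_abs_half_line_L2[OF L2_fun_add[OF L2_fun_rep[of f] L2_fun_rep[of g]]]
  by (simp add: plus_abs_half_line_L2[OF L2_fun_rep L2_fun_rep, symmetric] abs_rep_half_line_L2)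

lemma AE_rep_scaleC: "AE x in half_line. rep_half_line_L2 (scaleC_half_line c f) x = c * rep_half_line_L2 f x"
  using rep_abs_half_line_L2[OF L2_fun_scale[OF L2_fun_rep[of f], of c]]
  by (simp add: scaleC_abs_half_line_L2[OF L2_fun_rep, symmetric] abs_rep_half_line_L2)

lemma AE_rep_diff: "AE x in half_line. rep_half_line_L2 (f - g) x = rep_half_line_L2 f x - rep_half_line_L2 g x"
  using rep_abs_half_line_L2[OF L2_fun_diff[OF L2_fun_rep[of f] L2_fun_rep[of g]]]
  by (simp add: abs_diff_half_line_L2[OF L2_fun_rep L2_fun_rep, symmetric] abs_rep_half_line_L2)

lemma norm_half_line_L2_eq: "(norm f)\<^sup>2 = (LINT x|half_line. (norm (rep_half_line_L2 f x))\<^sup>2)"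
  using norm_abs_half_line_L2[OF L2_fun_rep[of f]] by (simp add: abs_rep_half_line_L2)

lemma norm_abs_half_line_L2_le:
  assumes "L2_fun f" "L2_fun g" "C \<ge> 0" "\<And>x. x \<ge> 0 \<Longrightarrow> norm (f x) \<le> C * norm (g x)"
  shows "norm (abs_half_line_L2 f) \<le> C * norm (abs_half_line_L2 g)"
proof (rule power2_le_imp_le)
  have "(LINT x|half_line. (norm (f x))\<^sup>2) \<le> (LINT x|half_line. C\<^sup>2 * (norm (g x))\<^sup>2)"
  proof (rule integral_mono)
    fix x assume "x \<in> space half_line"
    then have "(norm (f x))\<^sup>2 \<le> (C * norm (g x))\<^sup>2" using assms(4) by (intro power_mono) auto
    then show "(norm (f x))\<^sup>2 \<le> C\<^sup>2 * (norm (g x))\<^sup>2" by (simp add: power_mult_distrib)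
  qed (use assms in \<open>auto simp: L2_fun_def\<close>)
  then show "(norm (abs_half_line_L2 f))\<^sup>2 \<le> (C * norm (abs_half_line_L2 g))\<^sup>2"
    using assms by (simp add: norm_abs_half_line_L2 power_mult_distrib)
qed (use assms in auto)

lemma scaleC_half_line_add_left:
  "scaleC_half_line (a + b) f = scaleC_half_line a f + scaleC_half_line b f"
  by transfer (simp add: L2_eq_def L2_fun_add L2_fun_scale distrib_right)

lemma scaleC_half_line_add_right:
  "scaleC_half_line a (f + g) = scaleC_half_line a f + scaleC_half_line a g"
  by transfer (simp add: L2_eq_def L2_fun_add L2_fun_scale distrib_left)

lemma scaleC_half_line_scaleC: "scaleC_half_line a (scaleC_half_line b f) = scaleC_half_line (a * b) f"
  by transfer (simp add: L2_eq_def L2_fun_scale mult.assoc)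

lemma scaleC_half_line_of_real: "scaleC_half_line (of_real r) f = r *\<^sub>R f"
  by transfer (simp add: L2_eq_def L2_fun_scale)

lemma scaleC_half_line_one [simp]: "scaleC_half_line 1 f = f"
  using scaleC_half_line_of_real[of 1 f] by simp

lemma scaleC_half_line_zero [simp]: "scaleC_half_line 0 f = 0"
  using scaleC_half_line_of_real[of 0 f] by simp

lemma scaleC_half_line_scaleR_left: "scaleC_half_line (r *\<^sub>R a) f = r *\<^sub>R scaleC_half_line a f"
  by (simp add: scaleC_half_line_of_real[symmetric] scaleC_half_line_scaleC scaleR_conv_of_real)

lemma scaleC_half_line_scaleR_right: "scaleC_half_line a (r *\<^sub>R f) = r *\<^sub>R scaleC_half_line a f"
  by (simp add: scaleC_half_line_of_real[symmetric] scaleC_half_line_scaleC mult.commute)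

lemma norm_scaleC_half_line: "norm (scaleC_half_line c f) = norm c * norm f"
proof -
  have "(norm (scaleC_half_line c (abs_half_line_L2 (rep_half_line_L2 f))))\<^sup>2 = (norm c * norm (abs_half_line_L2 (rep_half_line_L2 f)))\<^sup>2"
    by (simp add: scaleC_abs_half_line_L2 L2_fun_rep norm_abs_half_line_L2 L2_fun_scale norm_mult
        power_mult_distrib)
  then show ?thesis by (simp add: abs_rep_half_line_L2 power2_eq_iff_nonneg)
qed

text \<open>One function on all edges, with a complex weight on each. All explicit waves below have this
  form, which reduces their calculus to that of a single half-line.\<close>

definition tensor :: "complex^'n \<Rightarrow> half_line_L2 \<Rightarrow> 'n::finite star_L2" where
  "tensor c f = (\<chi> j. scaleC_half_line (c $ j) f)"

lemma norm_tensor: "norm (tensor c f) = norm c * norm f"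
  by (simp add: tensor_def norm_vec_def norm_scaleC_half_line L2_set_left_distrib)

lemma bounded_bilinear_tensor: "bounded_bilinear (tensor :: complex^'n \<Rightarrow> half_line_L2 \<Rightarrow> 'n::finite star_L2)"
proof
  show "\<exists>K. \<forall>a b. norm (tensor a b :: 'n star_L2) \<le> norm a * norm b * K"
    by (rule exI[of _ 1]) (simp add: norm_tensor)
qed (simp_all add: tensor_def vec_eq_iff scaleC_half_line_add_left scaleC_half_line_add_right
      scaleC_half_line_scaleR_left scaleC_half_line_scaleR_right)

interpretation tensor: bounded_bilinear "tensor :: complex^'n \<Rightarrow> half_line_L2 \<Rightarrow> 'n::finite star_L2"
  by (rule bounded_bilinear_tensor)

lemma tensor_scaleC: "tensor c (scaleC_half_line a f) = tensor (a *s c) f"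
  by (simp add: tensor_def vec_eq_iff scaleC_half_line_scaleC mult.commute)

lemma scaleC_star_tensor: "scaleC_star a (tensor c f) = tensor (a *s c) f"
  by (simp add: tensor_def scaleC_star_def vec_eq_iff scaleC_half_line_scaleC)

lemma scaleC_star_of_real: "scaleC_star (of_real r) f = r *\<^sub>R f"
  by (simp add: scaleC_star_def vec_eq_iff scaleC_half_line_of_real)

lemma scaleC_star_scaleC: "scaleC_star a (scaleC_star b f) = scaleC_star (a * b) f"
  by (simp add: scaleC_star_def vec_eq_iff scaleC_half_line_scaleC)

lemma norm_scaleC_star: "norm (scaleC_star c f) = norm c * norm f"
  by (simp add: scaleC_star_def norm_vec_def norm_scaleC_half_line L2_set_right_distrib)

lemma bounded_linear_scaleC_star: "bounded_linear (scaleC_star c)"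
proof
  show "\<exists>K. \<forall>f. norm (scaleC_star c f) \<le> norm f * K"
    by (rule exI[of _ "norm c"]) (simp add: norm_scaleC_star)
qed (simp_all add: scaleC_star_def vec_eq_iff scaleC_half_line_add_right scaleC_half_line_scaleR_right)

lemma Re_cinner_star: "Re (cinner_star f g) = inner f g"
  by (simp add: cinner_star_def inner_vec_def inner_half_line_L2_def)

section \<open>Gaussians\<close>

lemma integrable_gaussian_even:
  assumes "b > 0"
  shows "integrable half_line (\<lambda>x. x ^ (2 * k) * exp (- (b * x\<^sup>2)))"
proof -
  have "integrable lborel (\<lambda>x::real. indicator {0..} x *\<^sub>R (exp (- x\<^sup>2) * x ^ (2 * k)))"
    using gaussian_moment_even_pos[of k] by (rule integrable.intros)
  then have "integrable half_line (\<lambda>x::real. exp (- x\<^sup>2) * x ^ (2 * k))"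
    by (simp add: integrable_restrict_space integrable_completion)
  then have "integrable half_line (\<lambda>x::real. exp (- (sqrt b * x)\<^sup>2) * (sqrt b * x) ^ (2 * k))"
    using half_line_integrable_scale[of "sqrt b" "\<lambda>x::real. exp (- x\<^sup>2) * x ^ (2 * k)"] assms by simp
  moreover have "exp (- (sqrt b * x)\<^sup>2) * (sqrt b * x) ^ (2 * k) = b ^ k * (x ^ (2 * k) * exp (- (b * x\<^sup>2)))" for x
    using assms by (simp add: power_mult_distrib power_mult)
  ultimately show ?thesis using assms by simp
qed

text \<open>Every explicit wave below is at each time a multiple of \<open>x\<^sup>m exp (- \<beta> x\<^sup>2)\<close> on each edge, with a
  complex \<open>\<beta>\<close> that carries the oscillation.\<close>

definition gauss_fun :: "nat \<Rightarrow> complex \<Rightarrow> real \<Rightarrow> complex" where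
  "gauss_fun m \<beta> x = of_real x ^ m * exp (- (\<beta> * (of_real x)\<^sup>2))"

definition gauss :: "nat \<Rightarrow> complex \<Rightarrow> half_line_L2" where
  "gauss m \<beta> = abs_half_line_L2 (gauss_fun m \<beta>)"

lemma Re_of_real_power_mult: "Re (z * (of_real x)\<^sup>2) = Re z * x\<^sup>2"
  by (simp flip: of_real_power)

lemma norm_gauss_fun: "norm (gauss_fun m \<beta> x) = \<bar>x\<bar> ^ m * exp (- (Re \<beta> * x\<^sup>2))"
  by (simp add: gauss_fun_def norm_mult norm_power Re_of_real_power_mult)

lemma gauss_fun_measurable [measurable]: "gauss_fun m \<beta> \<in> borel_measurable half_line"
  unfolding gauss_fun_def by (intro borel_imp_half_line borel_measurable_continuous_onI continuous_intros)

lemma L2_fun_gauss: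
  assumes "Re \<beta> > 0"
  shows "L2_fun (gauss_fun m \<beta>)"
proof -
  have "(norm (gauss_fun m \<beta> x))\<^sup>2 = x ^ (2 * m) * exp (- (2 * Re \<beta> * x\<^sup>2))" for x
    by (simp add: norm_gauss_fun power_mult_distrib power_mult[symmetric] mult.commute[of m]
        exp_double[symmetric] power_even_abs)
  then show ?thesis
    using integrable_gaussian_even[of "2 * Re \<beta>" m] assms by (simp add: L2_fun_def)
qed

lemma AE_rep_gauss:
  "Re \<beta> > 0 \<Longrightarrow> AE x in half_line. rep_half_line_L2 (gauss m \<beta>) x = gauss_fun m \<beta> x"
  unfolding gauss_def by (rule rep_abs_half_line_L2[OF L2_fun_gauss])

text \<open>The Taylor remainder of the exponential costs a factor \<open>exp (\<bar>h\<bar> x\<^sup>2)\<close>, which half of the decay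
  \<open>exp (- Re \<beta> x\<^sup>2)\<close> absorbs.\<close>

lemma gauss_remainder:
  assumes "Re \<beta> > 0" "norm h \<le> Re \<beta> / 2"
  shows "norm (gauss m (\<beta> + h) - gauss m \<beta> - scaleC_half_line (- h) (gauss (m + 2) \<beta>))
           \<le> (norm h)\<^sup>2 * norm (gauss (m + 4) (of_real (Re \<beta> / 2)))"
proof -
  have h: "Re (\<beta> + h) > 0" using assms abs_Re_le_cmod[of h] by simp
  note L = L2_fun_gauss[OF h] L2_fun_gauss[OF assms(1)]
  have "norm (gauss_fun m (\<beta> + h) x - gauss_fun m \<beta> x - (- h) * gauss_fun (m + 2) \<beta> x)
      \<le> (norm h)\<^sup>2 * norm (gauss_fun (m + 4) (of_real (Re \<beta> / 2)) x)" for x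
  proof -
    define z where "z = - (h * (of_real x)\<^sup>2)"
    have nz: "norm z = norm h * x\<^sup>2"
      by (simp add: z_def norm_mult norm_power)
    have "norm (exp z - (1 + z)) \<le> exp (norm z) * (norm z)\<^sup>2"
      using Taylor_exp_field[of z 1] by (simp add: power2_eq_square)
    also have "\<dots> \<le> exp (Re \<beta> / 2 * x\<^sup>2) * (norm z)\<^sup>2"
      using mult_right_mono[OF assms(2), of "x\<^sup>2"] by (intro mult_right_mono) (auto simp: nz)
    finally have T: "norm (exp z - (1 + z)) \<le> exp (Re \<beta> / 2 * x\<^sup>2) * ((norm h)\<^sup>2 * x ^ 4)"
      by (simp add: nz power_mult_distrib power_mult[symmetric])
    have "gauss_fun m (\<beta> + h) x - gauss_fun m \<beta> x - (- h) * gauss_fun (m + 2) \<beta> x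
        = gauss_fun m \<beta> x * (exp z - (1 + z))"
      by (simp add: gauss_fun_def z_def exp_add[symmetric] algebra_simps power2_eq_square
          exp_diff[symmetric] exp_minus[symmetric] mult_exp_exp)
    also have "norm \<dots> \<le> (\<bar>x\<bar> ^ m * exp (- (Re \<beta> * x\<^sup>2))) * (exp (Re \<beta> / 2 * x\<^sup>2) * ((norm h)\<^sup>2 * x ^ 4))"
      unfolding norm_mult norm_gauss_fun by (intro mult_left_mono T) auto
    also have "\<dots> = (norm h)\<^sup>2 * norm (gauss_fun (m + 4) (of_real (Re \<beta> / 2)) x)"
      by (simp add: norm_gauss_fun power_add mult_exp_exp algebra_simps)
    finally show ?thesis .
  qed
  then have "norm (abs_half_line_L2 (\<lambda>x. gauss_fun m (\<beta> + h) x - gauss_fun m \<beta> x - (- h) * gauss_fun (m + 2) \<beta> x))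
      \<le> (norm h)\<^sup>2 * norm (gauss (m + 4) (of_real (Re \<beta> / 2)))"
    unfolding gauss_def using assms
    by (intro norm_abs_half_line_L2_le L2_fun_diff L2_fun_scale L L2_fun_gauss) auto
  moreover have "abs_half_line_L2 (\<lambda>x. gauss_fun m (\<beta> + h) x - gauss_fun m \<beta> x - (- h) * gauss_fun (m + 2) \<beta> x)
      = gauss m (\<beta> + h) - gauss m \<beta> - scaleC_half_line (- h) (gauss (m + 2) \<beta>)"
    unfolding gauss_def
    by (simp only: scaleC_abs_half_line_L2[OF L(2)] abs_diff_half_line_L2[OF L]
        abs_diff_half_line_L2[OF L2_fun_diff[OF L] L2_fun_scale[OF L(2)]])
  ultimately show ?thesis by simp
qed

lemma bounded_linear_scaleC_left: "bounded_linear (\<lambda>h. scaleC_half_line (- h) f)"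
proof
  show "\<exists>K. \<forall>h. norm (scaleC_half_line (- h) f) \<le> norm h * K"
    by (rule exI[of _ "norm f"]) (simp add: norm_scaleC_half_line)
  show "scaleC_half_line (- (a + b)) f = scaleC_half_line (- a) f + scaleC_half_line (- b) f" for a b
    by (simp add: scaleC_half_line_add_left[symmetric])
  show "scaleC_half_line (- (r *\<^sub>R a)) f = r *\<^sub>R scaleC_half_line (- a) f" for r a
    by (simp add: scaleC_half_line_scaleR_left[symmetric])
qed

lemma gauss_has_derivative:
  assumes "Re \<beta> > 0"
  shows "(gauss m has_derivative (\<lambda>h. scaleC_half_line (- h) (gauss (m + 2) \<beta>))) (at \<beta>)"
proof (rule has_derivativeI_sandwich[where e = "Re \<beta> / 2"])
  let ?K = "norm (gauss (m + 4) (of_real (Re \<beta> / 2)))"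
  show "Re \<beta> / 2 > 0" using assms by simp
  show "bounded_linear (\<lambda>h. scaleC_half_line (- h) (gauss (m + 2) \<beta>))"
    by (rule bounded_linear_scaleC_left)
  show "norm (gauss m y - gauss m \<beta> - scaleC_half_line (- (y - \<beta>)) (gauss (m + 2) \<beta>)) / norm (y - \<beta>)
      \<le> norm (y - \<beta>) * ?K" if "y \<noteq> \<beta>" "dist y \<beta> < Re \<beta> / 2" for y
    using gauss_remainder[OF assms, of "y - \<beta>" m] that
    by (simp add: dist_norm divide_le_eq power2_eq_square mult_ac)
  have "((\<lambda>y. norm (y - \<beta>) * ?K) \<longlongrightarrow> norm (\<beta> - \<beta>) * ?K) (at \<beta>)"
    by (intro tendsto_intros)
  then show "((\<lambda>y. norm (y - \<beta>) * ?K) \<longlongrightarrow> 0) (at \<beta>)" by simp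
qed

lemma continuous_gauss: "Re \<beta> > 0 \<Longrightarrow> isCont (gauss m) \<beta>"
  by (rule has_derivative_continuous[OF gauss_has_derivative])

lemma gauss_has_vector_derivative:
  assumes "(\<beta> has_vector_derivative \<beta>') (at t)" "Re (\<beta> t) > 0"
  shows "((\<lambda>s. gauss m (\<beta> s)) has_vector_derivative scaleC_half_line (- \<beta>') (gauss (m + 2) (\<beta> t))) (at t)"
proof -
  have "((gauss m \<circ> \<beta>) has_derivative (\<lambda>h. scaleC_half_line (- h) (gauss (m + 2) (\<beta> t))) \<circ> (\<lambda>h. h *\<^sub>R \<beta>')) (at t)"
    using assms(1) gauss_has_derivative[OF assms(2)]
    by (intro diff_chain_at) (auto simp: has_vector_derivative_def)
  moreover have "(\<lambda>h. scaleC_half_line (- h) (gauss (m + 2) (\<beta> t))) \<circ> (\<lambda>h. h *\<^sub>R \<beta>')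
      = (\<lambda>h. h *\<^sub>R scaleC_half_line (- \<beta>') (gauss (m + 2) (\<beta> t)))"
    by (simp add: fun_eq_iff scaleC_half_line_scaleR_left[symmetric])
  ultimately show ?thesis by (simp add: has_vector_derivative_def o_def)
qed

section \<open>The pseudoconformal profile\<close>

text \<open>The inverse of \<open>\<eta> \<mapsto> (2t)\<^bsup>-1/2\<^esup> exp (i\<sigma>x\<^sup>2/4t) \<eta>(x/2t)\<close>, which is the leading behaviour of a free
  Schroedinger wave at the time \<open>\<sigma>t\<close>, \<open>t \<rightarrow> \<infinity>\<close>.\<close>

definition profile_fun :: "real \<Rightarrow> real \<Rightarrow> (real \<Rightarrow> complex) \<Rightarrow> real \<Rightarrow> complex" where
  "profile_fun \<sigma> t f y = of_real (sqrt (2 * t)) * cis (- (\<sigma> * t * y\<^sup>2)) * f (2 * t * y)"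

lemma norm_profile_fun: "t \<ge> 0 \<Longrightarrow> norm (profile_fun \<sigma> t f y) = sqrt (2 * t) * norm (f (2 * t * y))"
  by (simp add: profile_fun_def norm_mult)

lemma cis_quadratic_measurable [measurable]: "(\<lambda>y. cis (a * y\<^sup>2)) \<in> borel_measurable half_line"
  by (intro borel_imp_half_line borel_measurable_continuous_onI continuous_intros)

lemma profile_fun_measurable:
  assumes "t > 0" "f \<in> borel_measurable half_line"
  shows "profile_fun \<sigma> t f \<in> borel_measurable half_line"
proof -
  have [measurable]: "(\<lambda>y. f (2 * t * y)) \<in> borel_measurable half_line"
    using assms by (intro half_line_measurable_scale) auto
  have [measurable]: "(\<lambda>y. cis (- (\<sigma> * t * y\<^sup>2))) \<in> borel_measurable half_line"
    using cis_quadratic_measurable[of "- (\<sigma> * t)"] by simp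
  show ?thesis unfolding profile_fun_def by measurable
qed

lemma L2_fun_profile:
  assumes "t > 0" "L2_fun f"
  shows "L2_fun (profile_fun \<sigma> t f)"
  unfolding L2_fun_def
proof
  show "profile_fun \<sigma> t f \<in> borel_measurable half_line"
    using assms by (intro profile_fun_measurable) (auto simp: L2_fun_def)
  have "integrable half_line (\<lambda>y. 2 * t * (norm (f (2 * t * y)))\<^sup>2)"
    using assms half_line_integrable_scale[of "2 * t" "\<lambda>x. (norm (f x))\<^sup>2"]
    by (intro integrable_mult_right) (simp add: L2_fun_def)
  then show "integrable half_line (\<lambda>y. (norm (profile_fun \<sigma> t f y))\<^sup>2)"
    using assms(1) by (simp add: norm_profile_fun power_mult_distrib)
qed

definition profile :: "real \<Rightarrow> real \<Rightarrow> half_line_L2 \<Rightarrow> half_line_L2" where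
  "profile \<sigma> t f = abs_half_line_L2 (profile_fun \<sigma> t (rep_half_line_L2 f))"

lemma AE_rep_profile:
  "t > 0 \<Longrightarrow> AE y in half_line. rep_half_line_L2 (profile \<sigma> t f) y = profile_fun \<sigma> t (rep_half_line_L2 f) y"
  unfolding profile_def by (intro rep_abs_half_line_L2 L2_fun_profile L2_fun_rep)

lemma AE_profile_fun_cong:
  assumes "t > 0" "AE x in half_line. f x = g x"
  shows "AE y in half_line. profile_fun \<sigma> t f y = profile_fun \<sigma> t g y"
  using AE_half_line_scale[of "2 * t", OF _ assms(2)] assms(1)
  by (auto simp: profile_fun_def elim!: eventually_mono)

lemma profile_abs:
  assumes "t > 0" "L2_fun f"
  shows "profile \<sigma> t (abs_half_line_L2 f) = abs_half_line_L2 (profile_fun \<sigma> t f)"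
  unfolding profile_def using assms
  by (intro abs_half_line_L2_cong AE_profile_fun_cong L2_fun_profile L2_fun_rep rep_abs_half_line_L2)

lemma profile_fun_add: "profile_fun \<sigma> t (\<lambda>x. f x + g x) = (\<lambda>y. profile_fun \<sigma> t f y + profile_fun \<sigma> t g y)"
  by (simp add: profile_fun_def fun_eq_iff distrib_left)

lemma profile_fun_scale: "profile_fun \<sigma> t (\<lambda>x. c * f x) = (\<lambda>y. c * profile_fun \<sigma> t f y)"
  by (simp add: profile_fun_def fun_eq_iff)

lemma profile_add:
  assumes "t > 0"
  shows "profile \<sigma> t (f + g) = profile \<sigma> t f + profile \<sigma> t g"
proof -
  have "profile \<sigma> t (abs_half_line_L2 (rep_half_line_L2 f) + abs_half_line_L2 (rep_half_line_L2 g))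
      = abs_half_line_L2 (profile_fun \<sigma> t (rep_half_line_L2 f)) + abs_half_line_L2 (profile_fun \<sigma> t (rep_half_line_L2 g))"
    using assms
    by (simp add: plus_abs_half_line_L2 L2_fun_rep L2_fun_profile profile_abs L2_fun_add
        profile_fun_add)
  then show ?thesis by (simp add: abs_rep_half_line_L2 profile_def)
qed

lemma profile_scaleC:
  assumes "t > 0"
  shows "profile \<sigma> t (scaleC_half_line c f) = scaleC_half_line c (profile \<sigma> t f)"
proof -
  have "profile \<sigma> t (scaleC_half_line c (abs_half_line_L2 (rep_half_line_L2 f)))
      = scaleC_half_line c (abs_half_line_L2 (profile_fun \<sigma> t (rep_half_line_L2 f)))"
    using assms
    by (simp add: scaleC_abs_half_line_L2 L2_fun_rep L2_fun_profile profile_abs L2_fun_scale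
        profile_fun_scale)
  then show ?thesis by (simp add: abs_rep_half_line_L2 profile_def)
qed

lemma norm_profile:
  assumes "t > 0"
  shows "norm (profile \<sigma> t f) = norm f"
proof -
  have "(norm (profile \<sigma> t f))\<^sup>2 = (LINT y|half_line. 2 * t * (norm (rep_half_line_L2 f (2 * t * y)))\<^sup>2)"
    using assms unfolding profile_def
    by (simp add: norm_abs_half_line_L2 L2_fun_profile L2_fun_rep norm_profile_fun power_mult_distrib)
  also have "\<dots> = (norm f)\<^sup>2"
    using assms half_line_integral_scale[of "2 * t" "\<lambda>x. (norm (rep_half_line_L2 f x))\<^sup>2"]
    by (simp add: norm_half_line_L2_eq)
  finally show ?thesis by (simp add: power2_eq_iff_nonneg)
qed

lemma profile_gauss:
  assumes "t > 0" "Re \<beta> > 0"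
  shows "profile \<sigma> t (gauss m \<beta>)
       = scaleC_half_line (of_real (sqrt (2 * t) * (2 * t) ^ m)) (gauss m (of_real (4 * t\<^sup>2) * \<beta> + \<i> * of_real (\<sigma> * t)))"
proof -
  let ?\<gamma> = "of_real (4 * t\<^sup>2) * \<beta> + \<i> * of_real (\<sigma> * t)"
  have \<gamma>: "Re ?\<gamma> > 0" using assms by simp
  have eq: "profile_fun \<sigma> t (gauss_fun m \<beta>) = (\<lambda>y. of_real (sqrt (2 * t) * (2 * t) ^ m) * gauss_fun m ?\<gamma> y)"
    by (rule ext) (simp add: profile_fun_def gauss_fun_def cis_conv_exp mult_exp_exp power_mult_distrib algebra_simps
        power2_eq_square)
  show ?thesis
    unfolding gauss_def
    by (simp only: profile_abs[OF assms(1) L2_fun_gauss[OF assms(2)]] eq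
        scaleC_abs_half_line_L2[OF L2_fun_gauss[OF \<gamma>]])
qed

definition star_profile :: "real \<Rightarrow> real \<Rightarrow> 'n::finite star_L2 \<Rightarrow> 'n star_L2" where
  "star_profile \<sigma> t f = (\<chi> j. profile \<sigma> t (f $ j))"

lemma norm_star_profile: "t > 0 \<Longrightarrow> norm (star_profile \<sigma> t f) = norm f"
  by (simp add: star_profile_def norm_vec_def norm_profile)

lemma star_profile_add: "t > 0 \<Longrightarrow> star_profile \<sigma> t (f + g) = star_profile \<sigma> t f + star_profile \<sigma> t g"
  by (simp add: star_profile_def vec_eq_iff profile_add)

lemma star_profile_scaleR: "t > 0 \<Longrightarrow> star_profile \<sigma> t (r *\<^sub>R f) = r *\<^sub>R star_profile \<sigma> t f"
  by (simp add: star_profile_def vec_eq_iff profile_scaleC scaleC_half_line_of_real[symmetric])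

lemma star_profile_diff:
  assumes "t > 0"
  shows "star_profile \<sigma> t (f - g) = star_profile \<sigma> t f - star_profile \<sigma> t g"
  using star_profile_add[OF assms, of \<sigma> "f - g" g] by simp

lemma star_profile_tensor: "t > 0 \<Longrightarrow> star_profile \<sigma> t (tensor c f) = tensor c (profile \<sigma> t f)"
  by (simp add: star_profile_def tensor_def vec_eq_iff profile_scaleC)

section \<open>Gaussians in the domain of the Laplacian\<close>

lemma C1_imp_absolutely_continuous:
  assumes deriv: "\<And>x. (f has_vector_derivative f' x) (at x)" and cont: "continuous_on UNIV f'"
  shows "absolutely_continuous_fun_on {0..R} f"
proof -
  have "compact (f' ` {0..R})"
    by (intro compact_continuous_image continuous_on_subset[OF cont]) auto
  then obtain B where B: "B > 0" "\<And>x. x \<in> {0..R} \<Longrightarrow> norm (f' x) \<le> B"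
    by (metis bounded_pos compact_imp_bounded image_eqI)
  have lip: "norm (f b - f a) \<le> B * (b - a)" if "a \<le> b" "{a..b} \<subseteq> {0..R}" for a b
  proof -
    have "norm (f b - f a) \<le> B * norm (b - a)"
    proof (rule differentiable_bound[where S = "{a..b}"])
      show "(f has_derivative (\<lambda>h. h *\<^sub>R f' x)) (at x within {a..b})" for x
        using deriv[of x] by (simp add: has_vector_derivative_def has_derivative_at_withinI)
      show "onorm (\<lambda>h. h *\<^sub>R f' x) \<le> B" if "x \<in> {a..b}" for x
        using B(2)[of x] that \<open>{a..b} \<subseteq> {0..R}\<close> by (intro onorm_le) (auto simp: mult.commute[of B] intro!: mult_left_mono)
    qed (use that in auto)
    then show ?thesis using that by simp
  qed
  show ?thesis
    unfolding absolutely_continuous_fun_on_def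
  proof (intro allI impI)
    fix e :: real assume "e > 0"
    show "\<exists>d>0. \<forall>(m::nat) a b.
        (\<forall>k<m. a k \<le> b k \<and> {a k..b k} \<subseteq> {0..R}) \<and>
        disjoint_family_on (\<lambda>k. {a k<..<b k}) {..<m} \<and> (\<Sum>k<m. b k - a k) < d
        \<longrightarrow> (\<Sum>k<m. norm (f (b k) - f (a k))) < e"
    proof (intro exI[of _ "e / B"] conjI allI impI)
      show "e / B > 0" using \<open>e > 0\<close> B(1) by simp
      fix m :: nat and a b :: "nat \<Rightarrow> real"
      assume *: "(\<forall>k<m. a k \<le> b k \<and> {a k..b k} \<subseteq> {0..R}) \<and>
        disjoint_family_on (\<lambda>k. {a k<..<b k}) {..<m} \<and> (\<Sum>k<m. b k - a k) < e / B"
      have "(\<Sum>k<m. norm (f (b k) - f (a k))) \<le> (\<Sum>k<m. B * (b k - a k))"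
        using * by (intro sum_mono lip) auto
      also have "\<dots> = B * (\<Sum>k<m. b k - a k)" by (simp add: sum_distrib_left)
      also have "\<dots> < B * (e / B)" using * B(1) by (intro mult_strict_left_mono) auto
      finally show "(\<Sum>k<m. norm (f (b k) - f (a k))) < e" using B(1) by simp
    qed
  qed
qed

lemma gauss_fun_deriv:
  "(gauss_fun m \<beta> has_vector_derivative
      of_nat m * gauss_fun (m - 1) \<beta> x - 2 * \<beta> * gauss_fun (m + 1) \<beta> x) (at x)"
proof -
  have "((\<lambda>z. z ^ m * exp (- (\<beta> * z\<^sup>2))) has_field_derivative
      of_nat m * (z ^ (m - 1) * exp (- (\<beta> * z\<^sup>2))) - 2 * \<beta> * (z ^ (m + 1) * exp (- (\<beta> * z\<^sup>2)))) (at z)" for z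
    by (auto intro!: derivative_eq_intros simp: algebra_simps power2_eq_square)
  from has_vector_derivative_real_field[OF this[of "of_real x"]] show ?thesis
    by (simp add: gauss_fun_def[abs_def])
qed

lemma gauss_fun_continuous: "continuous_on S (gauss_fun m \<beta>)"
  unfolding gauss_fun_def by (intro continuous_intros)

text \<open>The second derivative of \<open>x\<^sup>m exp (- \<beta> x\<^sup>2)\<close>. For \<open>m \<le> 1\<close> the truncated exponent \<open>m - 2\<close> comes with
  the factor \<open>m (m - 1) = 0\<close>.\<close>

definition gauss_laplacian :: "nat \<Rightarrow> complex \<Rightarrow> half_line_L2" where
  "gauss_laplacian m \<beta> = scaleC_half_line (of_nat (m * (m - 1))) (gauss (m - 2) \<beta>)
     + scaleC_half_line (- (2 * \<beta> * of_nat (2 * m + 1))) (gauss m \<beta>)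
     + scaleC_half_line (4 * \<beta>\<^sup>2) (gauss (m + 2) \<beta>)"

text \<open>At the vertex \<open>x\<^sup>m exp (- \<beta> x\<^sup>2)\<close> has a value only if \<open>m = 0\<close> and a derivative only if \<open>m = 1\<close>. For
  \<open>m \<ge> 2\<close> what remains of the vertex condition is \<open>bc 0 0\<close>, true of every homogeneous linear one.\<close>

lemma star_laplacian_gauss:
  fixes c :: "complex^'n::finite"
  assumes \<beta>: "Re \<beta> > 0"
    and bc: "bc (if m = 0 then c else 0) (if m = 1 then c else 0)"
  shows "star_laplacian bc (tensor c (gauss m \<beta>)) (tensor c (gauss_laplacian m \<beta>))"
proof -
  define D where "D x = of_nat m * gauss_fun (m - 1) \<beta> x - 2 * \<beta> * gauss_fun (m + 1) \<beta> x" for x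
  define D2 where "D2 x = of_nat (m * (m - 1)) * gauss_fun (m - 2) \<beta> x
    + (- (2 * \<beta> * of_nat (2 * m + 1))) * gauss_fun m \<beta> x + (4 * \<beta>\<^sup>2) * gauss_fun (m + 2) \<beta> x" for x
  have D: "(gauss_fun m \<beta> has_vector_derivative D x) (at x)" for x
    unfolding D_def by (rule gauss_fun_deriv)
  have D2: "(D has_vector_derivative D2 x) (at x)" for x
  proof -
    have "(D has_vector_derivative
        of_nat m * (of_nat (m - 1) * gauss_fun (m - 1 - 1) \<beta> x - 2 * \<beta> * gauss_fun (m - 1 + 1) \<beta> x)
        - 2 * \<beta> * (of_nat (m + 1) * gauss_fun (m + 1 - 1) \<beta> x - 2 * \<beta> * gauss_fun (m + 1 + 1) \<beta> x)) (at x)"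
      unfolding D_def[abs_def]
      by (intro has_vector_derivative_diff has_vector_derivative_mult_right gauss_fun_deriv)
    moreover have "of_nat m * (of_nat (m - 1) * gauss_fun (m - 1 - 1) \<beta> x - 2 * \<beta> * gauss_fun (m - 1 + 1) \<beta> x)
        - 2 * \<beta> * (of_nat (m + 1) * gauss_fun (m + 1 - 1) \<beta> x - 2 * \<beta> * gauss_fun (m + 1 + 1) \<beta> x) = D2 x"
      unfolding D2_def by (cases m) (auto simp: algebra_simps power2_eq_square numeral_2_eq_2)
    ultimately show ?thesis by simp
  qed
  have contD: "continuous_on UNIV D" and contD2: "continuous_on UNIV D2"
    unfolding D_def D2_def by (intro continuous_intros gauss_fun_continuous)+
  have AC: "absolutely_continuous_fun_on {0..R} (\<lambda>x. a * gauss_fun m \<beta> x)"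
    "absolutely_continuous_fun_on {0..R} (\<lambda>x. a * D x)" for a R
    by (rule C1_imp_absolutely_continuous[OF has_vector_derivative_mult_right[OF D]],
        intro continuous_intros contD,
        rule C1_imp_absolutely_continuous[OF has_vector_derivative_mult_right[OF D2]],
        intro continuous_intros contD2)
  have AEg: "AE x in half_line. rep_half_line_L2 (scaleC_half_line a (gauss m \<beta>)) x = a * gauss_fun m \<beta> x" for a m
    using AE_rep_scaleC[of a "gauss m \<beta>"] AE_rep_gauss[OF \<beta>, of m] by eventually_elim simp
  have AE2: "AE x in half_line. rep_half_line_L2 (scaleC_half_line a (gauss_laplacian m \<beta>)) x = a * D2 x" for a
    using AE_rep_scaleC[of a "gauss_laplacian m \<beta>"]
      AE_rep_add[of "scaleC_half_line (of_nat (m * (m - 1))) (gauss (m - 2) \<beta>)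
        + scaleC_half_line (- (2 * \<beta> * of_nat (2 * m + 1))) (gauss m \<beta>)" "scaleC_half_line (4 * \<beta>\<^sup>2) (gauss (m + 2) \<beta>)"]
      AE_rep_add[of "scaleC_half_line (of_nat (m * (m - 1))) (gauss (m - 2) \<beta>)"
        "scaleC_half_line (- (2 * \<beta> * of_nat (2 * m + 1))) (gauss m \<beta>)"]
      AEg[of "of_nat (m * (m - 1))" "m - 2"] AEg[of "- (2 * \<beta> * of_nat (2 * m + 1))" m]
      AEg[of "4 * \<beta>\<^sup>2" "m + 2"]
    by eventually_elim (simp only: gauss_laplacian_def D2_def)
  have "gauss_fun m \<beta> 0 = (if m = 0 then 1 else 0)" "D 0 = (if m = 1 then 1 else 0)"
    by (auto simp: gauss_fun_def D_def)
  then have v: "(\<chi> j. c $ j * gauss_fun m \<beta> 0) = (if m = 0 then c else 0)"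
    "(\<chi> j. c $ j * D 0) = (if m = 1 then c else 0)"
    by (auto simp: vec_eq_iff)
  show ?thesis
    unfolding star_laplacian_def
  proof (rule exI[of _ "\<lambda>j x. c $ j * gauss_fun m \<beta> x"], rule exI[of _ "\<lambda>j x. c $ j * D x"], intro conjI allI impI)
    fix j
    show "AE x in half_line. rep_half_line_L2 (tensor c (gauss m \<beta>) $ j) x = c $ j * gauss_fun m \<beta> x"
      using AEg by (simp add: tensor_def)
    show "absolutely_continuous_fun_on {0..R} (\<lambda>x. c $ j * gauss_fun m \<beta> x)" for R by (rule AC)
    show "absolutely_continuous_fun_on {0..R} (\<lambda>x. c $ j * D x)" for R by (rule AC)
    show "((\<lambda>x. c $ j * gauss_fun m \<beta> x) has_vector_derivative c $ j * D x) (at x)" for x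
      by (intro has_vector_derivative_mult_right D)
    show "AE x in half_line. ((\<lambda>x. c $ j * D x) has_vector_derivative
        rep_half_line_L2 (tensor c (gauss_laplacian m \<beta>) $ j) x) (at x)"
      using AE2[of "c $ j"]
      by eventually_elim (auto simp: tensor_def intro!: has_vector_derivative_mult_right D2)
  next
    show "bc (\<chi> j. c $ j * gauss_fun m \<beta> 0) (\<chi> j. c $ j * D 0)"
      using bc by (simp only: v)
  qed
qed

section \<open>Unitary groups run forwards or backwards\<close>

text \<open>The family \<open>U(\<sigma>t)\<close> for a unitary group \<open>U\<close> and \<open>\<sigma> = \<plusminus>1\<close>: with \<open>\<sigma> = -1\<close> the past is treated as a
  future.\<close>

locale star_group =
  fixes \<sigma> :: real
    and T :: "'n::finite star_L2 \<Rightarrow> 'n star_L2 \<Rightarrow> bool"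
    and U :: "real \<Rightarrow> 'n star_L2 \<Rightarrow> 'n star_L2"
  assumes \<sigma>: "\<sigma>\<^sup>2 = 1"
    and U_add: "U t (f + g) = U t f + U t g"
    and U_scaleC: "U t (scaleC_star c f) = scaleC_star c (U t f)"
    and U_inner: "inner (U t f) (U t g) = inner f g"
    and U_zero: "U 0 f = f"
    and U_plus: "U (s + t) f = U s (U t f)"
    and U_cont: "continuous_on UNIV (\<lambda>t. U t f)"
    and U_generator: "T f g \<Longrightarrow> ((\<lambda>h. (U h f - f) /\<^sub>R h) \<longlongrightarrow> scaleC_star (\<i> * of_real \<sigma>) g) (at 0)"

lemma star_group_of_generates_unitary_group:
  assumes gen: "generates_unitary_group T U" and \<sigma>: "\<sigma> \<in> {1, -1}"
  shows "star_group \<sigma> T (\<lambda>t. U (\<sigma> * t))"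
proof
  show "\<sigma>\<^sup>2 = 1" using \<sigma> by auto
  fix s t c f g
  show "U (\<sigma> * t) (f + g) = U (\<sigma> * t) f + U (\<sigma> * t) g"
    "U (\<sigma> * t) (scaleC_star c f) = scaleC_star c (U (\<sigma> * t) f)"
    "U (\<sigma> * 0) f = f" "U (\<sigma> * (s + t)) f = U (\<sigma> * s) (U (\<sigma> * t) f)"
    using gen by (auto simp: generates_unitary_group_def distrib_left)
  have "Re (cinner_star (U (\<sigma> * t) f) (U (\<sigma> * t) g)) = Re (cinner_star f g)"
    using gen by (simp add: generates_unitary_group_def)
  then show "inner (U (\<sigma> * t) f) (U (\<sigma> * t) g) = inner f g" by (simp add: Re_cinner_star)
  have "continuous_on UNIV (\<lambda>t. U t f)" using gen by (simp add: generates_unitary_group_def)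
  then show "continuous_on UNIV (\<lambda>t. U (\<sigma> * t) f)"
    by (rule continuous_on_compose2) (auto intro!: continuous_intros)
  assume "T f g"
  then have lim: "((\<lambda>h. (U h f - f) /\<^sub>R h) \<longlongrightarrow> scaleC_star \<i> g) (at 0)"
    using gen by (simp add: generates_unitary_group_def)
  have "filterlim (\<lambda>h. \<sigma> * h) (at 0) (at 0)"
    using \<sigma> by (intro filterlim_atI tendsto_eq_intros) (auto simp: eventually_at_filter)
  from filterlim_compose[OF lim this]
  have "((\<lambda>h. \<sigma> *\<^sub>R ((U (\<sigma> * h) f - f) /\<^sub>R (\<sigma> * h))) \<longlongrightarrow> \<sigma> *\<^sub>R scaleC_star \<i> g) (at 0)"
    by (intro tendsto_intros)
  moreover have "(\<lambda>h. \<sigma> *\<^sub>R ((U (\<sigma> * h) f - f) /\<^sub>R (\<sigma> * h))) = (\<lambda>h. (U (\<sigma> * h) f - f) /\<^sub>R h)"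
    using \<sigma> by auto
  moreover have "\<sigma> *\<^sub>R scaleC_star \<i> g = scaleC_star (\<i> * of_real \<sigma>) g"
    by (simp add: scaleC_star_of_real[symmetric] scaleC_star_scaleC mult.commute)
  ultimately show "((\<lambda>h. (U (\<sigma> * h) f - f) /\<^sub>R h) \<longlongrightarrow> scaleC_star (\<i> * of_real \<sigma>) g) (at 0)"
    by (simp only:)
qed

lemma has_vector_derivative_iff_quotient:
  fixes f :: "real \<Rightarrow> 'a::real_normed_vector"
  shows "(f has_vector_derivative D) (at t) \<longleftrightarrow> ((\<lambda>h. (f (t + h) - f t) /\<^sub>R h) \<longlongrightarrow> D) (at 0)"
proof -
  have "(f has_vector_derivative D) (at t)
      \<longleftrightarrow> ((\<lambda>h. norm (f (t + h) - f t - h *\<^sub>R D) / norm h) \<longlongrightarrow> 0) (at 0)"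
    by (simp add: has_vector_derivative_def has_derivative_at bounded_linear_scaleR_left)
  also have "\<dots> \<longleftrightarrow> ((\<lambda>h. norm ((f (t + h) - f t) /\<^sub>R h - D)) \<longlongrightarrow> 0) (at 0)"
  proof (rule filterlim_cong[OF refl refl])
    show "\<forall>\<^sub>F h in at 0. norm (f (t + h) - f t - h *\<^sub>R D) / norm h = norm ((f (t + h) - f t) /\<^sub>R h - D)"
      unfolding eventually_at_filter
    proof (intro always_eventually allI impI)
      fix h :: real assume "h \<noteq> 0"
      then have "(f (t + h) - f t) /\<^sub>R h - D = (f (t + h) - f t - h *\<^sub>R D) /\<^sub>R h"
        by (simp add: scaleR_diff_right)
      then show "norm (f (t + h) - f t - h *\<^sub>R D) / norm h = norm ((f (t + h) - f t) /\<^sub>R h - D)"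
        by (simp add: divide_inverse mult.commute)
    qed
  qed
  also have "\<dots> \<longleftrightarrow> ((\<lambda>h. (f (t + h) - f t) /\<^sub>R h) \<longlongrightarrow> D) (at 0)"
    by (simp add: tendsto_norm_zero_iff LIM_zero_iff)
  finally show ?thesis .
qed

context star_group
begin

lemma U_scaleR: "U t (r *\<^sub>R f) = r *\<^sub>R U t f"
  using U_scaleC[of t "of_real r" f] by (simp add: scaleC_star_of_real)

lemma U_diff: "U t (f - g) = U t f - U t g"
  using U_add[of t "f - g" g] by simp

lemma norm_U: "norm (U t f) = norm f"
  by (simp add: norm_eq_sqrt_inner U_inner)

lemma bounded_linear_U: "bounded_linear (U t)"
  by (rule bounded_linear_intro[where K = 1]) (simp_all add: U_add U_scaleR norm_U)

lemma U_cancel [simp]: "U t (U (- t) f) = f" "U (- t) (U t f) = f"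
  using U_plus[of t "- t" f] U_plus[of "- t" t f] by (simp_all add: U_zero)

lemma tendsto_U:
  assumes "(r \<longlongrightarrow> a) F" "(x \<longlongrightarrow> y) F"
  shows "((\<lambda>h. U (r h) (x h)) \<longlongrightarrow> U a y) F"
proof -
  have "isCont (\<lambda>t. U t y) a" using U_cont by (simp add: continuous_on_eq_continuous_at)
  then have 1: "((\<lambda>h. U (r h) y) \<longlongrightarrow> U a y) F" by (rule isCont_tendsto_compose) (rule assms)
  have "((\<lambda>h. norm (x h - y)) \<longlongrightarrow> 0) F"
    using assms(2) by (simp add: tendsto_norm_zero_iff LIM_zero_iff)
  then have "((\<lambda>h. U (r h) (x h - y)) \<longlongrightarrow> 0) F"
    by (subst tendsto_norm_zero_iff[symmetric]) (simp add: norm_U)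
  from tendsto_add[OF this 1] show ?thesis by (simp add: U_diff)
qed

text \<open>Undoing the linear evolution turns the defect \<open>v' - i\<sigma>Tv\<close> of an approximate solution into a
  derivative, of the same norm because \<open>U\<close> is isometric.\<close>

lemma pulled_back_derivative:
  assumes v: "(v has_vector_derivative v') (at t)" and T: "T (v t) g"
  shows "((\<lambda>s. U (- s) (v s)) has_vector_derivative U (- t) (v' - scaleC_star (\<i> * of_real \<sigma>) g)) (at t)"
  unfolding has_vector_derivative_iff_quotient
proof -
  have "((\<lambda>h. U (- (t + h)) ((v (t + h) - v t) /\<^sub>R h - (U h (v t) - v t) /\<^sub>R h))
      \<longlongrightarrow> U (- (t + 0)) (v' - scaleC_star (\<i> * of_real \<sigma>) g)) (at 0)"
    using v U_generator[OF T] unfolding has_vector_derivative_iff_quotient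
    by (intro tendsto_U tendsto_intros)
  moreover have "U (- (t + h)) ((v (t + h) - v t) /\<^sub>R h - (U h (v t) - v t) /\<^sub>R h)
      = (U (- (t + h)) (v (t + h)) - U (- t) (v t)) /\<^sub>R h" for h
    using U_plus[of "- (t + h)" h "v t"]
    by (simp only: U_diff U_scaleR scaleR_diff_right[symmetric]) simp
  ultimately show "((\<lambda>h. (U (- (t + h)) (v (t + h)) - U (- t) (v t)) /\<^sub>R h)
      \<longlongrightarrow> U (- t) (v' - scaleC_star (\<i> * of_real \<sigma>) g)) (at 0)"
    by simp
qed

end

lemma bounded_bilinear_scaleC_half_line: "bounded_bilinear scaleC_half_line"
proof
  show "\<exists>K. \<forall>a b. norm (scaleC_half_line a b) \<le> norm a * norm b * K"
    by (rule exI[of _ 1]) (simp add: norm_scaleC_half_line)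
qed (simp_all add: scaleC_half_line_add_left scaleC_half_line_add_right
      scaleC_half_line_scaleR_left scaleC_half_line_scaleR_right)

interpretation scaleC: bounded_bilinear scaleC_half_line
  by (rule bounded_bilinear_scaleC_half_line)

section \<open>Gaussian waves\<close>

text \<open>The defect \<open>v' - i\<sigma>v\<^sub>x\<^sub>x\<close> of \<open>v(t,x) = \<alpha>(t) x\<^sup>m exp (- \<beta>(t) x\<^sup>2)\<close>.\<close>

definition gauss_defect :: "real \<Rightarrow> nat \<Rightarrow> complex \<Rightarrow> complex \<Rightarrow> complex \<Rightarrow> complex \<Rightarrow> half_line_L2" where
  "gauss_defect \<sigma> m \<alpha> \<alpha>' \<beta> \<beta>' =
     scaleC_half_line (\<alpha>' + 2 * \<i> * of_real \<sigma> * of_nat (2 * m + 1) * \<alpha> * \<beta>) (gauss m \<beta>)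
     - scaleC_half_line (\<alpha> * (\<beta>' + 4 * \<i> * of_real \<sigma> * \<beta>\<^sup>2)) (gauss (m + 2) \<beta>)
     - scaleC_half_line (\<i> * of_real \<sigma> * \<alpha> * of_nat (m * (m - 1))) (gauss (m - 2) \<beta>)"

lemma (in star_group) gauss_wave_derivative:
  fixes c :: "complex^'n"
  assumes T: "T = star_laplacian bc"
    and bc: "bc (if m = 0 then \<alpha> t *s c else 0) (if m = 1 then \<alpha> t *s c else 0)"
    and \<alpha>: "(\<alpha> has_vector_derivative \<alpha>') (at t)"
    and \<beta>: "(\<beta> has_vector_derivative \<beta>') (at t)" "Re (\<beta> t) > 0"
  shows "((\<lambda>s. U (- s) (tensor c (scaleC_half_line (\<alpha> s) (gauss m (\<beta> s))))) has_vector_derivative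
     U (- t) (tensor c (gauss_defect \<sigma> m (\<alpha> t) \<alpha>' (\<beta> t) \<beta>'))) (at t)"
proof -
  define v' where "v' = scaleC_half_line (\<alpha> t) (scaleC_half_line (- \<beta>') (gauss (m + 2) (\<beta> t)))
      + scaleC_half_line \<alpha>' (gauss m (\<beta> t))"
  have "((\<lambda>s. scaleC_half_line (\<alpha> s) (gauss m (\<beta> s))) has_vector_derivative v') (at t)"
    unfolding v'_def using \<alpha> gauss_has_vector_derivative[OF \<beta>]
    by (rule scaleC.has_vector_derivative)
  then have "((\<lambda>s. tensor c (scaleC_half_line (\<alpha> s) (gauss m (\<beta> s)))) has_vector_derivative tensor c v') (at t)"
    by (rule bounded_linear.has_vector_derivative[OF tensor.bounded_linear_right])
  moreover have "T (tensor c (scaleC_half_line (\<alpha> t) (gauss m (\<beta> t)))) (tensor (\<alpha> t *s c) (gauss_laplacian m (\<beta> t)))"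
    unfolding T tensor_scaleC by (rule star_laplacian_gauss[where bc = bc, OF \<beta>(2) bc])
  ultimately have "((\<lambda>s. U (- s) (tensor c (scaleC_half_line (\<alpha> s) (gauss m (\<beta> s))))) has_vector_derivative
     U (- t) (tensor c v' - scaleC_star (\<i> * of_real \<sigma>) (tensor (\<alpha> t *s c) (gauss_laplacian m (\<beta> t))))) (at t)"
    by (rule pulled_back_derivative)
  moreover have "tensor c v' - scaleC_star (\<i> * of_real \<sigma>) (tensor (\<alpha> t *s c) (gauss_laplacian m (\<beta> t)))
      = tensor c (v' - scaleC_half_line (\<i> * of_real \<sigma> * \<alpha> t) (gauss_laplacian m (\<beta> t)))"
    by (simp add: scaleC_star_tensor tensor.diff_right tensor_scaleC vector_smult_assoc)
  moreover have "v' - scaleC_half_line (\<i> * of_real \<sigma> * \<alpha> t) (gauss_laplacian m (\<beta> t))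
      = gauss_defect \<sigma> m (\<alpha> t) \<alpha>' (\<beta> t) \<beta>'"
    unfolding v'_def gauss_laplacian_def gauss_defect_def scaleC_half_line_add_right scaleC_half_line_scaleC
    by (simp add: algebra_simps scaleC.minus_left scaleC_half_line_add_left[symmetric] scaleC.diff_left[symmetric]
        del: of_nat_mult of_nat_add)
  ultimately show ?thesis by simp
qed

lemma sqrt_power_eq_exp:
  assumes "t > 0"
  shows "sqrt (2 * t) * (2 * t) ^ m = exp ((of_nat m + 1/2) * ln (2 * t))"
proof -
  have "sqrt (2 * t) = exp (ln (2 * t) / 2)"
    using assms by (simp add: powr_half_sqrt[symmetric] powr_def)
  moreover have "(2 * t) ^ m = exp (of_nat m * ln (2 * t))"
    using assms by (simp add: exp_of_nat_mult)
  ultimately show ?thesis by (simp add: mult_exp_exp algebra_simps)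
qed

section \<open>The asymptotic profile of Kirchhoff waves\<close>

text \<open>The two factors in the profile of the exact wave \<open>z\<^bsup>-m-1/2\<^esup> x\<^sup>m exp (- x\<^sup>2/4z)\<close>, \<open>z = a + i\<sigma>t\<close>: they
  converge because \<open>z/2t \<rightarrow> i\<sigma>/2\<close>, a point off the cut of the logarithm.\<close>

lemma exact_wave_profile_limit:
  assumes a: "a > 0" and \<sigma>: "\<sigma>\<^sup>2 = (1::real)"
  defines "z \<equiv> (\<lambda>t. Complex a (\<sigma> * t))"
  shows "\<exists>L. ((\<lambda>t. of_real (sqrt (2 * t) * (2 * t) ^ m) * exp (- (of_nat m + 1/2) * Ln (z t))) \<longlongrightarrow> L) at_top"
    and "((\<lambda>t. of_real (4 * t\<^sup>2) * (1 / (4 * z t)) + \<i> * of_real (\<sigma> * t)) \<longlongrightarrow> of_real a) at_top"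
proof -
  have zt: "z t = of_real t * (of_real (a / t) + \<i> * of_real \<sigma>)" if "t > 0" for t
    using that by (simp add: z_def complex_eq_iff)
  have inf: "((\<lambda>t. of_real (a / t) :: complex) \<longlongrightarrow> of_real 0) at_top"
    by (intro tendsto_of_real tendsto_divide_0[OF tendsto_const] filterlim_at_top_imp_at_infinity filterlim_ident)
  let ?w = "\<lambda>t. (of_real (a / t) + \<i> * of_real \<sigma>) / 2 :: complex"
  have w: "(?w \<longlongrightarrow> (of_real 0 + \<i> * of_real \<sigma>) / 2) at_top"
    by (intro tendsto_intros inf) auto
  have ne: "(of_real 0 + \<i> * of_real \<sigma>) / 2 \<notin> (\<real>\<^sub>\<le>\<^sub>0 :: complex set)"
    using \<sigma> by (auto simp: complex_nonpos_Reals_iff)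
  have "((\<lambda>t. exp (- (of_nat m + 1/2) * Ln (?w t))) \<longlongrightarrow> exp (- (of_nat m + 1/2) * Ln ((of_real 0 + \<i> * of_real \<sigma>) / 2))) at_top"
    by (intro tendsto_intros tendsto_Ln w ne)
  moreover have "\<forall>\<^sub>F t in at_top. of_real (sqrt (2 * t) * (2 * t) ^ m) * exp (- (of_nat m + 1/2) * Ln (z t))
      = exp (- (of_nat m + 1/2) * Ln (?w t))"
    using eventually_gt_at_top[of 0]
  proof eventually_elim
    case (elim t)
    have "?w t \<noteq> 0" using elim a by (auto simp: complex_eq_iff)
    then have "Ln (of_real (2 * t) * ?w t) = of_real (ln (2 * t)) + Ln (?w t)"
      using Ln_times_of_real[of "2 * t" "?w t"] Ln_of_real[of "2 * t"] elim by (simp only:) simp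
    moreover have "of_real (2 * t) * ?w t = z t" using elim by (simp add: zt)
    ultimately have "Ln (z t) = of_real (ln (2 * t)) + Ln (?w t)" by simp
    then show ?case
      using elim unfolding sqrt_power_eq_exp[OF elim] exp_of_real[symmetric] mult_exp_exp
      by (simp add: algebra_simps)
  qed
  ultimately show "\<exists>L. ((\<lambda>t. of_real (sqrt (2 * t) * (2 * t) ^ m) * exp (- (of_nat m + 1/2) * Ln (z t))) \<longlongrightarrow> L) at_top"
    using tendsto_cong by fast
  have "((\<lambda>t. \<i> * of_real \<sigma> * of_real a / (of_real (a / t) + \<i> * of_real \<sigma>)) \<longlongrightarrow>
      \<i> * of_real \<sigma> * of_real a / (of_real 0 + \<i> * of_real \<sigma>)) at_top"
    using \<sigma> by (intro tendsto_intros inf) auto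
  moreover have "\<i> * of_real \<sigma> * of_real a / (of_real 0 + \<i> * of_real \<sigma>) = of_real a"
    using \<sigma> by auto
  moreover have "\<forall>\<^sub>F t in at_top. of_real (4 * t\<^sup>2) * (1 / (4 * z t)) + \<i> * of_real (\<sigma> * t)
      = \<i> * of_real \<sigma> * of_real a / (of_real (a / t) + \<i> * of_real \<sigma>)"
    using eventually_gt_at_top[of 0]
  proof eventually_elim
    case (elim t)
    have d: "of_real (a / t) + \<i> * of_real \<sigma> \<noteq> 0" using elim a by (auto simp: complex_eq_iff)
    have s2: "of_real \<sigma> * of_real \<sigma> = (1::complex)"
      using \<sigma> by (metis of_real_1 of_real_mult power2_eq_square)
    have "of_real (4 * t\<^sup>2) * (1 / (4 * z t)) = of_real t / (of_real (a / t) + \<i> * of_real \<sigma>)"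
      using elim d by (simp add: zt power2_eq_square)
    moreover have "of_real t + \<i> * of_real (\<sigma> * t) * (of_real (a / t) + \<i> * of_real \<sigma>) = \<i> * of_real \<sigma> * of_real a"
      using elim s2 by (simp add: algebra_simps)
    ultimately show ?case using d by (simp add: field_simps)
  qed
  ultimately show "((\<lambda>t. of_real (4 * t\<^sup>2) * (1 / (4 * z t)) + \<i> * of_real (\<sigma> * t)) \<longlongrightarrow> of_real a) at_top"
    using tendsto_cong by fastforce
qed

context star_group
begin

text \<open>The heat kernel (\<open>m = 0\<close>) and, up to a constant, its space derivative (\<open>m = 1\<close>), continued to the
  complex time \<open>z = a + i\<sigma>t\<close>. The even wave satisfies the Kirchhoff condition if it is the same on all
  edges, the odd one if its weights sum to zero.\<close>

lemma kirchhoff_gauss_wave: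
  fixes c :: "complex^'n"
  assumes T: "T = star_laplacian kirchhoff_bc"
    and m: "m = 0 \<and> (\<forall>i j. c $ i = c $ j) \<or> m = 1 \<and> (\<Sum>j\<in>UNIV. c $ j) = 0"
    and a: "a > 0"
  defines "z \<equiv> (\<lambda>t. Complex a (\<sigma> * t))"
  defines "v \<equiv> (\<lambda>t. tensor c (scaleC_half_line (exp (- (of_nat m + 1/2) * Ln (z t))) (gauss m (1 / (4 * z t)))))"
  shows "U t (v 0) = v t"
proof -
  have z: "(z has_vector_derivative \<i> * of_real \<sigma>) (at t)" for t
  proof -
    have "((\<lambda>t. of_real a + t *\<^sub>R (\<i> * of_real \<sigma>)) has_vector_derivative 0 + 1 *\<^sub>R (\<i> * of_real \<sigma>)) (at t)"
      unfolding has_vector_derivative_def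
      by (rule has_derivative_eq_rhs, rule has_derivative_add[OF has_derivative_const
            bounded_linear_imp_has_derivative[OF bounded_linear_scaleR_left]]) simp
    moreover have "z = (\<lambda>t. of_real a + t *\<^sub>R (\<i> * of_real \<sigma>))"
      by (simp add: z_def fun_eq_iff complex_eq_iff)
    ultimately show ?thesis by simp
  qed
  have z0: "z t \<noteq> 0" for t using a by (auto simp: z_def complex_eq_iff)
  have znp: "z t \<notin> \<real>\<^sub>\<le>\<^sub>0" for t using a by (auto simp: z_def complex_nonpos_Reals_iff)
  have Rez: "Re (1 / (4 * z t)) > 0" for t
    using a by (simp add: Re_divide z_def zero_less_divide_iff add_pos_nonneg)
  define \<alpha> where "\<alpha> t = exp (- (of_nat m + 1/2) * Ln (z t))" for t
  define \<alpha>' where "\<alpha>' t = \<i> * of_real \<sigma> * (- (of_nat m + 1/2) / z t * \<alpha> t)" for t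
  define \<beta>' where "\<beta>' t = \<i> * of_real \<sigma> * (- 1 / (4 * (z t)\<^sup>2))" for t
  have \<alpha>: "(\<alpha> has_vector_derivative \<alpha>' t) (at t)" for t
  proof -
    have "((\<lambda>w. exp (- (of_nat m + 1/2) * Ln w)) has_field_derivative - (of_nat m + 1/2) / z t * \<alpha> t) (at (z t))"
      unfolding \<alpha>_def using znp[of t] z0[of t] by (auto intro!: derivative_eq_intros simp: field_simps)
    from field_vector_diff_chain_at[OF z this] show ?thesis
      by (simp add: \<alpha>_def[abs_def] \<alpha>'_def o_def)
  qed
  have \<beta>: "((\<lambda>t. 1 / (4 * z t)) has_vector_derivative \<beta>' t) (at t)" for t
  proof -
    have "((\<lambda>w. 1 / (4 * w)) has_field_derivative - 1 / (4 * (z t)\<^sup>2)) (at (z t))"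
      using z0[of t] by (auto intro!: derivative_eq_intros simp: field_simps power2_eq_square)
    from field_vector_diff_chain_at[OF z this] show ?thesis
      by (simp add: \<beta>'_def o_def)
  qed
  have bc: "kirchhoff_bc (if m = 0 then \<alpha> t *s c else 0) (if m = 1 then \<alpha> t *s c else 0)" for t
    using m by (auto simp: kirchhoff_bc_def sum_distrib_left[symmetric])
  have e1: "\<alpha>' t + 2 * \<i> * of_real \<sigma> * of_nat (2 * m + 1) * \<alpha> t * (1 / (4 * z t)) = 0" for t
    using z0[of t] by (simp add: \<alpha>'_def field_simps)
  have e2: "\<beta>' t + 4 * \<i> * of_real \<sigma> * (1 / (4 * z t))\<^sup>2 = 0" for t
    using z0[of t] by (simp add: \<beta>'_def field_simps power2_eq_square)
  have e3: "m * (m - 1) = 0" using m by auto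
  have defect: "gauss_defect \<sigma> m (\<alpha> t) (\<alpha>' t) (1 / (4 * z t)) (\<beta>' t) = 0" for t
    unfolding gauss_defect_def e1 e2 e3 by simp
  have "((\<lambda>s. U (- s) (v s)) has_vector_derivative 0) (at t)" for t
    using gauss_wave_derivative[where bc = kirchhoff_bc and m = m and c = c and \<alpha> = \<alpha> and \<beta> = "\<lambda>t. 1 / (4 * z t)"
        and t = t, OF T bc \<alpha> \<beta> Rez]
    unfolding defect v_def \<alpha>_def[symmetric]
    by (simp add: tensor.zero_right linear_0[OF bounded_linear.linear[OF bounded_linear_U]])
  then have "((\<lambda>s. U (- s) (v s)) has_derivative (\<lambda>h. 0)) (at t within UNIV)" for t
    by (simp add: has_vector_derivative_def)
  then obtain w where w: "\<And>s. U (- s) (v s) = w"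
    using has_derivative_zero_constant[OF convex_UNIV, of "\<lambda>s. U (- s) (v s)"] by auto
  have "v 0 = w" using w[of 0] by (simp add: U_zero)
  then have "U t (v 0) = U t (U (- t) (v t))" using w[of t] by simp
  then show ?thesis by simp
qed

definition has_profile :: "'n star_L2 \<Rightarrow> bool" where
  "has_profile f \<longleftrightarrow> (\<exists>\<Phi>. ((\<lambda>t. star_profile \<sigma> t (U t f)) \<longlongrightarrow> \<Phi>) at_top)"

lemma kirchhoff_gauss_has_profile:
  fixes c :: "complex^'n"
  assumes T: "T = star_laplacian kirchhoff_bc"
    and m: "m = 0 \<and> (\<forall>i j. c $ i = c $ j) \<or> m = 1 \<and> (\<Sum>j\<in>UNIV. c $ j) = 0"
    and b: "b > 0"
  shows "has_profile (tensor c (gauss m (of_real b)))"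
proof -
  define a where "a = 1 / (4 * b)"
  have a: "a > 0" using b by (simp add: a_def)
  define z where "z t = Complex a (\<sigma> * t)" for t
  define \<alpha> where "\<alpha> t = exp (- (of_nat m + 1/2) * Ln (z t))" for t
  \<comment> \<open>The exact wave starts from \<open>\<alpha> 0\<close> times the Gaussian.\<close>
  define d where "d = inverse (\<alpha> 0) *s c"
  define v where "v t = tensor d (scaleC_half_line (\<alpha> t) (gauss m (1 / (4 * z t))))" for t
  have "\<alpha> 0 \<noteq> 0" by (simp add: \<alpha>_def)
  then have "v 0 = tensor c (gauss m (1 / (4 * z 0)))"
    by (simp add: v_def d_def tensor_scaleC vector_smult_assoc)
  also have "1 / (4 * z 0) = of_real b"
    using b by (simp add: z_def a_def complex_eq_iff Re_divide Im_divide power2_eq_square)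
  finally have v0: "v 0 = tensor c (gauss m (of_real b))" .
  have "m = 0 \<and> (\<forall>i j. d $ i = d $ j) \<or> m = 1 \<and> (\<Sum>j\<in>UNIV. d $ j) = 0"
    using m by (auto simp: d_def sum_distrib_left[symmetric])
  then have U: "U t (v 0) = v t" for t
    unfolding v_def \<alpha>_def z_def by (rule kirchhoff_gauss_wave[OF T _ a])
  obtain L where L: "((\<lambda>t. of_real (sqrt (2 * t) * (2 * t) ^ m) * \<alpha> t) \<longlongrightarrow> L) at_top"
    using exact_wave_profile_limit(1)[OF a \<sigma>, of m] unfolding \<alpha>_def z_def by blast
  have lim: "((\<lambda>t. of_real (4 * t\<^sup>2) * (1 / (4 * z t)) + \<i> * of_real (\<sigma> * t)) \<longlongrightarrow> of_real a) at_top"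
    using exact_wave_profile_limit(2)[OF a \<sigma>] unfolding z_def .
  have Rez: "Re (1 / (4 * z t)) > 0" for t
    using a by (simp add: Re_divide z_def zero_less_divide_iff add_pos_nonneg)
  have "\<forall>\<^sub>F t in at_top. tensor d (scaleC_half_line (of_real (sqrt (2 * t) * (2 * t) ^ m) * \<alpha> t)
      (gauss m (of_real (4 * t\<^sup>2) * (1 / (4 * z t)) + \<i> * of_real (\<sigma> * t)))) = star_profile \<sigma> t (U t (v 0))"
    using eventually_gt_at_top[of 0]
  proof eventually_elim
    case (elim t)
    show ?case
      unfolding U unfolding v_def
      by (simp only: star_profile_tensor[OF elim] profile_scaleC[OF elim] profile_gauss[OF elim Rez]
          scaleC_half_line_scaleC mult.commute[of "\<alpha> t"])
  qed
  moreover have "((\<lambda>t. tensor d (scaleC_half_line (of_real (sqrt (2 * t) * (2 * t) ^ m) * \<alpha> t)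
      (gauss m (of_real (4 * t\<^sup>2) * (1 / (4 * z t)) + \<i> * of_real (\<sigma> * t))))) \<longlongrightarrow>
      tensor d (scaleC_half_line L (gauss m (of_real a)))) at_top"
    by (intro tensor.tendsto tendsto_const scaleC.tendsto L isCont_tendsto_compose[OF continuous_gauss lim])
       (use a in simp)
  ultimately show ?thesis
    unfolding has_profile_def v0[symmetric] using tendsto_cong by fast
qed

lemma has_profile_add: "has_profile f \<Longrightarrow> has_profile g \<Longrightarrow> has_profile (f + g)"
  unfolding has_profile_def
proof (elim exE)
  fix \<Phi> \<Psi>
  assume "((\<lambda>t. star_profile \<sigma> t (U t f)) \<longlongrightarrow> \<Phi>) at_top" "((\<lambda>t. star_profile \<sigma> t (U t g)) \<longlongrightarrow> \<Psi>) at_top"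
  then have "((\<lambda>t. star_profile \<sigma> t (U t f) + star_profile \<sigma> t (U t g)) \<longlongrightarrow> \<Phi> + \<Psi>) at_top"
    by (rule tendsto_add)
  moreover have "\<forall>\<^sub>F t in at_top. star_profile \<sigma> t (U t f) + star_profile \<sigma> t (U t g) = star_profile \<sigma> t (U t (f + g))"
    using eventually_gt_at_top[of 0] by eventually_elim (simp add: U_add star_profile_add)
  ultimately show "\<exists>\<Phi>. ((\<lambda>t. star_profile \<sigma> t (U t (f + g))) \<longlongrightarrow> \<Phi>) at_top"
    using tendsto_cong by fast
qed

lemma has_profile_scaleR: "has_profile f \<Longrightarrow> has_profile (r *\<^sub>R f)"
  unfolding has_profile_def
proof (elim exE)
  fix \<Phi>
  assume "((\<lambda>t. star_profile \<sigma> t (U t f)) \<longlongrightarrow> \<Phi>) at_top"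
  then have "((\<lambda>t. r *\<^sub>R star_profile \<sigma> t (U t f)) \<longlongrightarrow> r *\<^sub>R \<Phi>) at_top"
    by (intro tendsto_intros)
  moreover have "\<forall>\<^sub>F t in at_top. r *\<^sub>R star_profile \<sigma> t (U t f) = star_profile \<sigma> t (U t (r *\<^sub>R f))"
    using eventually_gt_at_top[of 0] by eventually_elim (simp add: U_scaleR star_profile_scaleR)
  ultimately show "\<exists>\<Phi>. ((\<lambda>t. star_profile \<sigma> t (U t (r *\<^sub>R f))) \<longlongrightarrow> \<Phi>) at_top"
    using tendsto_cong by fast
qed

lemma subspace_has_profile: "subspace {f. has_profile f}"
proof (rule subspaceI)
  have "has_profile (tensor 0 0)"
    unfolding has_profile_def
    by (rule exI[of _ 0], rule tendsto_eventually)
       (use eventually_gt_at_top[of 0] in eventually_elim, simp add: tensor.zero_left star_profile_def vec_eq_iff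
        norm_profile[of _ \<sigma> 0, simplified] linear_0[OF bounded_linear.linear[OF bounded_linear_U]])
  then show "0 \<in> {f. has_profile f}" by (simp add: tensor.zero_left)
qed (simp_all add: has_profile_add has_profile_scaleR)

lemma norm_wave_profile_diff:
  "t > 0 \<Longrightarrow> norm (star_profile \<sigma> t (U t f) - star_profile \<sigma> t (U t g)) = norm (f - g)"
  by (simp add: star_profile_diff[symmetric] U_diff[symmetric] norm_star_profile norm_U)

text \<open>The maps \<open>f \<mapsto> star_profile \<sigma> t (U t f)\<close> are isometries, so the limits of the profiles of a Cauchy
  sequence are again Cauchy, and strong convergence survives passage to the limit.\<close>

lemma closed_has_profile: "closed {f. has_profile f}"
  unfolding closed_sequential_limits
proof (intro allI impI, elim conjE)
  fix x f assume "\<forall>n. x n \<in> {f. has_profile f}" and xf: "x \<longlonglongrightarrow> f"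
  then obtain \<Phi> where \<Phi>: "\<And>n. ((\<lambda>t. star_profile \<sigma> t (U t (x n))) \<longlongrightarrow> \<Phi> n) at_top"
    unfolding has_profile_def by simp metis
  have d: "dist (\<Phi> m) (\<Phi> n) = dist (x m) (x n)" for m n
  proof (rule tendsto_unique)
    show "((\<lambda>t. dist (star_profile \<sigma> t (U t (x m))) (star_profile \<sigma> t (U t (x n)))) \<longlongrightarrow> dist (\<Phi> m) (\<Phi> n)) at_top"
      by (intro tendsto_intros \<Phi>)
    show "((\<lambda>t. dist (star_profile \<sigma> t (U t (x m))) (star_profile \<sigma> t (U t (x n)))) \<longlongrightarrow> dist (x m) (x n)) at_top"
      by (rule tendsto_eventually, use eventually_gt_at_top[of 0] in eventually_elim)
         (simp add: dist_norm norm_wave_profile_diff)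
  qed simp
  have "Cauchy \<Phi>" using LIMSEQ_imp_Cauchy[OF xf] by (simp add: Cauchy_def d)
  then obtain \<Psi> where \<Psi>: "\<Phi> \<longlonglongrightarrow> \<Psi>" by (auto simp: Cauchy_convergent_iff convergent_def)
  have "((\<lambda>t. star_profile \<sigma> t (U t f)) \<longlongrightarrow> \<Psi>) at_top"
  proof (rule tendstoI)
    fix e :: real assume e: "e > 0"
    have "\<forall>\<^sub>F n in sequentially. dist (x n) f < e / 3 \<and> dist (\<Phi> n) \<Psi> < e / 3"
      using tendstoD[OF xf, of "e / 3"] tendstoD[OF \<Psi>, of "e / 3"] e by (simp add: eventually_conj)
    then obtain n where n: "dist (x n) f < e / 3" "dist (\<Phi> n) \<Psi> < e / 3"
      by (auto simp: eventually_sequentially)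
    have "\<forall>\<^sub>F t in at_top. dist (star_profile \<sigma> t (U t (x n))) (\<Phi> n) < e / 3"
      using tendstoD[OF \<Phi>[of n], of "e / 3"] e by simp
    with eventually_gt_at_top[of 0] show "\<forall>\<^sub>F t in at_top. dist (star_profile \<sigma> t (U t f)) \<Psi> < e"
    proof eventually_elim
      case (elim t)
      have "dist (star_profile \<sigma> t (U t f)) (star_profile \<sigma> t (U t (x n))) < e / 3"
        using n(1) elim(1) by (simp add: dist_norm norm_wave_profile_diff norm_minus_commute)
      then show ?case using elim(2) n(2)
          dist_triangle[of "star_profile \<sigma> t (U t f)" \<Psi> "star_profile \<sigma> t (U t (x n))"]
          dist_triangle[of "star_profile \<sigma> t (U t (x n))" \<Psi> "\<Phi> n"] by linarith
    qed
  qed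
  then show "f \<in> {f. has_profile f}" by (auto simp: has_profile_def)
qed

end

text \<open>The projection theorem in the form used for density: a minimising sequence for the distance to
  \<open>X\<close> is Cauchy by the parallelogram law, and the error of its limit is orthogonal to \<open>X\<close>.\<close>

lemma closed_subspace_eq_UNIV:
  fixes X :: "'a::{real_inner, complete_space} set"
  assumes sub: "subspace X" and cl: "closed X"
    and orth: "\<And>y. (\<And>x. x \<in> X \<Longrightarrow> inner x y = 0) \<Longrightarrow> y = 0"
  shows "X = UNIV"
proof (intro set_eqI iffI UNIV_I)
  fix f :: 'a
  define d where "d = (INF x\<in>X. (norm (f - x))\<^sup>2)"
  have ne: "X \<noteq> {}" using subspace_0[OF sub] by auto
  have bdd: "bdd_below ((\<lambda>x. (norm (f - x))\<^sup>2) ` X)" by (intro bdd_belowI2[of _ 0]) auto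
  have d_le: "d \<le> (norm (f - x))\<^sup>2" if "x \<in> X" for x
    unfolding d_def by (rule cINF_lower[OF bdd that])
  have "\<exists>x\<in>X. (norm (f - x))\<^sup>2 < d + 1 / real (Suc n)" for n
    using cINF_less_iff[OF ne bdd, of "d + 1 / real (Suc n)"] by (simp add: d_def)
  then obtain x where x: "\<And>n. x n \<in> X" "\<And>n. (norm (f - x n))\<^sup>2 < d + 1 / real (Suc n)"
    by metis
  \<comment> \<open>The midpoint of \<open>x m\<close> and \<open>x n\<close> lies in \<open>X\<close>, so its distance to \<open>f\<close> is at least the infimum.\<close>
  have par: "(norm (x m - x n))\<^sup>2 \<le> 2 / real (Suc m) + 2 / real (Suc n)" for m n
  proof -
    have "(1/2) *\<^sub>R (x m + x n) \<in> X"
      by (intro subspace_scale[OF sub] subspace_add[OF sub] x)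
    then have "4 * d \<le> 4 * (norm (f - (1/2) *\<^sub>R (x m + x n)))\<^sup>2" using d_le by simp
    also have "\<dots> = (norm (2 *\<^sub>R (f - (1/2) *\<^sub>R (x m + x n))))\<^sup>2"
      by (simp add: power_mult_distrib)
    also have "2 *\<^sub>R (f - (1/2) *\<^sub>R (x m + x n)) = (f - x m) + (f - x n)"
      by (simp add: scaleR_diff_right scaleR_2)
    finally have "4 * d \<le> (norm ((f - x m) + (f - x n)))\<^sup>2" .
    moreover have "(norm ((f - x m) + (f - x n)))\<^sup>2 + (norm ((f - x m) - (f - x n)))\<^sup>2
        = 2 * (norm (f - x m))\<^sup>2 + 2 * (norm (f - x n))\<^sup>2"
      by (simp only: power2_norm_eq_inner inner_add_left inner_add_right inner_diff_left inner_diff_right)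
         (simp add: inner_commute)
    moreover have "norm ((f - x m) - (f - x n)) = norm (x m - x n)"
      by (simp add: norm_minus_commute)
    ultimately show ?thesis using x(2)[of m] x(2)[of n] by simp
  qed
  have "Cauchy x"
  proof (rule metric_CauchyI)
    fix e :: real assume e: "e > 0"
    obtain N :: nat where N: "4 / e\<^sup>2 < real N" using reals_Archimedean2 by blast
    show "\<exists>M. \<forall>m\<ge>M. \<forall>n\<ge>M. dist (x m) (x n) < e"
    proof (intro exI[of _ N] allI impI)
      fix m n assume mn: "m \<ge> N" "n \<ge> N"
      have "4 < e\<^sup>2 * real N" using N e by (simp add: divide_less_eq mult.commute)
      then have S: "4 / real (Suc N) < e\<^sup>2"
        using e by (simp add: divide_less_eq distrib_left add_strict_increasing2)
      have "2 / real (Suc m) \<le> 2 / real (Suc N)" "2 / real (Suc n) \<le> 2 / real (Suc N)"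
        using mn by (auto intro!: divide_left_mono)
      then have "(norm (x m - x n))\<^sup>2 < e\<^sup>2" using par[of m n] S by simp
      then show "dist (x m) (x n) < e"
        using e by (simp add: dist_norm power_less_imp_less_base)
    qed
  qed
  then obtain y where y: "x \<longlonglongrightarrow> y" by (auto simp: Cauchy_convergent_iff convergent_def)
  have yX: "y \<in> X" using closed_sequentially[OF cl _ y] x(1) by blast
  have "(\<lambda>n. (norm (f - x n))\<^sup>2) \<longlonglongrightarrow> (norm (f - y))\<^sup>2"
    by (intro tendsto_intros y)
  moreover have "(\<lambda>n. d + 1 / real (Suc n)) \<longlonglongrightarrow> d + 0"
    by (intro tendsto_intros LIMSEQ_Suc[OF lim_1_over_n])
  ultimately have "(norm (f - y))\<^sup>2 \<le> d + 0"
    by (rule LIMSEQ_le) (use x(2) less_imp_le in blast)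
  then have min: "(norm (f - y))\<^sup>2 \<le> d" by simp
  have "f - y = 0"
  proof (rule orth)
    fix w assume w: "w \<in> X"
    have *: "2 * s * inner w (f - y) \<le> s\<^sup>2 * (norm w)\<^sup>2" for s
    proof -
      have "y + s *\<^sub>R w \<in> X" by (intro subspace_add[OF sub] subspace_scale[OF sub] w yX)
      then have "(norm (f - y))\<^sup>2 \<le> (norm ((f - y) - s *\<^sub>R w))\<^sup>2"
        using order_trans[OF min d_le[of "y + s *\<^sub>R w"]] by (simp only: diff_diff_eq)
      moreover have "(norm (u - s *\<^sub>R w))\<^sup>2 = (norm u)\<^sup>2 - 2 * s * inner w u + s\<^sup>2 * (norm w)\<^sup>2" for u
        unfolding power2_norm_eq_inner inner_diff_left inner_diff_right inner_scaleR_left inner_scaleR_right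
        by (simp add: inner_commute[of u w] power2_eq_square algebra_simps)
      ultimately show ?thesis by simp
    qed
    show "inner w (f - y) = 0"
    proof (cases "w = 0")
      case False
      then have nw: "(norm w)\<^sup>2 > 0" by simp
      let ?i = "inner w (f - y)"
      \<comment> \<open>The minimising step in the direction \<open>w\<close>.\<close>
      have "2 * (?i / (norm w)\<^sup>2) * ?i \<le> (?i / (norm w)\<^sup>2)\<^sup>2 * (norm w)\<^sup>2" by (rule *)
      also have "\<dots> = ?i\<^sup>2 / (norm w)\<^sup>2" using nw by (simp add: power2_eq_square)
      finally have "2 * ?i\<^sup>2 / (norm w)\<^sup>2 \<le> ?i\<^sup>2 / (norm w)\<^sup>2" by (simp add: power2_eq_square)
      then have "?i\<^sup>2 \<le> 0" using nw by (simp add: divide_le_cancel)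
      then show ?thesis by simp
    qed simp
  qed
  then show "f \<in> X" using yX by simp
qed

lemma AE_half_line_pos: "AE x in half_line. 0 < x"
  unfolding AE_half_line_iff by (rule negligible_subset[of "{0}"]) auto

lemma cinner_scaleC_left: "cinner_half_line (scaleC_half_line c f) g = c * cinner_half_line f g"
  by transfer (simp add: mult.assoc)

text \<open>For fixed \<open>m\<close> the weight \<open>x\<^sup>m\<close> vanishes only at the vertex, so the functions \<open>x\<^sup>m exp (- k x\<^sup>2)\<close> are
  total by the injectivity of Gaussian moments.\<close>

lemma gauss_total:
  assumes orth: "\<And>w (k::nat). k \<ge> 1 \<Longrightarrow> inner (scaleC_half_line w (gauss m (of_real (real k)))) s = 0"
  shows "s = 0"
proof -
  define H where "H x = of_real x ^ m * exp (- (of_real x)\<^sup>2) * cnj (rep_half_line_L2 s x)" for x :: real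
  have "AE y in half_line. H y = 0"
  proof (rule complex_gaussian_moments_zero_imp_AE_zero)
    have L: "L2_fun (gauss_fun m 1)" by (rule L2_fun_gauss) simp
    show "integrable half_line H"
      using L2_fun_mult_integrable[OF L L2_fun_rep[of s]] by (simp add: H_def[abs_def] gauss_fun_def)
    fix k :: nat
    let ?g = "gauss m (of_real (real (Suc k)))"
    have z: "Re (of_real (real (Suc k))) > 0" by simp
    have "Re (w * cinner_half_line ?g s) = 0" for w
      using orth[of "Suc k" w] by (simp only: inner_half_line_L2_def cinner_scaleC_left)
    from this[of 1] this[of "- \<i>"] have "cinner_half_line ?g s = 0" by (simp add: complex_eq_iff)
    also have "cinner_half_line ?g s
        = (LINT x|half_line. rep_half_line_L2 ?g x * cnj (rep_half_line_L2 s x))"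
      by (simp add: cinner_half_line_def)
    also have "\<dots> = (LINT y|half_line. H y * complex_of_real (exp (- (real k * y\<^sup>2))))"
    proof (rule integral_cong_AE)
      have [measurable]: "rep_half_line_L2 ?g \<in> borel_measurable half_line" "rep_half_line_L2 s \<in> borel_measurable half_line"
        using L2_fun_rep by (auto simp: L2_fun_def)
      show "(\<lambda>x. rep_half_line_L2 ?g x * cnj (rep_half_line_L2 s x)) \<in> borel_measurable half_line"
        by measurable
      have [measurable]: "(\<lambda>y::real. exp (- (real k * y\<^sup>2))) \<in> borel_measurable half_line"
        by (rule borel_imp_half_line) measurable
      show "(\<lambda>y. H y * complex_of_real (exp (- (real k * y\<^sup>2)))) \<in> borel_measurable half_line"
        using \<open>integrable half_line H\<close> by measurable
      show "AE x in half_line. rep_half_line_L2 ?g x * cnj (rep_half_line_L2 s x) = H x * complex_of_real (exp (- (real k * x\<^sup>2)))"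
        using AE_rep_gauss[OF z, of m]
      proof eventually_elim
        case (elim x)
        have "exp (- (of_real (real (Suc k)) * (complex_of_real x)\<^sup>2))
            = exp (- (of_real x)\<^sup>2) * complex_of_real (exp (- (real k * x\<^sup>2)))"
          by (simp add: exp_of_real[symmetric] mult_exp_exp algebra_simps)
        then show ?case by (simp only: elim gauss_fun_def H_def mult_ac)
      qed
    qed
    finally show "(LINT y|half_line. H y * complex_of_real (exp (- (real k * y\<^sup>2)))) = 0" by simp
  qed
  with AE_half_line_pos rep_abs_half_line_L2[OF L2_fun_zero]
  have "AE x in half_line. rep_half_line_L2 s x = rep_half_line_L2 0 x"
    unfolding zero_half_line_L2_def[symmetric] by eventually_elim (simp add: H_def)
  then show "s = 0" by (rule half_line_L2_eqI)
qed

lemma inner_tensor: "inner (tensor c f) y = (\<Sum>j\<in>UNIV. inner (scaleC_half_line (c $ j) f) (y $ j))"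
  by (simp add: tensor_def inner_vec_def)

text \<open>Asymptotic completeness for the Kirchhoff condition. An element orthogonal to all explicit waves
  vanishes: the odd ones with weights \<open>w\<close>, \<open>-w\<close> on two edges force equal components, and the even ones
  force the sum of the components to be zero. Vertex conditions with bound states have no such result,
  as the profile of a bound state only converges weakly.\<close>

lemma (in star_group) kirchhoff_has_profile:
  assumes T: "T = star_laplacian kirchhoff_bc"
  shows "\<exists>\<Phi>. ((\<lambda>t. star_profile \<sigma> t (U t f)) \<longlongrightarrow> \<Phi>) at_top \<and> norm \<Phi> = norm f"
proof -
  have "{f. has_profile f} = UNIV"
  proof (rule closed_subspace_eq_UNIV[OF subspace_has_profile closed_has_profile])
    fix y assume orth: "\<And>x. x \<in> {f. has_profile f} \<Longrightarrow> inner x y = 0"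
    have eq: "y $ i = y $ j" if "i \<noteq> j" for i j
    proof -
      have "y $ i - y $ j = 0"
      proof (rule gauss_total[of 1])
        fix w :: complex and k :: nat assume k: "k \<ge> 1"
        \<comment> \<open>Weights of sum zero, so that the odd wave is admitted.\<close>
        let ?c = "(\<chi> l. if l = i then w else if l = j then - w else 0) :: complex^'n"
        let ?g = "gauss 1 (of_real (real k))"
        have split: "(\<Sum>l\<in>UNIV. if l = i then a else if l = j then b else 0) = a + b" for a b :: "'c::comm_monoid_add"
        proof -
          have "(\<Sum>l\<in>UNIV. if l = i then a else if l = j then b else 0)
              = (\<Sum>l\<in>UNIV. (if l = i then a else 0) + (if l = j then b else 0))"
            using that by (intro sum.cong) auto
          then show ?thesis by (simp add: sum.distrib)
        qed
        have "(\<Sum>l\<in>UNIV. ?c $ l) = 0" using split[of w "- w"] by simp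
        then have "has_profile (tensor ?c ?g)"
          using k by (intro kirchhoff_gauss_has_profile[OF T]) auto
        then have "inner (tensor ?c ?g) y = 0" by (intro orth) simp
        moreover have "inner (tensor ?c ?g) y
            = (\<Sum>l\<in>UNIV. if l = i then inner (scaleC_half_line w ?g) (y $ i)
                else if l = j then - inner (scaleC_half_line w ?g) (y $ j) else 0)"
          unfolding inner_tensor by (intro sum.cong) (auto simp: scaleC.minus_left)
        ultimately show "inner (scaleC_half_line w ?g) (y $ i - y $ j) = 0"
          by (simp only: split inner_diff_right uminus_add_conv_diff add_uminus_conv_diff)
      qed
      then show ?thesis by simp
    qed
    have "(\<Sum>j\<in>UNIV. y $ j) = 0"
    proof (rule gauss_total[of 0])
      fix w :: complex and k :: nat assume k: "k \<ge> 1"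
      have "has_profile (tensor (\<chi> l. w) (gauss 0 (of_real (real k))))"
        using k by (intro kirchhoff_gauss_has_profile[OF T]) auto
      then have "inner (tensor (\<chi> l. w) (gauss 0 (of_real (real k)))) y = 0" by (intro orth) simp
      then show "inner (scaleC_half_line w (gauss 0 (of_real (real k)))) (\<Sum>j\<in>UNIV. y $ j) = 0"
        by (simp add: inner_tensor inner_sum_right)
    qed
    moreover have "(\<Sum>j\<in>UNIV. y $ j) = real CARD('n) *\<^sub>R (y $ i)" for i
    proof -
      have "(\<Sum>j\<in>UNIV. y $ j) = (\<Sum>j\<in>(UNIV :: 'n set). y $ i)"
        using eq by (intro sum.cong) metis+
      then show ?thesis by (simp add: sum_constant_scaleR)
    qed
    ultimately show "y = 0" by (simp add: vec_eq_iff)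
  qed
  then obtain \<Phi> where \<Phi>: "((\<lambda>t. star_profile \<sigma> t (U t f)) \<longlongrightarrow> \<Phi>) at_top"
    by (auto simp: has_profile_def)
  have "norm \<Phi> = norm f"
  proof (rule tendsto_unique)
    show "((\<lambda>t. norm (star_profile \<sigma> t (U t f))) \<longlongrightarrow> norm \<Phi>) at_top" by (intro tendsto_intros \<Phi>)
    show "((\<lambda>t. norm (star_profile \<sigma> t (U t f))) \<longlongrightarrow> norm f) at_top"
      by (rule tendsto_eventually, use eventually_gt_at_top[of 0] in eventually_elim)
         (simp add: norm_star_profile norm_U)
  qed simp
  with \<Phi> show ?thesis by blast
qed

section \<open>Test waves that do not see the vertex condition\<close>

lemma norm_gauss_scaled:
  assumes t: "t > 0" and a: "a > 0"
  shows "norm (gauss m (Complex (a / (4 * t\<^sup>2)) (- (\<sigma> / (4 * t))))) = exp ((of_nat m + 1/2) * ln (2 * t)) * norm (gauss m (of_real a))"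
    and "profile \<sigma> t (gauss m (Complex (a / (4 * t\<^sup>2)) (- (\<sigma> / (4 * t)))))
      = scaleC_half_line (of_real (exp ((of_nat m + 1/2) * ln (2 * t)))) (gauss m (of_real a))"
proof -
  let ?\<beta> = "Complex (a / (4 * t\<^sup>2)) (- (\<sigma> / (4 * t)))"
  have "of_real (4 * t\<^sup>2) * ?\<beta> + \<i> * of_real (\<sigma> * t) = of_real a"
    using t by (simp add: complex_eq_iff power2_eq_square)
  then show "profile \<sigma> t (gauss m ?\<beta>) = scaleC_half_line (of_real (exp ((of_nat m + 1/2) * ln (2 * t)))) (gauss m (of_real a))"
    using profile_gauss[OF t, of ?\<beta> \<sigma> m] t a by (simp only: sqrt_power_eq_exp[OF t]) simp
  then show "norm (gauss m ?\<beta>) = exp ((of_nat m + 1/2) * ln (2 * t)) * norm (gauss m (of_real a))"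
    using norm_profile[OF t, of \<sigma> "gauss m ?\<beta>"] by (simp add: norm_scaleC_half_line del: of_real_exp)
qed

text \<open>In profile variables the equation becomes \<open>\<eta>\<^sub>t = i\<sigma>\<eta>\<^sub>y\<^sub>y/4t\<^sup>2\<close>, so a function with a constant profile
  is a solution up to an error of size \<open>t\<^bsup>-2\<^esup>\<close>, which is integrable in time. The profile
  \<open>y\<^sup>2 exp (- a y\<^sup>2)\<close> vanishes to second order at the vertex, hence the wave lies in the domain of the
  Laplacian for every homogeneous vertex condition.\<close>

lemma (in star_group) test_wave:
  fixes c :: "complex^'n"
  assumes T: "T = star_laplacian bc" and bc: "bc 0 0" and a: "a > 0"
  obtains v K where "K \<ge> 0" "\<And>t. t > 0 \<Longrightarrow> star_profile \<sigma> t (v t) = tensor c (gauss 2 (of_real a))"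
    and "\<And>s t. 0 < s \<Longrightarrow> s \<le> t \<Longrightarrow> norm (U (- t) (v t) - U (- s) (v s)) \<le> K / s - K / t"
proof -
  \<comment> \<open>\<open>(2t)\<^bsup>-5/2\<^esup> x\<^sup>2 exp (- \<beta> x\<^sup>2)\<close> has the profile \<open>y\<^sup>2 exp (- a y\<^sup>2)\<close> at every time.\<close>
  define \<alpha> where "\<alpha> t = complex_of_real (exp (- (5/2) * ln (2 * t)))" for t :: real
  define \<beta> where "\<beta> t = Complex (a / (4 * t\<^sup>2)) (- (\<sigma> / (4 * t)))" for t
  define v where "v t = tensor c (scaleC_half_line (\<alpha> t) (gauss 2 (\<beta> t)))" for t
  define N where "N m = norm (gauss m (of_real a))" for m
  define K where "K = norm c * (N 0 / 2 + 5/2 * a * N 2 + a\<^sup>2 * N 4)"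
  have s2: "complex_of_real \<sigma> * complex_of_real \<sigma> = 1"
    using \<sigma> by (metis of_real_1 of_real_mult power2_eq_square)
  have n\<sigma>: "\<bar>\<sigma>\<bar> = 1" using \<sigma> by (auto simp: power2_eq_1_iff)
  have K: "K \<ge> 0" using a by (auto simp: K_def N_def intro!: mult_nonneg_nonneg add_nonneg_nonneg)
  have v: "star_profile \<sigma> t (v t) = tensor c (gauss 2 (of_real a))" if t: "t > 0" for t
  proof -
    have "\<alpha> t * of_real (exp ((of_nat 2 + 1/2) * ln (2 * t))) = 1"
      unfolding \<alpha>_def of_real_mult[symmetric] mult_exp_exp by (simp add: algebra_simps)
    then show ?thesis
      unfolding v_def \<beta>_def
      by (simp only: star_profile_tensor[OF t] profile_scaleC[OF t] norm_gauss_scaled(2)[OF t a]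
          scaleC_half_line_scaleC scaleC_half_line_one)
  qed
  define \<alpha>' where "\<alpha>' t = - (5/2) * \<alpha> t / of_real t" for t :: real
  define \<beta>' where "\<beta>' t = Complex (- (a / (2 * t ^ 3))) (\<sigma> / (4 * t\<^sup>2))" for t :: real
  have \<alpha>: "(\<alpha> has_vector_derivative \<alpha>' t) (at t)" if "t > 0" for t
  proof -
    have "((\<lambda>t. exp (- (5/2) * ln (2 * t))) has_real_derivative exp (- (5/2) * ln (2 * t)) * (- (5/2) / t)) (at t)"
      using that by (auto intro!: derivative_eq_intros simp: field_simps)
    then have "((\<lambda>t. complex_of_real (exp (- (5/2) * ln (2 * t)))) has_vector_derivative
        of_real (exp (- (5/2) * ln (2 * t)) * (- (5/2) / t))) (at t)"
      by (rule has_vector_derivative_of_real)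
    then show ?thesis by (simp add: \<alpha>_def[abs_def] \<alpha>'_def mult.commute)
  qed
  have \<beta>: "(\<beta> has_vector_derivative \<beta>' t) (at t)" if "t > 0" for t
  proof -
    have "((\<lambda>t. a / (4 * t\<^sup>2)) has_real_derivative - (a / (2 * t ^ 3))) (at t)"
      using that by (auto intro!: derivative_eq_intros simp: field_simps power2_eq_square power3_eq_cube)
    moreover have "((\<lambda>t. - (\<sigma> / (4 * t))) has_real_derivative \<sigma> / (4 * t\<^sup>2)) (at t)"
      using that by (auto intro!: derivative_eq_intros simp: field_simps power2_eq_square)
    ultimately show ?thesis
      unfolding \<beta>_def[abs_def] \<beta>'_def
      by (auto simp: has_vector_derivative_complex_iff)
  qed
  have Re\<beta>: "Re (\<beta> t) > 0" if "t > 0" for t using that a by (simp add: \<beta>_def)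
  have deriv: "((\<lambda>s. U (- s) (v s)) has_vector_derivative
      U (- t) (tensor c (gauss_defect \<sigma> 2 (\<alpha> t) (\<alpha>' t) (\<beta> t) (\<beta>' t)))) (at t)" if "t > 0" for t
    unfolding v_def
    by (rule gauss_wave_derivative[where bc = bc, OF T _ \<alpha> \<beta> Re\<beta>]) (use that bc in auto)
  have defect: "norm (tensor c (gauss_defect \<sigma> 2 (\<alpha> t) (\<alpha>' t) (\<beta> t) (\<beta>' t))) \<le> K / t\<^sup>2" if t: "t > 0" for t
  proof -
    have n\<alpha>: "norm (\<alpha> t) = exp (- (5/2) * ln (2 * t))" by (simp add: \<alpha>_def del: of_real_exp)
    have nG: "norm (gauss m (\<beta> t)) = exp ((of_nat m + 1/2) * ln (2 * t)) * N m" for m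
      unfolding \<beta>_def N_def by (rule norm_gauss_scaled(1)[OF t a])
    have e2: "exp (2 * ln (2 * t)) = 4 * t\<^sup>2"
      using t exp_of_nat_mult[of 2 "ln (2 * t)"] by (simp add: power_mult_distrib)
    have \<beta>eq: "\<beta> t = of_real (a / (4 * t\<^sup>2)) - \<i> * of_real (\<sigma> / (4 * t))"
      by (simp add: \<beta>_def complex_eq_iff)
    \<comment> \<open>The phase of the wave makes the leading terms cancel: order \<open>t\<^bsup>-1\<^esup>\<close> in \<open>e1\<close>, orders \<open>t\<^bsup>-2\<^esup>\<close> and \<open>t\<^bsup>-3\<^esup>\<close> in \<open>b2\<close>.\<close>
    have e1: "\<alpha>' t + 2 * \<i> * of_real \<sigma> * of_nat (2 * 2 + 1) * \<alpha> t * \<beta> t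
        = \<alpha> t * (\<i> * of_real (5/2 * \<sigma> * a / t\<^sup>2))"
      using t s2 by (simp add: \<alpha>'_def \<beta>eq field_simps power2_eq_square)
    have E1: "exp (- (5/2) * ln (2 * t)) * exp ((of_nat 2 + 1/2) * ln (2 * t)) = 1"
      unfolding mult_exp_exp by (simp add: algebra_simps)
    have "norm (scaleC_half_line (\<alpha> t * (\<i> * of_real (5/2 * \<sigma> * a / t\<^sup>2))) (gauss 2 (\<beta> t)))
        = (exp (- (5/2) * ln (2 * t)) * exp ((of_nat 2 + 1/2) * ln (2 * t)))
          * (norm \<i> * norm (complex_of_real (5/2 * \<sigma> * a / t\<^sup>2)) * N 2)"
      unfolding norm_scaleC_half_line norm_mult nG n\<alpha> by (simp only: mult_ac)
    also have "\<dots> = 5/2 * a * N 2 / t\<^sup>2"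
      unfolding E1 using a n\<sigma> by (simp only: norm_of_real) (simp add: abs_mult)
    finally have 1: "norm (scaleC_half_line (\<alpha>' t + 2 * \<i> * of_real \<sigma> * of_nat (2 * 2 + 1) * \<alpha> t * \<beta> t) (gauss 2 (\<beta> t)))
        = 5/2 * a * N 2 / t\<^sup>2" unfolding e1 .
    have b2: "\<beta>' t + 4 * \<i> * of_real \<sigma> * (\<beta> t)\<^sup>2 = \<i> * of_real (\<sigma> * a\<^sup>2 / (4 * t ^ 4))"
    proof -
      have "\<sigma> * (\<sigma> * x) = x" for x using \<sigma> by (simp add: power2_eq_square mult.assoc[symmetric])
      then show ?thesis
        using t by (simp add: \<beta>_def \<beta>'_def complex_eq_iff field_simps power2_eq_square power3_eq_cube power4_eq_xxxx)
    qed
    have E2: "exp (- (5/2) * ln (2 * t)) * exp ((of_nat (2 + 2) + 1/2) * ln (2 * t)) = 4 * t\<^sup>2"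
      unfolding mult_exp_exp e2[symmetric] by (simp add: algebra_simps)
    have "norm (scaleC_half_line (\<alpha> t * (\<i> * of_real (\<sigma> * a\<^sup>2 / (4 * t ^ 4)))) (gauss (2 + 2) (\<beta> t)))
        = (exp (- (5/2) * ln (2 * t)) * exp ((of_nat (2 + 2) + 1/2) * ln (2 * t)))
          * (norm \<i> * norm (complex_of_real (\<sigma> * a\<^sup>2 / (4 * t ^ 4))) * N (2 + 2))"
      unfolding norm_scaleC_half_line norm_mult nG n\<alpha> by (simp only: mult_ac)
    also have "\<dots> = a\<^sup>2 * N 4 / t\<^sup>2"
      unfolding E2 using a n\<sigma> t by (simp only: norm_of_real) (simp add: abs_mult power4_eq_xxxx power2_eq_square)
    finally have 2: "norm (scaleC_half_line (\<alpha> t * (\<beta>' t + 4 * \<i> * of_real \<sigma> * (\<beta> t)\<^sup>2)) (gauss (2 + 2) (\<beta> t)))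
        = a\<^sup>2 * N 4 / t\<^sup>2" unfolding b2 .
    have "exp (- (5/2) * ln (2 * t)) * exp ((of_nat 0 + 1/2) * ln (2 * t)) * (4 * t\<^sup>2) = 1"
      unfolding e2[symmetric] mult_exp_exp by (simp add: algebra_simps)
    then have E3: "exp (- (5/2) * ln (2 * t)) * exp ((of_nat 0 + 1/2) * ln (2 * t)) = 1 / (4 * t\<^sup>2)"
      using t by (simp add: field_simps)
    have "norm (scaleC_half_line (\<i> * of_real \<sigma> * \<alpha> t * of_nat (2 * (2 - 1))) (gauss 0 (\<beta> t)))
        = (exp (- (5/2) * ln (2 * t)) * exp ((of_nat 0 + 1/2) * ln (2 * t)))
          * (norm \<i> * norm (complex_of_real \<sigma>) * norm (of_nat (2 * (2 - 1)) :: complex) * N 0)"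
      unfolding norm_scaleC_half_line norm_mult nG n\<alpha> by (simp only: mult_ac)
    also have "\<dots> = N 0 / 2 / t\<^sup>2"
      unfolding E3 using n\<sigma> by (simp only: norm_of_real) simp
    finally have 3: "norm (scaleC_half_line (\<i> * of_real \<sigma> * \<alpha> t * of_nat (2 * (2 - 1))) (gauss (2 - 2) (\<beta> t)))
        = N 0 / 2 / t\<^sup>2" by simp
    have "norm (gauss_defect \<sigma> 2 (\<alpha> t) (\<alpha>' t) (\<beta> t) (\<beta>' t))
        \<le> 5/2 * a * N 2 / t\<^sup>2 + a\<^sup>2 * N 4 / t\<^sup>2 + N 0 / 2 / t\<^sup>2"
      unfolding gauss_defect_def 1[symmetric] 2[symmetric] 3[symmetric]
      by (intro order_trans[OF norm_triangle_ineq4] add_mono order_refl)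
    then have "norm c * norm (gauss_defect \<sigma> 2 (\<alpha> t) (\<alpha>' t) (\<beta> t) (\<beta>' t))
        \<le> norm c * (5/2 * a * N 2 / t\<^sup>2 + a\<^sup>2 * N 4 / t\<^sup>2 + N 0 / 2 / t\<^sup>2)"
      by (rule mult_left_mono) simp
    also have "\<dots> = K / t\<^sup>2" by (simp add: K_def add_divide_distrib distrib_left)
    finally show ?thesis by (simp add: norm_tensor)
  qed
  have "norm (U (- t) (v t) - U (- s) (v s)) \<le> K / s - K / t" if st: "0 < s" "s \<le> t" for s t
  proof (cases "s = t")
    case False
    have "norm (U (- t) (v t) - U (- s) (v s)) \<le> - K / t - - K / s"
    proof (rule differentiable_bound_general[where f' = "\<lambda>t. U (- t) (tensor c (gauss_defect \<sigma> 2 (\<alpha> t) (\<alpha>' t) (\<beta> t) (\<beta>' t)))"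
          and \<phi>' = "\<lambda>t. K / t\<^sup>2" and \<phi> = "\<lambda>t. - K / t"])
      show "s < t" using st False by simp
      show "continuous_on {s..t} (\<lambda>t. U (- t) (v t))"
        using st by (intro continuous_at_imp_continuous_on ballI has_vector_derivative_continuous[OF deriv]) auto
      show "continuous_on {s..t} (\<lambda>t. - K / t)"
        using st by (intro continuous_intros) auto
      fix x assume x: "s < x" "x < t"
      show "((\<lambda>t. U (- t) (v t)) has_vector_derivative U (- x) (tensor c (gauss_defect \<sigma> 2 (\<alpha> x) (\<alpha>' x) (\<beta> x) (\<beta>' x)))) (at x)"
        using st x by (intro deriv) simp
      have "((\<lambda>t. - K / t) has_real_derivative K / x\<^sup>2) (at x)"
        using st x by (auto intro!: derivative_eq_intros simp: field_simps power2_eq_square)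
      then show "((\<lambda>t. - K / t) has_vector_derivative K / x\<^sup>2) (at x)"
        by (simp add: has_real_derivative_iff_has_vector_derivative)
      show "norm (U (- x) (tensor c (gauss_defect \<sigma> 2 (\<alpha> x) (\<alpha>' x) (\<beta> x) (\<beta>' x)))) \<le> K / x\<^sup>2"
        using st x by (simp add: norm_U defect)
    qed
    then show ?thesis by simp
  qed simp
  with K v that show ?thesis by blast
qed

section \<open>A product rule for Bochner integrals\<close>

text \<open>Freezing \<open>b\<close> at the right end point makes the product rule exact; \<open>\<delta>\<close> bounds what this changes.\<close>

lemma inner_increment_step:
  fixes a b a' :: "real \<Rightarrow> 'v::{real_inner, banach, second_countable_topology}"
  assumes st: "s \<le> t"
    and int: "set_integrable lborel {s<..t} a'" and intb: "set_integrable lborel {s<..t} (\<lambda>r. inner (a' r) (b r))"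
    and a: "a t - a s = (LBINT r:{s<..t}. a' r)"
    and b: "\<And>r. s \<le> r \<Longrightarrow> r \<le> t \<Longrightarrow> norm (b t - b r) \<le> \<delta>"
    and A: "norm (a s) \<le> A"
  shows "\<bar>inner (a t) (b t) - inner (a s) (b s) - (LBINT r:{s<..t}. inner (a' r) (b r))\<bar>
      \<le> A * norm (b t - b s) + \<delta> * (LBINT r:{s<..t}. norm (a' r))"
proof -
  have intc: "set_integrable lborel {s<..t} (\<lambda>r. inner (a' r) (b t))"
    using int unfolding set_integrable_def by (simp add: inner_scaleR_left[symmetric] del: inner_scaleR_left)
  have "inner (a t - a s) (b t) = (LBINT r:{s<..t}. inner (a' r) (b t))"
    using integral_inner_left[of "b t" lborel "\<lambda>r. indicat_real {s<..t} r *\<^sub>R a' r"] int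
    unfolding a set_lebesgue_integral_def set_integrable_def by simp
  then have "inner (a t) (b t) - inner (a s) (b s) - (LBINT r:{s<..t}. inner (a' r) (b r))
      = inner (a s) (b t - b s) + ((LBINT r:{s<..t}. inner (a' r) (b t)) - (LBINT r:{s<..t}. inner (a' r) (b r)))"
    by (simp add: inner_diff_left inner_diff_right)
  also have "(LBINT r:{s<..t}. inner (a' r) (b t)) - (LBINT r:{s<..t}. inner (a' r) (b r))
      = (LBINT r:{s<..t}. inner (a' r) (b t - b r))"
    by (subst set_integral_diff(2)[OF intc intb, symmetric]) (simp add: inner_diff_right)
  finally have eq: "inner (a t) (b t) - inner (a s) (b s) - (LBINT r:{s<..t}. inner (a' r) (b r))
      = inner (a s) (b t - b s) + (LBINT r:{s<..t}. inner (a' r) (b t - b r))" .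
  have "\<bar>LBINT r:{s<..t}. inner (a' r) (b t - b r)\<bar> \<le> (LBINT r:{s<..t}. \<delta> * norm (a' r))"
    unfolding set_lebesgue_integral_def
  proof (rule order_trans[OF integral_abs_bound], rule integral_mono)
    show "integrable lborel (\<lambda>r. \<bar>indicat_real {s<..t} r *\<^sub>R inner (a' r) (b t - b r)\<bar>)"
      using set_integral_diff(1)[OF intc intb] unfolding set_integrable_def inner_diff_right by (rule integrable_abs)
    show "integrable lborel (\<lambda>r. indicat_real {s<..t} r *\<^sub>R (\<delta> * norm (a' r)))"
      using set_integrable_mult_right[OF set_integrable_norm[OF int], of \<delta>] unfolding set_integrable_def .
    fix r
    show "\<bar>indicat_real {s<..t} r *\<^sub>R inner (a' r) (b t - b r)\<bar> \<le> indicat_real {s<..t} r *\<^sub>R (\<delta> * norm (a' r))"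
    proof (cases "r \<in> {s<..t}")
      case True
      then have "\<bar>inner (a' r) (b t - b r)\<bar> \<le> norm (a' r) * \<delta>"
        using b[of r] by (intro order_trans[OF Cauchy_Schwarz_ineq2] mult_left_mono) auto
      then show ?thesis using True by (simp add: mult.commute)
    qed simp
  qed
  moreover have "(LBINT r:{s<..t}. \<delta> * norm (a' r)) = \<delta> * (LBINT r:{s<..t}. norm (a' r))"
    by (rule set_integral_mult_right)
  moreover have "\<bar>inner (a s) (b t - b s)\<bar> \<le> A * norm (b t - b s)"
    using A by (intro order_trans[OF Cauchy_Schwarz_ineq2] mult_right_mono) auto
  ultimately show ?thesis unfolding eq by linarith
qed

text \<open>The product rule for \<open>\<langle>a,b\<rangle>\<close> when \<open>a\<close> is an indefinite Bochner integral and the variation of \<open>b\<close> is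
  bounded by that of \<open>\<phi>\<close>. On a fine partition of \<open>[S,T]\<close> the errors of freezing \<open>b\<close> in each cell add up
  to at most \<open>\<epsilon> \<integral> \<parallel>a'\<parallel>\<close>, where \<open>\<epsilon>\<close> bounds the increments of \<open>\<phi>\<close> on the cells;
  pairing \<open>a\<close> with the increments of \<open>b\<close> contributes the right-hand side.\<close>

lemma inner_increment:
  fixes a b a' :: "real \<Rightarrow> 'v::{real_inner, banach, second_countable_topology}"
  assumes ST: "S \<le> T" and int: "set_integrable lborel {S<..T} a'"
    and a: "\<And>s t. S \<le> s \<Longrightarrow> s \<le> t \<Longrightarrow> t \<le> T \<Longrightarrow> a t - a s = (LBINT r:{s<..t}. a' r)"
    and b: "\<And>s t. S \<le> s \<Longrightarrow> s \<le> t \<Longrightarrow> t \<le> T \<Longrightarrow> norm (b t - b s) \<le> \<phi> t - \<phi> s"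
    and \<phi>: "continuous_on {S..T} \<phi>"
    and A: "\<And>s. S \<le> s \<Longrightarrow> s \<le> T \<Longrightarrow> norm (a s) \<le> A"
  shows "set_integrable lborel {S<..T} (\<lambda>r. inner (a' r) (b r))"
    and "\<bar>inner (a T) (b T) - inner (a S) (b S) - (LBINT r:{S<..T}. inner (a' r) (b r))\<bar> \<le> A * (\<phi> T - \<phi> S)"
proof -
  have uc: "\<exists>d>0. \<forall>x\<in>{S..T}. \<forall>y\<in>{S..T}. dist y x < d \<longrightarrow> dist (\<phi> y) (\<phi> x) < e" if "e > 0" for e
    using compact_uniformly_continuous[OF \<phi> compact_Icc] that unfolding uniformly_continuous_on_def by blast
  have "continuous_on {S..T} b"
    unfolding continuous_on_iff
  proof (intro ballI allI impI)
    fix x e assume x: "x \<in> {S..T}" and "(e::real) > 0"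
    then obtain d where d: "d > 0" "\<forall>x\<in>{S..T}. \<forall>y\<in>{S..T}. dist y x < d \<longrightarrow> dist (\<phi> y) (\<phi> x) < e"
      using uc by blast
    have "dist (b y) (b x) < e" if "y \<in> {S..T}" "dist y x < d" for y
    proof -
      have "dist (b y) (b x) \<le> dist (\<phi> y) (\<phi> x)"
        using b[of x y] b[of y x] x that(1)
        by (cases "x \<le> y") (auto simp: dist_norm norm_minus_commute[of "b y"] abs_if)
      then show ?thesis using d(2) x that by (meson le_less_trans)
    qed
    then show "\<exists>d>0. \<forall>y\<in>{S..T}. dist y x < d \<longrightarrow> dist (b y) (b x) < e" using d(1) by blast
  qed
  then have bm: "(\<lambda>r. indicat_real {S..T} r *\<^sub>R b r) \<in> borel_measurable lborel"
    using borel_measurable_continuous_on_indicator[of "{S..T}" b] by simp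
  show intb: "set_integrable lborel {S<..T} (\<lambda>r. inner (a' r) (b r))"
  proof -
    have "compact (b ` {S..T})" using \<open>continuous_on {S..T} b\<close> by (intro compact_continuous_image) auto
    then obtain B where B: "\<And>r. r \<in> {S..T} \<Longrightarrow> norm (b r) \<le> B"
      by (metis bounded_iff compact_imp_bounded image_eqI)
    show ?thesis
      unfolding set_integrable_def
    proof (rule Bochner_Integration.integrable_bound)
      show "integrable lborel (\<lambda>r. B * norm (indicat_real {S<..T} r *\<^sub>R a' r))"
        using int unfolding set_integrable_def by (intro integrable_mult_right integrable_norm)
      have [measurable]: "(\<lambda>r. indicat_real {S<..T} r *\<^sub>R a' r) \<in> borel_measurable lborel"
        using int unfolding set_integrable_def by auto
      have "(\<lambda>r. inner (indicat_real {S<..T} r *\<^sub>R a' r) (indicat_real {S..T} r *\<^sub>R b r)) \<in> borel_measurable lborel"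
        using bm by measurable
      moreover have "(\<lambda>r. inner (indicat_real {S<..T} r *\<^sub>R a' r) (indicat_real {S..T} r *\<^sub>R b r))
          = (\<lambda>r. indicat_real {S<..T} r *\<^sub>R inner (a' r) (b r))"
        by (auto simp: indicator_def fun_eq_iff)
      ultimately show "(\<lambda>r. indicat_real {S<..T} r *\<^sub>R inner (a' r) (b r)) \<in> borel_measurable lborel" by simp
      show "AE r in lborel. norm (indicat_real {S<..T} r *\<^sub>R inner (a' r) (b r)) \<le> norm (B * norm (indicat_real {S<..T} r *\<^sub>R a' r))"
      proof (rule AE_I2)
        fix r
        show "norm (indicat_real {S<..T} r *\<^sub>R inner (a' r) (b r)) \<le> norm (B * norm (indicat_real {S<..T} r *\<^sub>R a' r))"
        proof (cases "r \<in> {S<..T}")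
          case True
          then have "norm (b r) \<le> B" using B by simp
          then have "B \<ge> 0" using norm_ge_zero[of "b r"] by linarith
          have "\<bar>inner (a' r) (b r)\<bar> \<le> norm (a' r) * B"
            using \<open>norm (b r) \<le> B\<close>
            by (intro order_trans[OF Cauchy_Schwarz_ineq2] mult_left_mono) auto
          then show ?thesis using True \<open>B \<ge> 0\<close> by (simp add: abs_mult mult.commute)
        qed simp
      qed
    qed
  qed
  define M where "M t = (LBINT r:{S<..t}. norm (a' r))" for t
  define D where "D t = inner (a t) (b t) - inner (a S) (b S) - (LBINT r:{S<..t}. inner (a' r) (b r))" for t
  have split: "(LBINT r:{S<..t}. f r) = (LBINT r:{S<..s}. f r) + (LBINT r:{s<..t}. f r)"
    if "set_integrable lborel {S<..T} f" "S \<le> s" "s \<le> t" "t \<le> T" for f :: "real \<Rightarrow> real" and s t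
  proof -
    have "{S<..t} = {S<..s} \<union> {s<..t}" using that by auto
    moreover have "(LBINT r:{S<..s} \<union> {s<..t}. f r) = (LBINT r:{S<..s}. f r) + (LBINT r:{s<..t}. f r)"
      using that(2-) by (intro set_integral_Un set_integrable_subset[OF that(1)]) auto
    ultimately show ?thesis by simp
  qed
  have step: "\<bar>D t - D s\<bar> \<le> A * (\<phi> t - \<phi> s) + \<epsilon> * (M t - M s)"
    if st: "S \<le> s" "s \<le> t" "t \<le> T" and \<epsilon>: "\<phi> t - \<phi> s \<le> \<epsilon>" for s t \<epsilon>
  proof -
    have "norm (b t - b r) \<le> \<epsilon>" if "s \<le> r" "r \<le> t" for r
    proof -
      have "\<phi> s \<le> \<phi> r" using order_trans[OF norm_ge_zero b[of s r]] st that by simp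
      then show ?thesis using b[of r t] st that \<epsilon> by simp
    qed
    then have inc: "\<bar>inner (a t) (b t) - inner (a s) (b s) - (LBINT r:{s<..t}. inner (a' r) (b r))\<bar>
        \<le> A * norm (b t - b s) + \<epsilon> * (LBINT r:{s<..t}. norm (a' r))"
      using st by (intro inner_increment_step set_integrable_subset[OF int] set_integrable_subset[OF intb] a A) auto
    have "A \<ge> 0" using order_trans[OF norm_ge_zero A[of s]] st by simp
    then have Ab: "A * norm (b t - b s) \<le> A * (\<phi> t - \<phi> s)" using b st by (intro mult_left_mono) auto
    have Dd: "D t - D s = inner (a t) (b t) - inner (a s) (b s) - (LBINT r:{s<..t}. inner (a' r) (b r))"
      unfolding D_def split[OF intb st] by simp
    have Md: "M t - M s = (LBINT r:{s<..t}. norm (a' r))"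
      unfolding M_def using split[OF set_integrable_norm[OF int] st] by simp
    show ?thesis
      unfolding Dd Md by (rule order_trans[OF inc add_right_mono[OF Ab]])
  qed
  have main: "\<bar>D T\<bar> \<le> A * (\<phi> T - \<phi> S) + \<epsilon> * M T" if \<epsilon>: "\<epsilon> > 0" for \<epsilon>
  proof -
    obtain d where d: "d > 0" "\<forall>x\<in>{S..T}. \<forall>y\<in>{S..T}. dist y x < d \<longrightarrow> dist (\<phi> y) (\<phi> x) < \<epsilon>"
      using uc[OF \<epsilon>] by blast
    \<comment> \<open>Equidistant partition whose mesh is finer than the modulus of continuity of \<open>\<phi>\<close> for \<open>\<epsilon>\<close>.\<close>
    obtain n0 :: nat where "(T - S) / d < real n0" using reals_Archimedean2 by blast
    define n where "n = Suc n0"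
    have n: "n > 0" "(T - S) / d < real n" using \<open>(T - S) / d < real n0\<close> by (auto simp: n_def)
    define h where "h = (T - S) / real n"
    have h: "0 \<le> h" "h < d" using ST n d(1) by (auto simp: h_def field_simps)
    define \<tau> where "\<tau> k = S + real k * h" for k :: nat
    have \<tau>T: "\<tau> n = T" using n by (simp add: \<tau>_def h_def)
    have \<tau>_le: "\<tau> k \<le> T" if "k \<le> n" for k
      unfolding \<tau>T[symmetric] \<tau>_def using that h by (simp add: mult_right_mono)
    have \<tau>S: "S \<le> \<tau> k" for k using h by (simp add: \<tau>_def)
    have "\<bar>D (\<tau> k)\<bar> \<le> A * (\<phi> (\<tau> k) - \<phi> S) + \<epsilon> * M (\<tau> k)" if "k \<le> n" for k
      using that
    proof (induction k)
      case 0
      show ?case by (simp add: \<tau>_def D_def M_def set_lebesgue_integral_def)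
    next
      case (Suc k)
      have le: "\<tau> k \<le> \<tau> (Suc k)" using h by (simp add: \<tau>_def distrib_right)
      have "dist (\<tau> (Suc k)) (\<tau> k) < d" using h by (simp add: \<tau>_def dist_real_def distrib_right)
      then have "dist (\<phi> (\<tau> (Suc k))) (\<phi> (\<tau> k)) < \<epsilon>"
        using d(2) \<tau>S \<tau>_le[of k] \<tau>_le[OF Suc.prems] Suc.prems by simp
      then have "\<phi> (\<tau> (Suc k)) - \<phi> (\<tau> k) \<le> \<epsilon>" by (simp add: dist_real_def)
      from step[OF \<tau>S le \<tau>_le[OF Suc.prems] this] Suc show ?case by (simp add: algebra_simps)
    qed
    from this[of n] show ?thesis by (simp add: \<tau>T)
  qed
  have "\<bar>D T\<bar> \<le> A * (\<phi> T - \<phi> S)"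
  proof (rule field_le_epsilon)
    fix e :: real assume e: "e > 0"
    have M0: "M T \<ge> 0" unfolding M_def set_lebesgue_integral_def by (intro integral_nonneg_AE AE_I2) simp
    have "\<bar>D T\<bar> \<le> A * (\<phi> T - \<phi> S) + e / (M T + 1) * M T" using e M0 by (intro main) simp
    also have "e / (M T + 1) * M T \<le> e" using e M0 by (simp add: field_simps)
    finally show "\<bar>D T\<bar> \<le> A * (\<phi> T - \<phi> S) + e" by simp
  qed
  then show "\<bar>inner (a T) (b T) - inner (a S) (b S) - (LBINT r:{S<..T}. inner (a' r) (b r))\<bar> \<le> A * (\<phi> T - \<phi> S)"
    by (simp add: D_def)
qed

section \<open>The power nonlinearity\<close>

definition pow_nl :: "real \<Rightarrow> complex \<Rightarrow> complex" where
  "pow_nl p z = of_real (norm z powr p) * z"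

lemma norm_pow_nl: "norm (pow_nl p z) = norm z powr p * norm z"
  by (simp add: pow_nl_def norm_mult)

lemma pow_nl_diff:
  assumes p: "0 < p" "p < 1"
  shows "norm (pow_nl p a - pow_nl p b) \<le> 2 * (norm a powr p + norm b powr p) * norm (a - b)"
proof -
  have *: "norm (pow_nl p a - pow_nl p b) \<le> 2 * norm a powr p * norm (a - b)" if le: "norm b \<le> norm a" for a b
  proof (cases "a = 0")
    case True
    then show ?thesis using le by (simp add: pow_nl_def)
  next
    case False
    define x where "x = norm b / norm a"
    have x: "0 \<le> x" "x \<le> 1" using le False by (auto simp: x_def)
    have nb: "norm b = x * norm a" using False by (simp add: x_def)
    \<comment> \<open>This turns the difference of powers into a difference of norms, without a derivative of the power at 0.\<close>
    have "x \<le> x powr p"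
      using powr_mono'[of p 1 x] x p by (cases "x = 0") auto
    have "pow_nl p a - pow_nl p b = of_real (norm a powr p) * (a - b) + of_real (norm a powr p - norm b powr p) * b"
      by (simp add: pow_nl_def algebra_simps)
    also have "norm \<dots> \<le> norm a powr p * norm (a - b) + \<bar>norm a powr p - norm b powr p\<bar> * norm b"
      by (rule order_trans[OF norm_triangle_ineq]) (simp add: norm_mult del: of_real_diff)
    also have "\<bar>norm a powr p - norm b powr p\<bar> = norm a powr p * (1 - x powr p)"
      using x powr_mono2[of p "norm b" "norm a"] le p by (simp add: nb powr_mult algebra_simps)
    also have "norm a powr p * (1 - x powr p) * norm b \<le> norm a powr p * (1 - x) * norm a"
      using \<open>x \<le> x powr p\<close> x le by (intro mult_mono) (use p in \<open>auto intro!: mult_nonneg_nonneg powr_le1\<close>)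
    also have "\<dots> = norm a powr p * (norm a - norm b)" by (simp add: nb algebra_simps)
    also have "\<dots> \<le> norm a powr p * norm (a - b)" by (intro mult_left_mono norm_triangle_ineq2) auto
    finally show ?thesis by (simp add: mult_ac)
  qed
  show ?thesis
  proof (cases "norm b \<le> norm a")
    case True
    have "2 * norm a powr p * norm (a - b) \<le> 2 * (norm a powr p + norm b powr p) * norm (a - b)"
      by (intro mult_right_mono) auto
    then show ?thesis using *[OF True] by linarith
  next
    case False
    have "2 * norm b powr p * norm (b - a) \<le> 2 * (norm a powr p + norm b powr p) * norm (b - a)"
      by (intro mult_right_mono) auto
    then show ?thesis using *[of a b] False by (simp add: norm_minus_commute)
  qed
qed

text \<open>Splits a power into a constant and a part that is linear with a small coefficient for large \<open>R\<close>;
  together with the next lemma it replaces interpolation between Lebesgue spaces.\<close>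

lemma powr_le_split:
  assumes "0 < p" "p < (1::real)" "R > 0" "x \<ge> 0"
  shows "x powr p \<le> R powr p + R powr (p - 1) * x"
proof (cases "x \<le> R")
  case True
  then have "x powr p \<le> R powr p" using assms by (intro powr_mono2) auto
  then show ?thesis using assms by (simp add: add_increasing2)
next
  case False
  then have "x powr p = x powr (p - 1) * x" using assms by (simp add: powr_diff)
  also have "\<dots> \<le> R powr (p - 1) * x"
    using False assms by (intro mult_right_mono powr_mono2') auto
  finally show ?thesis by (simp add: add_increasing)
qed

text \<open>Against a weight of finite mass, an \<open>L\<^sup>q\<close> quantity that tends to zero makes the \<open>L\<^sup>1\<close> quantity tend to
  zero.\<close>

lemma le_split_powr:
  assumes "1 \<le> q" "\<epsilon> > 0" "x \<ge> (0::real)"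
  shows "x \<le> \<epsilon> + \<epsilon> powr (1 - q) * x powr q"
proof (cases "x \<le> \<epsilon>")
  case True
  then show ?thesis by (simp add: add_increasing2)
next
  case False
  then have x: "x > 0" using assms by linarith
  have "x = x powr (1 - q) * x powr q" using x by (simp add: powr_add[symmetric])
  also have "\<dots> \<le> \<epsilon> powr (1 - q) * x powr q"
    using False assms by (intro mult_right_mono powr_mono2') auto
  finally show ?thesis using assms by simp
qed

lemma norm_pow_nl_le:
  assumes "0 < p" "p < 1"
  shows "norm (pow_nl p z) \<le> 1 + 2 * (norm z)\<^sup>2"
proof -
  have "norm z powr p * norm z \<le> (1 powr p + 1 powr (p - 1) * norm z) * norm z"
    using assms by (intro mult_right_mono powr_le_split) auto
  also have "\<dots> = norm z + (norm z)\<^sup>2" by (simp add: algebra_simps power2_eq_square)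
  finally have "norm (pow_nl p z) \<le> norm z + (norm z)\<^sup>2" by (simp only: norm_pow_nl)
  moreover have "2 * norm z \<le> 1 + (norm z)\<^sup>2"
    using sum_squares_bound[of 1 "norm z"] by simp
  ultimately show ?thesis using norm_ge_zero[of z] by linarith
qed

lemma pow_nl_measurable [measurable]: "pow_nl p \<in> borel_measurable borel"
  unfolding pow_nl_def by measurable

lemma rep_half_line_L2_measurable [measurable]: "rep_half_line_L2 f \<in> borel_measurable half_line"
  using L2_fun_rep by (auto simp: L2_fun_def)

lemma rep_half_line_L2_square_integrable: "integrable half_line (\<lambda>x. (norm (rep_half_line_L2 f x))\<^sup>2)"
  using L2_fun_rep by (auto simp: L2_fun_def)

lemma pow_nl_pairing_integrable:
  assumes p: "0 < p" "p < 1" and \<eta>: "integrable half_line \<eta>" "\<And>y. norm (\<eta> y) \<le> B"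
  shows "integrable half_line (\<lambda>y. pow_nl p (rep_half_line_L2 f y) * \<eta> y)"
proof (rule Bochner_Integration.integrable_bound)
  have [measurable]: "\<eta> \<in> borel_measurable half_line" using \<eta>(1) by auto
  show "integrable half_line (\<lambda>y. norm (\<eta> y) + 2 * B * (norm (rep_half_line_L2 f y))\<^sup>2)"
    using \<eta>(1) rep_half_line_L2_square_integrable by (intro Bochner_Integration.integrable_add integrable_norm integrable_mult_right)
  show "(\<lambda>y. pow_nl p (rep_half_line_L2 f y) * \<eta> y) \<in> borel_measurable half_line" by measurable
  show "AE y in half_line. norm (pow_nl p (rep_half_line_L2 f y) * \<eta> y) \<le> norm (norm (\<eta> y) + 2 * B * (norm (rep_half_line_L2 f y))\<^sup>2)"
  proof (rule AE_I2)
    fix y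
    let ?z = "rep_half_line_L2 f y"
    have "norm (pow_nl p ?z * \<eta> y) \<le> (1 + 2 * (norm ?z)\<^sup>2) * norm (\<eta> y)"
      unfolding norm_mult by (intro mult_right_mono norm_pow_nl_le p) auto
    also have "\<dots> = norm (\<eta> y) + 2 * (norm (\<eta> y) * (norm ?z)\<^sup>2)" by (simp add: algebra_simps)
    also have "norm (\<eta> y) * (norm ?z)\<^sup>2 \<le> B * (norm ?z)\<^sup>2" using \<eta>(2) by (intro mult_right_mono) auto
    finally show "norm (pow_nl p ?z * \<eta> y) \<le> norm (norm (\<eta> y) + 2 * B * (norm ?z)\<^sup>2)" by simp
  qed
qed

text \<open>Three scales: values above \<open>R\<close> are paid for by the \<open>L\<^sup>2\<close> bounds and \<open>R\<^bsup>p-1\<^esup>\<close>, differences below \<open>\<epsilon>\<close>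
  by the mass of \<open>\<eta>\<close>, and what is left of \<open>z - \<Phi>\<close> by the smallness of \<open>z - \<Phi> - m\<close> in \<open>L\<^sup>2\<close> and of \<open>m\<close>
  in \<open>L\<^sup>q\<close>.\<close>

lemma pow_nl_pairing_diff:
  assumes p: "0 < p" "p < 1" and \<eta>: "integrable half_line \<eta>" "\<And>y. norm (\<eta> y) \<le> B"
    and R: "R > 0" and \<epsilon>: "\<epsilon> > 0" and q: "1 \<le> q"
    and m: "integrable half_line (\<lambda>y. norm (rep_half_line_L2 m y) powr q)"
  shows "norm ((LINT y|half_line. pow_nl p (rep_half_line_L2 z y) * \<eta> y) - (LINT y|half_line. pow_nl p (rep_half_line_L2 \<Phi> y) * \<eta> y))
    \<le> 4 * R powr p * (2 * \<epsilon> * (LINT y|half_line. norm (\<eta> y)) + B / \<epsilon> * (norm (z - \<Phi> - m))\<^sup>2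
         + B * \<epsilon> powr (1 - q) * (LINT y|half_line. norm (rep_half_line_L2 m y) powr q))
      + 4 * R powr (p - 1) * B * ((norm z)\<^sup>2 + (norm \<Phi>)\<^sup>2)"
proof -
  let ?z = "rep_half_line_L2 z" and ?\<Phi> = "rep_half_line_L2 \<Phi>" and ?m = "rep_half_line_L2 m"
    and ?d = "rep_half_line_L2 (z - \<Phi> - m)"
  let ?bd = "\<lambda>y. 4 * R powr p * (2 * \<epsilon> * norm (\<eta> y) + B / \<epsilon> * (norm (?d y))\<^sup>2 + B * \<epsilon> powr (1 - q) * norm (?m y) powr q)
      + 4 * R powr (p - 1) * B * ((norm (?z y))\<^sup>2 + (norm (?\<Phi> y))\<^sup>2)"
  note int = pow_nl_pairing_integrable[OF p \<eta>]
  have B: "B \<ge> 0" using \<eta>(2)[of 0] norm_ge_zero[of "\<eta> 0"] by linarith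
  have pw: "AE y in half_line. norm (pow_nl p (?z y) * \<eta> y - pow_nl p (?\<Phi> y) * \<eta> y) \<le> ?bd y"
    using AE_rep_diff[of "z - \<Phi>" m] AE_rep_diff[of z \<Phi>]
  proof eventually_elim
    case (elim y)
    then have d: "?z y - ?\<Phi> y = ?d y + ?m y" by simp
    let ?D = "norm (?z y - ?\<Phi> y)" and ?a = "norm (?z y)" and ?b = "norm (?\<Phi> y)" and ?w = "norm (\<eta> y)"
    have "norm (pow_nl p (?z y) - pow_nl p (?\<Phi> y)) \<le> 2 * (?a powr p + ?b powr p) * ?D"
      by (rule pow_nl_diff[OF p])
    also have "\<dots> \<le> 2 * ((R powr p + R powr (p - 1) * ?a) + (R powr p + R powr (p - 1) * ?b)) * ?D"
      using p R by (intro mult_right_mono mult_left_mono add_mono powr_le_split) auto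
    also have "\<dots> = 4 * R powr p * ?D + 2 * R powr (p - 1) * ((?a + ?b) * ?D)" by (simp add: algebra_simps)
    also have "(?a + ?b) * ?D \<le> (?a + ?b)\<^sup>2"
      unfolding power2_eq_square by (intro mult_left_mono norm_triangle_ineq4) auto
    also have "(?a + ?b)\<^sup>2 \<le> 2 * (?a\<^sup>2 + ?b\<^sup>2)"
      using sum_squares_bound[of ?a ?b] by (simp add: power2_sum)
    finally have 1: "norm (pow_nl p (?z y) - pow_nl p (?\<Phi> y)) \<le> 4 * R powr p * ?D + 2 * R powr (p - 1) * (2 * (?a\<^sup>2 + ?b\<^sup>2))"
      by (simp add: mult_left_mono)
    have "norm (?d y) \<le> \<epsilon> + \<epsilon> powr (1 - 2) * norm (?d y) powr 2"
      using \<epsilon> by (intro le_split_powr) auto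
    then have 2: "norm (?d y) \<le> \<epsilon> + 1 / \<epsilon> * (norm (?d y))\<^sup>2" using \<epsilon> by (simp add: powr_minus_divide)
    have 3: "norm (?m y) \<le> \<epsilon> + \<epsilon> powr (1 - q) * norm (?m y) powr q"
      using \<epsilon> q by (intro le_split_powr) auto
    have "?D \<le> 2 * \<epsilon> + 1 / \<epsilon> * (norm (?d y))\<^sup>2 + \<epsilon> powr (1 - q) * norm (?m y) powr q"
      unfolding d using 2 3 norm_triangle_ineq[of "?d y" "?m y"] by linarith
    then have "?w * ?D \<le> ?w * (2 * \<epsilon> + 1 / \<epsilon> * (norm (?d y))\<^sup>2 + \<epsilon> powr (1 - q) * norm (?m y) powr q)"
      by (rule mult_left_mono) simp
    also have "\<dots> = 2 * \<epsilon> * ?w + ?w * (1 / \<epsilon> * (norm (?d y))\<^sup>2) + ?w * (\<epsilon> powr (1 - q) * norm (?m y) powr q)"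
      by (simp add: algebra_simps)
    also have "\<dots> \<le> 2 * \<epsilon> * ?w + B * (1 / \<epsilon> * (norm (?d y))\<^sup>2) + B * (\<epsilon> powr (1 - q) * norm (?m y) powr q)"
      using \<eta>(2)[of y] \<epsilon> by (intro add_mono mult_right_mono order_refl) auto
    finally have 4: "?w * ?D \<le> 2 * \<epsilon> * ?w + B / \<epsilon> * (norm (?d y))\<^sup>2 + B * \<epsilon> powr (1 - q) * norm (?m y) powr q"
      by (simp add: mult.assoc)
    have "norm (pow_nl p (?z y) * \<eta> y - pow_nl p (?\<Phi> y) * \<eta> y) = norm (pow_nl p (?z y) - pow_nl p (?\<Phi> y)) * ?w"
      by (simp add: norm_mult[symmetric] left_diff_distrib)
    also have "\<dots> \<le> (4 * R powr p * ?D + 2 * R powr (p - 1) * (2 * (?a\<^sup>2 + ?b\<^sup>2))) * ?w"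
      by (intro mult_right_mono 1) auto
    also have "\<dots> = 4 * R powr p * (?w * ?D) + 4 * R powr (p - 1) * (?a\<^sup>2 + ?b\<^sup>2) * ?w" by (simp add: algebra_simps)
    also have "\<dots> \<le> 4 * R powr p * (2 * \<epsilon> * ?w + B / \<epsilon> * (norm (?d y))\<^sup>2 + B * \<epsilon> powr (1 - q) * norm (?m y) powr q)
        + 4 * R powr (p - 1) * (?a\<^sup>2 + ?b\<^sup>2) * B"
      using \<eta>(2)[of y] by (intro add_mono mult_left_mono 4) auto
    finally show ?case by (simp add: mult_ac)
  qed
  have "norm ((LINT y|half_line. pow_nl p (?z y) * \<eta> y) - (LINT y|half_line. pow_nl p (?\<Phi> y) * \<eta> y))
      = norm (LINT y|half_line. pow_nl p (?z y) * \<eta> y - pow_nl p (?\<Phi> y) * \<eta> y)"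
    by (simp add: int)
  also have "\<dots> \<le> (LINT y|half_line. ?bd y)"
    using \<eta>(1) m int pw
    by (intro order_trans[OF integral_norm_bound] integral_mono_AE)
       (auto intro!: Bochner_Integration.integrable_add Bochner_Integration.integrable_diff integrable_mult_right integrable_norm rep_half_line_L2_square_integrable)
  also have "\<dots> = 4 * R powr p * (2 * \<epsilon> * (LINT y|half_line. norm (\<eta> y)) + B / \<epsilon> * (norm (z - \<Phi> - m))\<^sup>2
         + B * \<epsilon> powr (1 - q) * (LINT y|half_line. norm (?m y) powr q))
      + 4 * R powr (p - 1) * B * ((norm z)\<^sup>2 + (norm \<Phi>)\<^sup>2)"
    using \<eta>(1) m by (simp add: norm_half_line_L2_eq rep_half_line_L2_square_integrable)
  finally show ?thesis .
qed

section \<open>The nonlinear pairing in profile variables\<close>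

lemma inner_profile:
  assumes "t > 0"
  shows "inner (profile \<sigma> t f) (profile \<sigma> t g) = inner f g"
  unfolding dot_norm profile_add[OF assms, symmetric] norm_profile[OF assms] ..

lemma inner_abs_half_line_L2:
  assumes "L2_fun f" "L2_fun g"
  shows "inner (abs_half_line_L2 f) (abs_half_line_L2 g) = Re (LINT x|half_line. f x * cnj (g x))"
proof -
  have "L2_eq f f" "L2_eq g g" using assms by (simp_all add: L2_eq_def)
  then show ?thesis by (simp add: inner_half_line_L2_def cinner_half_line.abs_eq)
qed

lemma pow_nl_scale:
  assumes "s > 0" "norm c = 1"
  shows "of_real s * c * pow_nl p z = of_real (s powr - p) * pow_nl p (of_real s * c * z)"
proof -
  have "s powr - p * s powr p = 1" using assms by (simp add: powr_add[symmetric])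
  then have "of_real (s powr - p) * (of_real (s powr p) :: complex) = 1"
    unfolding of_real_mult[symmetric] by simp
  then show ?thesis using assms by (simp add: pow_nl_def norm_mult powr_mult)
qed

text \<open>The factor \<open>(2t)\<^bsup>-p/2\<^esup>\<close>, which comes from the homogeneity of the nonlinearity, is the rate of decay of
  the interaction; that it is not integrable drives the whole argument. Integrability of the power
  \<open>2p + 2\<close> makes \<open>edge_nonlinearity\<close> the true power and not its default value.\<close>

lemma inner_edge_nonlinearity:
  assumes t: "t > 0" and f: "edge_in_Lp (ereal (2 * p + 2)) f"
    and \<eta>: "L2_fun \<eta>" and v: "profile \<sigma> t v = abs_half_line_L2 \<eta>"
  shows "inner (edge_nonlinearity p f) v
       = (2 * t) powr (- p / 2) * Re (LINT y|half_line. pow_nl p (rep_half_line_L2 (profile \<sigma> t f) y) * cnj (\<eta> y))"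
proof -
  define h where "h x = pow_nl p (rep_half_line_L2 f x)" for x
  have "(norm (h x))\<^sup>2 = norm (rep_half_line_L2 f x) powr (2 * p + 2)" for x
  proof (cases "rep_half_line_L2 f x = 0")
    case False
    then have "norm (h x) = norm (rep_half_line_L2 f x) powr (p + 1)"
      by (simp add: h_def norm_pow_nl powr_add)
    then show ?thesis by (simp add: power2_eq_square powr_add[symmetric])
  qed (simp add: h_def pow_nl_def)
  moreover have "h \<in> borel_measurable half_line" unfolding h_def by measurable
  ultimately have h: "L2_fun h"
    using f by (simp add: L2_fun_def edge_in_Lp_def)
  then have nl: "edge_nonlinearity p f = abs_half_line_L2 h"
    by (simp add: edge_nonlinearity_def h_def[abs_def] pow_nl_def Let_def)
  define s where "s = sqrt (2 * t)"
  have s: "s > 0" using t by (simp add: s_def)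
  have sp: "s powr - p = (2 * t) powr (- p / 2)"
    using t by (simp add: s_def powr_half_sqrt[symmetric] powr_powr)
  have pf: "profile_fun \<sigma> t h y = of_real (s powr - p) * pow_nl p (profile_fun \<sigma> t (rep_half_line_L2 f) y)" for y
    using pow_nl_scale[OF s, of "cis (- (\<sigma> * t * y\<^sup>2))" p "rep_half_line_L2 f (2 * t * y)"]
    by (simp add: profile_fun_def h_def s_def)
  have ae: "AE y in half_line. profile_fun \<sigma> t h y * cnj (\<eta> y)
      = of_real ((2 * t) powr (- p / 2)) * (pow_nl p (rep_half_line_L2 (profile \<sigma> t f) y) * cnj (\<eta> y))"
    using AE_rep_profile[OF t, of \<sigma> f] by eventually_elim (simp add: pf sp)
  have [measurable]: "\<eta> \<in> borel_measurable half_line" "profile_fun \<sigma> t h \<in> borel_measurable half_line"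
    using \<eta> L2_fun_profile[OF t h] by (auto simp: L2_fun_def)
  have "inner (edge_nonlinearity p f) v = inner (profile \<sigma> t (abs_half_line_L2 h)) (profile \<sigma> t v)"
    by (simp add: inner_profile[OF t] nl)
  also have "\<dots> = Re (LINT y|half_line. profile_fun \<sigma> t h y * cnj (\<eta> y))"
    unfolding v profile_abs[OF t h] by (rule inner_abs_half_line_L2[OF L2_fun_profile[OF t h] \<eta>])
  also have "(LINT y|half_line. profile_fun \<sigma> t h y * cnj (\<eta> y))
      = (LINT y|half_line. of_real ((2 * t) powr (- p / 2)) * (pow_nl p (rep_half_line_L2 (profile \<sigma> t f) y) * cnj (\<eta> y)))"
    by (rule integral_cong_AE[OF _ _ ae]) measurable
  finally show ?thesis by simp
qed

text \<open>For \<open>q < 2\<close> the exponent is negative, so a remainder that is bounded in \<open>L\<^sup>q\<close> fades out in profile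
  variables.\<close>

lemma profile_powr_integral:
  assumes t: "t > 0" and q: "1 \<le> q" and f: "integrable half_line (\<lambda>x. norm (rep_half_line_L2 f x) powr q)"
  shows "integrable half_line (\<lambda>y. norm (rep_half_line_L2 (profile \<sigma> t f) y) powr q)"
    and "(LINT y|half_line. norm (rep_half_line_L2 (profile \<sigma> t f) y) powr q)
       = (2 * t) powr (q / 2 - 1) * (LINT x|half_line. norm (rep_half_line_L2 f x) powr q)"
proof -
  let ?g = "\<lambda>x. norm (rep_half_line_L2 f x) powr q"
  have ae: "AE y in half_line. norm (rep_half_line_L2 (profile \<sigma> t f) y) powr q = (2 * t) powr (q / 2) * ?g (2 * t * y)"
    using AE_rep_profile[OF t, of \<sigma> f]
    by eventually_elim (use t in \<open>simp add: norm_profile_fun powr_mult powr_half_sqrt[symmetric] powr_powr\<close>)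
  have [measurable]: "(\<lambda>y. ?g (2 * t * y)) \<in> borel_measurable half_line"
    using t by (intro half_line_measurable_scale[where f = ?g]) auto
  have int: "integrable half_line (\<lambda>y. (2 * t) powr (q / 2) * ?g (2 * t * y))"
    using f half_line_integrable_scale[of "2 * t" ?g] t by (intro integrable_mult_right) simp
  have *: "(2 * t) powr (q / 2) = (2 * t) powr (q / 2 - 1) * (2 * t)"
    using t by (simp add: powr_diff)
  show "integrable half_line (\<lambda>y. norm (rep_half_line_L2 (profile \<sigma> t f) y) powr q)"
    by (rule iffD2[OF integrable_cong_AE[OF _ _ ae] int]) measurable
  have "(LINT y|half_line. norm (rep_half_line_L2 (profile \<sigma> t f) y) powr q) = (LINT y|half_line. (2 * t) powr (q / 2) * ?g (2 * t * y))"
    by (rule integral_cong_AE[OF _ _ ae]) measurable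
  also have "\<dots> = (2 * t) powr (q / 2) * (LINT y|half_line. ?g (2 * t * y))" by simp
  also have "\<dots> = (2 * t) powr (q / 2 - 1) * (2 * t * (LINT y|half_line. ?g (2 * t * y)))" unfolding * by simp
  also have "2 * t * (LINT y|half_line. ?g (2 * t * y)) = (LINT x|half_line. ?g x)"
    using half_line_integral_scale[of "2 * t" ?g] t by simp
  finally show "(LINT y|half_line. norm (rep_half_line_L2 (profile \<sigma> t f) y) powr q)
       = (2 * t) powr (q / 2 - 1) * (LINT x|half_line. norm (rep_half_line_L2 f x) powr q)" .
qed

lemma integrable_norm_gauss_fun_two:
  assumes "b > 0"
  shows "integrable half_line (gauss_fun 2 (of_real b))" and "norm (gauss_fun 2 (of_real b) y) \<le> 1 / b"
proof -
  have n: "norm (gauss_fun 2 (of_real b) y) = y\<^sup>2 * exp (- (b * y\<^sup>2))" for y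
    by (simp add: norm_gauss_fun)
  show "integrable half_line (gauss_fun 2 (of_real b))"
    by (rule Bochner_Integration.integrable_bound[OF integrable_gaussian_even[OF assms, of 1]])
       (auto simp: n intro!: AE_I2)
  have "b * y\<^sup>2 \<le> exp (b * y\<^sup>2)" using exp_ge_add_one_self[of "b * y\<^sup>2"] by linarith
  then have "b * y\<^sup>2 * exp (- (b * y\<^sup>2)) \<le> exp (b * y\<^sup>2) * exp (- (b * y\<^sup>2))" by (rule mult_right_mono) simp
  then show "norm (gauss_fun 2 (of_real b) y) \<le> 1 / b"
    using assms by (simp add: n mult_exp_exp field_simps)
qed

text \<open>First \<open>R\<close>, then \<open>\<epsilon>\<close>, then \<open>t\<close> is chosen in the estimate above.\<close>

lemma pow_nl_pairing_tendsto:
  fixes z m :: "real \<Rightarrow> half_line_L2"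
  assumes p: "0 < p" "p < 1" and \<eta>: "integrable half_line \<eta>" "\<And>y. norm (\<eta> y) \<le> B"
    and q: "1 \<le> q"
    and m: "\<forall>\<^sub>F t in F. integrable half_line (\<lambda>y. norm (rep_half_line_L2 (m t) y) powr q)"
    and m0: "((\<lambda>t. LINT y|half_line. norm (rep_half_line_L2 (m t) y) powr q) \<longlongrightarrow> 0) F"
    and z: "\<forall>\<^sub>F t in F. norm (z t) \<le> A"
    and lim: "((\<lambda>t. norm (z t - \<Phi> - m t)) \<longlongrightarrow> 0) F"
  shows "((\<lambda>t. LINT y|half_line. pow_nl p (rep_half_line_L2 (z t) y) * \<eta> y)
    \<longlongrightarrow> (LINT y|half_line. pow_nl p (rep_half_line_L2 \<Phi> y) * \<eta> y)) F"
proof (rule tendstoI)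
  fix e :: real assume e: "e > 0"
  define W where "W = (LINT y|half_line. norm (\<eta> y))"
  have W: "W \<ge> 0" by (simp add: W_def)
  have B: "B \<ge> 0" using \<eta>(2)[of 0] norm_ge_zero[of "\<eta> 0"] by linarith
  have "((\<lambda>R. 4 * R powr (p - 1) * B * (A\<^sup>2 + (norm \<Phi>)\<^sup>2)) \<longlongrightarrow> 4 * 0 * B * (A\<^sup>2 + (norm \<Phi>)\<^sup>2)) at_top"
    using p by (intro tendsto_intros tendsto_neg_powr filterlim_ident) auto
  then have "\<forall>\<^sub>F R in at_top. 4 * R powr (p - 1) * B * (A\<^sup>2 + (norm \<Phi>)\<^sup>2) < e / 2"
    using e by (intro order_tendstoD(2)) auto
  with eventually_gt_at_top[of 0]
  have "\<forall>\<^sub>F R in at_top. R > 0 \<and> 4 * R powr (p - 1) * B * (A\<^sup>2 + (norm \<Phi>)\<^sup>2) < e / 2"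
    by eventually_elim simp
  then obtain R where R: "R > 0" "4 * R powr (p - 1) * B * (A\<^sup>2 + (norm \<Phi>)\<^sup>2) < e / 2"
    by (auto simp: eventually_at_top_linorder)
  define X where "X = 8 * R powr p * W"
  define \<epsilon> where "\<epsilon> = e / 2 / (X + 1)"
  have X: "X \<ge> 0" using W by (simp add: X_def)
  then have \<epsilon>: "\<epsilon> > 0" using e by (simp add: \<epsilon>_def)
  have "X * \<epsilon> = e / 2 * (X / (X + 1))" by (simp add: \<epsilon>_def)
  also have "\<dots> < e / 2 * 1"
    using e X by (intro mult_strict_left_mono) (auto simp: divide_less_eq)
  finally have small: "4 * R powr p * (2 * \<epsilon> * W + B / \<epsilon> * 0\<^sup>2 + B * \<epsilon> powr (1 - q) * 0) < e / 2"
    by (simp add: X_def mult_ac)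
  have "\<forall>\<^sub>F t in F. 4 * R powr p * (2 * \<epsilon> * W + B / \<epsilon> * (norm (z t - \<Phi> - m t))\<^sup>2
        + B * \<epsilon> powr (1 - q) * (LINT y|half_line. norm (rep_half_line_L2 (m t) y) powr q)) < e / 2"
    using small by (intro order_tendstoD(2)[rotated]) (assumption, intro tendsto_intros lim m0)
  with m z show "\<forall>\<^sub>F t in F. dist (LINT y|half_line. pow_nl p (rep_half_line_L2 (z t) y) * \<eta> y)
      (LINT y|half_line. pow_nl p (rep_half_line_L2 \<Phi> y) * \<eta> y) < e"
  proof eventually_elim
    case (elim t)
    have "(norm (z t))\<^sup>2 \<le> A\<^sup>2" using elim(2) by (intro power_mono) auto
    then have "4 * R powr (p - 1) * B * ((norm (z t))\<^sup>2 + (norm \<Phi>)\<^sup>2) \<le> 4 * R powr (p - 1) * B * (A\<^sup>2 + (norm \<Phi>)\<^sup>2)"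
      using B by (intro mult_left_mono) auto
    then show ?case
      using pow_nl_pairing_diff[OF p \<eta> R(1) \<epsilon> q elim(1), of "z t" \<Phi>] elim(3) R(2)
      unfolding W_def dist_norm by linarith
  qed
qed

text \<open>The test profiles \<open>y\<^sup>2 exp (- k y\<^sup>2)\<close>, \<open>k \<ge> 1\<close>, suffice because \<open>y\<^sup>2 exp (- y\<^sup>2)\<close> makes \<open>\<bar>f\<bar>\<^sup>pf\<close>
  integrable and the remaining Gaussians \<open>exp (- k y\<^sup>2)\<close>, \<open>k \<ge> 0\<close>, determine an integrable function.\<close>

lemma pow_nl_pairing_zero_imp_zero:
  assumes p: "0 < p" "p < 1"
    and zero: "\<And>w (k::nat). k \<ge> 1 \<Longrightarrow> Re (LINT y|half_line. pow_nl p (rep_half_line_L2 f y) * cnj (w * gauss_fun 2 (of_real (real k)) y)) = 0"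
  shows "f = 0"
proof -
  have real_gauss: "cnj (gauss_fun 2 (of_real b) y) = gauss_fun 2 (of_real b) y" for b y
    by (simp add: gauss_fun_def exp_cnj)
  have "AE y in half_line. pow_nl p (rep_half_line_L2 f y) * gauss_fun 2 1 y = 0"
  proof (rule complex_gaussian_moments_zero_imp_AE_zero)
    show "integrable half_line (\<lambda>y. pow_nl p (rep_half_line_L2 f y) * gauss_fun 2 1 y)"
      using pow_nl_pairing_integrable[OF p integrable_norm_gauss_fun_two[of 1]] by simp
    fix k :: nat
    let ?I = "LINT y|half_line. pow_nl p (rep_half_line_L2 f y) * gauss_fun 2 (of_real (real (Suc k))) y"
    have "Re (cnj w * ?I) = 0" for w
    proof -
      have "cnj w * ?I = (LINT y|half_line. pow_nl p (rep_half_line_L2 f y) * cnj (w * gauss_fun 2 (of_real (real (Suc k))) y))"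
        unfolding complex_cnj_mult real_gauss
        by (subst integral_mult_right_zero[symmetric]) (simp add: mult_ac)
      then show ?thesis using zero[of "Suc k" w] by simp
    qed
    from this[of 1] this[of \<i>] have I: "?I = 0" by (simp add: complex_eq_iff)
    have "gauss_fun 2 1 y * complex_of_real (exp (- (real k * y\<^sup>2))) = gauss_fun 2 (of_real (real (Suc k))) y" for y
      by (simp add: gauss_fun_def exp_of_real[symmetric] mult_exp_exp algebra_simps)
    then show "(LINT y|half_line. pow_nl p (rep_half_line_L2 f y) * gauss_fun 2 1 y * complex_of_real (exp (- (real k * y\<^sup>2)))) = 0"
      using I by (simp only: mult.assoc)
  qed
  with AE_half_line_pos rep_abs_half_line_L2[OF L2_fun_zero]
  have "AE y in half_line. rep_half_line_L2 f y = rep_half_line_L2 0 y"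
    unfolding zero_half_line_L2_def[symmetric]
    by eventually_elim (auto simp: gauss_fun_def pow_nl_def)
  then show "f = 0" by (rule half_line_L2_eqI)
qed

section \<open>Vanishing of the scattering state\<close>

lemma continuous_bounded_AE_imp_bounded:
  fixes f :: "real \<Rightarrow> 'a::real_normed_vector"
  assumes f: "continuous_on {T<..} f" and ae: "AE t in lborel. T < t \<longrightarrow> norm (f t) \<le> A"
    and t: "T < t"
  shows "norm (f t) \<le> A"
proof (rule ccontr)
  assume "\<not> norm (f t) \<le> A"
  define V where "V = {T<..} \<inter> (\<lambda>t. norm (f t)) -` {A<..}"
  have "open V" unfolding V_def
    by (intro continuous_open_preimage continuous_on_norm f) auto
  moreover have "t \<in> V" using t \<open>\<not> norm (f t) \<le> A\<close> by (simp add: V_def)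
  moreover have "negligible V"
  proof -
    have "AE t in lborel. t \<notin> V" using ae by eventually_elim (auto simp: V_def)
    then have "V \<in> null_sets lborel"
      using \<open>open V\<close> by (subst (asm) AE_iff_null_sets[symmetric]) auto
    then show ?thesis by (simp add: negligible_iff_null_sets null_sets_completionI)
  qed
  ultimately show False using open_not_negligible by blast
qed

lemma sgn_mult_le_abs: "sgn x * y \<le> \<bar>y::real\<bar>"
  by (auto simp: sgn_if)

lemma adjoint_scaleC_star: "scaleC_star (cnj \<kappa>) (scaleC_star \<kappa> f) = (norm \<kappa>)\<^sup>2 *\<^sub>R f"
  using complex_norm_square[of \<kappa>]
  by (simp add: scaleC_star_scaleC scaleC_star_of_real[symmetric] mult.commute)

text \<open>The factor \<open>cnj \<kappa>\<close> removes the phase of the coupling, so that the pulled back solution is an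
  indefinite integral of the pulled back nonlinearity itself.\<close>

lemma (in star_group) duhamel_pulled_back:
  assumes int: "\<And>t. t \<ge> 0 \<Longrightarrow> set_integrable lborel {0<..t} (\<lambda>s. U (t - s) (N s))"
    and u: "\<And>t. t \<ge> 0 \<Longrightarrow> u t = U t u0 + scaleC_star \<kappa> (LBINT s:{0<..t}. U (t - s) (N s))"
    and \<kappa>: "norm \<kappa> = 1"
  shows "t \<ge> 0 \<Longrightarrow> set_integrable lborel {0<..t} (\<lambda>r. U (- r) (N r))"
    and "0 \<le> s \<Longrightarrow> s \<le> t \<Longrightarrow> scaleC_star (cnj \<kappa>) (U (- t) (u t)) - scaleC_star (cnj \<kappa>) (U (- s) (u s))
      = (LBINT r:{s<..t}. U (- r) (N r))"
proof -
  have shift: "U (- t) (indicat_real {0<..t} s *\<^sub>R U (t - s) (N s)) = indicat_real {0<..t} s *\<^sub>R U (- s) (N s)" for t s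
    using U_plus[of "- t" "t - s" "N s"] by (simp add: U_scaleR)
  show int': "set_integrable lborel {0<..t} (\<lambda>r. U (- r) (N r))" if "t \<ge> 0" for t
    using integrable_bounded_linear[OF bounded_linear_U[of "- t"] int[OF that, unfolded set_integrable_def]]
    unfolding set_integrable_def by (simp only: shift)
  have eq: "scaleC_star (cnj \<kappa>) (U (- t) (u t)) = scaleC_star (cnj \<kappa>) u0 + (LBINT r:{0<..t}. U (- r) (N r))"
    if t: "t \<ge> 0" for t
  proof -
    have "U (- t) (LBINT s:{0<..t}. U (t - s) (N s)) = (LBINT r:{0<..t}. U (- r) (N r))"
      using integral_bounded_linear[OF bounded_linear_U[of "- t"] int[OF t, unfolded set_integrable_def]]
      unfolding set_lebesgue_integral_def by (simp only: shift)
    then have "U (- t) (u t) = u0 + scaleC_star \<kappa> (LBINT r:{0<..t}. U (- r) (N r))"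
      by (simp only: u[OF t] U_add U_scaleC U_cancel)
    then show ?thesis
      by (simp add: linear_add[OF bounded_linear.linear[OF bounded_linear_scaleC_star]] adjoint_scaleC_star \<kappa>)
  qed
  show "scaleC_star (cnj \<kappa>) (U (- t) (u t)) - scaleC_star (cnj \<kappa>) (U (- s) (u s)) = (LBINT r:{s<..t}. U (- r) (N r))"
    if st: "0 \<le> s" "s \<le> t" for s t
  proof -
    have t0: "t \<ge> 0" using st by simp
    have "{0<..t} = {0<..s} \<union> {s<..t}" using st by auto
    moreover have "(LBINT r:{0<..s} \<union> {s<..t}. U (- r) (N r))
        = (LBINT r:{0<..s}. U (- r) (N r)) + (LBINT r:{s<..t}. U (- r) (N r))"
      using st by (intro set_integral_Un set_integrable_subset[OF int'[OF t0]]) auto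
    ultimately show ?thesis using st by (simp add: eq)
  qed
qed

text \<open>What is left of \<open>Re \<langle>\<bar>u\<bar>\<^sup>pu, v\<rangle>\<close> for a test wave \<open>v\<close> once the decaying factor is taken out; \<open>f\<close> stands
  for the profile of \<open>u\<close>.\<close>

definition pairing :: "real \<Rightarrow> complex^'n \<Rightarrow> real \<Rightarrow> 'n::finite star_L2 \<Rightarrow> real" where
  "pairing p c b f = (\<Sum>i\<in>UNIV. Re (LINT y|half_line. pow_nl p (rep_half_line_L2 (f $ i) y) * cnj (c $ i * gauss_fun 2 (of_real b) y)))"

lemma inner_nonlinearity:
  assumes t: "t > 0" and b: "b > 0" and f: "star_in_Lp (ereal (2 * p + 2)) f"
    and v: "star_profile \<sigma> t v = tensor c (gauss 2 (of_real b))"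
  shows "inner (nonlinearity p f) v = (2 * t) powr (- p / 2) * pairing p c b (star_profile \<sigma> t f)"
proof -
  have L: "L2_fun (gauss_fun 2 (of_real b))" using b by (intro L2_fun_gauss) simp
  have vi: "profile \<sigma> t (v $ i) = abs_half_line_L2 (\<lambda>y. c $ i * gauss_fun 2 (of_real b) y)" for i
    using arg_cong[OF v, of "\<lambda>f. f $ i"]
    by (simp add: star_profile_def tensor_def gauss_def scaleC_abs_half_line_L2[OF L])
  show ?thesis
    using f
    by (simp add: inner_vec_def nonlinearity_def pairing_def sum_distrib_left star_in_Lp_def star_profile_def
        inner_edge_nonlinearity[OF t _ L2_fun_scale[OF L] vi] del: complex_cnj_mult)
qed

lemma pairing_zero_imp_zero:
  fixes f :: "'n::finite star_L2"
  assumes p: "0 < p" "p < 1" and zero: "\<And>c (k::nat). k \<ge> 1 \<Longrightarrow> pairing p c (real k) f = 0"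
  shows "f = 0"
proof -
  have "f $ i = 0" for i
  proof (rule pow_nl_pairing_zero_imp_zero[OF p])
    fix w :: complex and k :: nat assume "k \<ge> 1"
    then have "pairing p (axis i w) (real k) f = 0" by (rule zero)
    moreover have "pairing p (axis i w) (real k) f
        = (\<Sum>j\<in>UNIV. if j = i then Re (LINT y|half_line. pow_nl p (rep_half_line_L2 (f $ i) y) * cnj (w * gauss_fun 2 (of_real (real k)) y)) else 0)"
      unfolding pairing_def by (intro sum.cong) (auto simp: axis_def)
    ultimately show "Re (LINT y|half_line. pow_nl p (rep_half_line_L2 (f $ i) y) * cnj (w * gauss_fun 2 (of_real (real k)) y)) = 0"
      by simp
  qed
  then show ?thesis by (simp add: vec_eq_iff)
qed

text \<open>Here \<open>w\<close> is the linear wave with the profile \<open>\<Phi>\<close> and \<open>l\<close> the remainder that fades out. The filter \<open>F\<close>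
  leaves room for neglecting null sets of times.\<close>

lemma pairing_tendsto:
  fixes u l w :: "real \<Rightarrow> 'n::finite star_L2"
  assumes p: "0 < p" "p < 1" and b: "b > 0" and q: "1 \<le> q" "q < 2"
    and F: "F \<le> at_top"
    and l: "\<forall>\<^sub>F t in F. \<forall>j. integrable half_line (\<lambda>x. norm (rep_half_line_L2 (l t $ j) x) powr q)
        \<and> (LINT x|half_line. norm (rep_half_line_L2 (l t $ j) x) powr q) \<le> C"
    and u: "\<forall>\<^sub>F t in F. norm (u t) \<le> A"
    and w: "((\<lambda>t. star_profile \<sigma> t (w t)) \<longlongrightarrow> \<Phi>) F"
    and lim: "((\<lambda>t. norm (u t - (w t + l t))) \<longlongrightarrow> 0) F"
  shows "((\<lambda>t. pairing p c b (star_profile \<sigma> t (u t))) \<longlongrightarrow> pairing p c b \<Phi>) F"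
  unfolding pairing_def
proof (intro tendsto_sum tendsto_Re pow_nl_pairing_tendsto[OF p])
  fix i
  have pos: "\<forall>\<^sub>F t in F. 0 < t" using filter_leD[OF F eventually_gt_at_top] .
  have I: "integrable half_line (\<lambda>y. c $ i * gauss_fun 2 (of_real b) y)"
    using integrable_norm_gauss_fun_two(1)[OF b] by simp
  show "integrable half_line (\<lambda>y. cnj (c $ i * gauss_fun 2 (of_real b) y))"
    using I by (rule integrable_cnj)
  show "norm (cnj (c $ i * gauss_fun 2 (of_real b) y)) \<le> norm (c $ i) * (1 / b)" for y
    unfolding complex_mod_cnj norm_mult by (intro mult_left_mono integrable_norm_gauss_fun_two(2)[OF b]) auto
  show "1 \<le> q" by (rule q)
  show "\<forall>\<^sub>F t in F. integrable half_line (\<lambda>y. norm (rep_half_line_L2 (star_profile \<sigma> t (l t) $ i) y) powr q)"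
    using l pos by eventually_elim (simp add: star_profile_def profile_powr_integral(1)[OF _ q(1)])
  show "((\<lambda>t. LINT y|half_line. norm (rep_half_line_L2 (star_profile \<sigma> t (l t) $ i) y) powr q) \<longlongrightarrow> 0) F"
  proof (rule tendsto_sandwich[where f = "\<lambda>t. 0"])
    show "\<forall>\<^sub>F t in F. 0 \<le> (LINT y|half_line. norm (rep_half_line_L2 (star_profile \<sigma> t (l t) $ i) y) powr q)"
      by (intro always_eventually allI integral_nonneg_AE AE_I2) simp
    show "\<forall>\<^sub>F t in F. (LINT y|half_line. norm (rep_half_line_L2 (star_profile \<sigma> t (l t) $ i) y) powr q) \<le> (2 * t) powr (q / 2 - 1) * C"
      using l pos
    proof eventually_elim
      case (elim t)
      then show ?case
        by (auto simp: star_profile_def profile_powr_integral(2)[OF _ q(1)] intro!: mult_left_mono)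
    qed
    have "filterlim (\<lambda>t. 2 * t) at_top (at_top :: real filter)"
      by (rule filterlim_tendsto_pos_mult_at_top[OF tendsto_const _ filterlim_ident]) simp
    then have "((\<lambda>t. (2 * t) powr (q / 2 - 1)) \<longlongrightarrow> 0) at_top"
      using q by (intro tendsto_neg_powr) auto
    from tendsto_mult_left_zero[OF tendsto_mono[OF F this]]
    show "((\<lambda>t. (2 * t) powr (q / 2 - 1) * C) \<longlongrightarrow> 0) F" .
  qed simp
  show "\<forall>\<^sub>F t in F. norm (star_profile \<sigma> t (u t) $ i) \<le> A"
    using u pos
  proof eventually_elim
    case (elim t)
    then show ?case using Finite_Cartesian_Product.norm_nth_le[of "star_profile \<sigma> t (u t)" i] by (simp add: norm_star_profile)
  qed
  show "((\<lambda>t. norm (star_profile \<sigma> t (u t) $ i - \<Phi> $ i - star_profile \<sigma> t (l t) $ i)) \<longlongrightarrow> 0) F"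
  proof (rule tendsto_sandwich[where f = "\<lambda>t. 0"])
    show "\<forall>\<^sub>F t in F. norm (star_profile \<sigma> t (u t) $ i - \<Phi> $ i - star_profile \<sigma> t (l t) $ i)
        \<le> norm (u t - (w t + l t)) + norm (star_profile \<sigma> t (w t) - \<Phi>)"
      using pos
    proof eventually_elim
      case (elim t)
      have "norm (star_profile \<sigma> t (u t) $ i - \<Phi> $ i - star_profile \<sigma> t (l t) $ i)
          \<le> norm (star_profile \<sigma> t (u t) - \<Phi> - star_profile \<sigma> t (l t))"
        using Finite_Cartesian_Product.norm_nth_le[of "star_profile \<sigma> t (u t) - \<Phi> - star_profile \<sigma> t (l t)" i] by simp
      also have "star_profile \<sigma> t (u t) - \<Phi> - star_profile \<sigma> t (l t)
          = star_profile \<sigma> t (u t - (w t + l t)) + (star_profile \<sigma> t (w t) - \<Phi>)"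
        using elim by (simp add: star_profile_diff star_profile_add)
      also have "norm \<dots> \<le> norm (u t - (w t + l t)) + norm (star_profile \<sigma> t (w t) - \<Phi>)"
        using norm_triangle_ineq[of "star_profile \<sigma> t (u t - (w t + l t))" "star_profile \<sigma> t (w t) - \<Phi>"] elim
        by (simp only: norm_star_profile)
      finally show ?case .
    qed
    show "((\<lambda>t. norm (u t - (w t + l t)) + norm (star_profile \<sigma> t (w t) - \<Phi>)) \<longlongrightarrow> 0) F"
      using tendsto_add[OF lim tendsto_norm[OF tendsto_diff[OF w tendsto_const[of \<Phi>]]]] by simp
  qed auto
qed

text \<open>Suppose that a pairing of the limit profile \<open>\<Phi>\<close> is not zero. The product rule for the solution and the
  test wave bounds the integral of \<open>\<langle>\<bar>u\<bar>\<^sup>pu, v\<rangle>\<close> over \<open>(S,T)\<close> uniformly in \<open>T\<close>, but the integrand is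
  eventually at least a multiple of \<open>t\<^bsup>-p/2\<^esup> \<ge> T\<^bsup>-1/2\<^esup>\<close> up to sign, so the integral grows like \<open>T\<^bsup>1/2\<^esup>\<close>.\<close>

lemma scattering_state_zero:
  fixes u l :: "real \<Rightarrow> 'n::finite star_L2"
  assumes M: "star_group \<sigma> (star_laplacian bc) U" and bc: "bc 0 0"
    and K: "star_group \<sigma> (star_laplacian kirchhoff_bc) UK"
    and p: "0 < p" "p < 1" and q: "1 \<le> q" "q < 2" and \<kappa>: "norm \<kappa> = 1"
    and u_cont: "continuous_on {0<..} u"
    and int: "\<And>t. t \<ge> 0 \<Longrightarrow> set_integrable lborel {0<..t} (\<lambda>s. U (t - s) (nonlinearity p (u s)))"
    and duhamel: "\<And>t. t \<ge> 0 \<Longrightarrow> u t = U t u0 + scaleC_star \<kappa> (LBINT s:{0<..t}. U (t - s) (nonlinearity p (u s)))"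
    and u_Lp: "AE t in lborel. 0 < t \<longrightarrow> star_in_Lp (ereal (2 * p + 2)) (u t)"
    and l_L2: "AE t in lborel. 0 < t \<longrightarrow> norm (l t) \<le> C2"
    and l_Lq: "AE t in lborel. 0 < t \<longrightarrow> (\<forall>j. integrable half_line (\<lambda>x. norm (rep_half_line_L2 (l t $ j) x) powr q)
        \<and> (LINT x|half_line. norm (rep_half_line_L2 (l t $ j) x) powr q) \<le> Cq)"
    and lim: "((\<lambda>t. norm (u t - (UK t up + l t))) \<longlongrightarrow> 0) at_top"
  shows "up = 0"
proof -
  interpret M: star_group \<sigma> "star_laplacian bc" U by (rule M)
  interpret K: star_group \<sigma> "star_laplacian kirchhoff_bc" UK by (rule K)
  obtain \<Phi> where \<Phi>: "((\<lambda>t. star_profile \<sigma> t (UK t up)) \<longlongrightarrow> \<Phi>) at_top" "norm \<Phi> = norm up"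
    using K.kirchhoff_has_profile[OF refl, of up] by blast
  \<comment> \<open>Large times up to a null set: the bounds on \<open>l\<close> and on the nonlinearity hold only almost everywhere.\<close>
  define F where "F = inf (at_top :: real filter) (ae_filter lborel)"
  have F: "F \<le> at_top" "F \<le> ae_filter lborel" by (simp_all add: F_def)
  have pos: "\<forall>\<^sub>F t in F. 0 < t" using filter_leD[OF F(1) eventually_gt_at_top] .
  have F_AE: "\<forall>\<^sub>F t in F. P t" if "AE t in lborel. 0 < t \<longrightarrow> P t" for P
    using filter_leD[OF F(2) that] pos by eventually_elim simp
  have F_E: "\<exists>S\<ge>1. AE t in lborel. S < t \<longrightarrow> P t" if ev: "\<forall>\<^sub>F t in F. P t" for P
  proof -
    obtain Q R where "\<forall>\<^sub>F t in at_top. Q t" "AE t in lborel. R t" "\<forall>t. Q t \<and> R t \<longrightarrow> P t"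
      using ev unfolding F_def eventually_inf by auto
    moreover from this(1) obtain S where S: "\<And>t. t \<ge> S \<Longrightarrow> Q t" by (auto simp: eventually_at_top_linorder)
    ultimately have "AE t in lborel. max S 1 < t \<longrightarrow> P t" by (auto elim!: eventually_mono)
    then show ?thesis by (intro exI[of _ "max S 1"]) simp
  qed
  define A where "A = 1 + norm up + C2"
  have "\<forall>\<^sub>F t in at_top. norm (u t - (UK t up + l t)) < 1"
    using order_tendstoD(2)[OF lim, of 1] by simp
  from filter_leD[OF F(1) this] F_AE[OF l_L2] have bd: "\<forall>\<^sub>F t in F. norm (u t) \<le> A"
  proof eventually_elim
    case (elim t)
    have "norm (u t) \<le> norm (u t - (UK t up + l t)) + norm (UK t up + l t)"
      using norm_triangle_ineq[of "u t - (UK t up + l t)" "UK t up + l t"] by simp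
    also have "norm (UK t up + l t) \<le> norm up + norm (l t)"
      using norm_triangle_ineq[of "UK t up" "l t"] by (simp add: K.norm_U)
    finally show ?case using elim by (simp add: A_def)
  qed
  from F_E[OF bd] obtain S0 where S0: "S0 \<ge> 1" "AE t in lborel. S0 < t \<longrightarrow> norm (u t) \<le> A" by blast
  have uA: "norm (u t) \<le> A" if "t > S0" for t
    using continuous_bounded_AE_imp_bounded[OF continuous_on_subset[OF u_cont] S0(2) that] S0(1) by auto
  have "A \<ge> 0" using order_trans[OF norm_ge_zero uA[of "S0 + 1"]] by simp
  have "pairing p c (real k) \<Phi> = 0" if k: "k \<ge> 1" for c and k :: nat
  proof (rule ccontr)
    let ?b = "real k" and ?J = "pairing p c (real k) \<Phi>"
    assume J0: "?J \<noteq> 0"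
    have b: "?b > 0" using k by simp
    have "((\<lambda>t. sgn ?J * pairing p c ?b (star_profile \<sigma> t (u t))) \<longlongrightarrow> sgn ?J * ?J) F"
      by (intro tendsto_mult_left pairing_tendsto[where w = "\<lambda>t. UK t up", OF p b q F(1) F_AE[OF l_Lq] bd
            tendsto_mono[OF F(1) \<Phi>(1)] tendsto_mono[OF F(1) lim]])
    moreover have "sgn ?J * ?J = \<bar>?J\<bar>" by (simp add: mult.commute abs_sgn)
    ultimately have "\<forall>\<^sub>F t in F. \<bar>?J\<bar> / 2 < sgn ?J * pairing p c ?b (star_profile \<sigma> t (u t))"
      using J0 by (intro order_tendstoD(1)) auto
    from F_E[OF this] obtain S1 where S1: "S1 \<ge> 1"
      "AE t in lborel. S1 < t \<longrightarrow> \<bar>?J\<bar> / 2 < sgn ?J * pairing p c ?b (star_profile \<sigma> t (u t))" by blast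
    define S where "S = S0 + S1"
    have S: "S > S0" "S > S1" "S \<ge> 1" using S0 S1 by (auto simp: S_def)
    obtain v Kc where Kc: "Kc \<ge> 0" and v: "\<And>t. t > 0 \<Longrightarrow> star_profile \<sigma> t (v t) = tensor c (gauss 2 (of_real ?b))"
      and vb: "\<And>s t. 0 < s \<Longrightarrow> s \<le> t \<Longrightarrow> norm (U (- t) (v t) - U (- s) (v s)) \<le> Kc / s - Kc / t"
      by (rule M.test_wave[OF refl bc b, where c = c], rule that)
    define V where "V = norm (tensor c (gauss 2 (of_real ?b)))"
    have nv: "norm (v t) = V" if "t > 0" for t
      using norm_star_profile[OF that, of \<sigma> "v t"] v[OF that] by (simp add: V_def)
    define a where "a t = scaleC_star (cnj \<kappa>) (U (- t) (u t))" for t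
    define a' where "a' r = U (- r) (nonlinearity p (u r))" for r
    define b' where "b' t = U (- t) (v t)" for t
    note pulled = M.duhamel_pulled_back[OF int duhamel \<kappa>]
    have na: "norm (a t) \<le> A" if "t > S0" for t
      using uA[OF that] \<kappa> by (simp add: a_def norm_scaleC_star M.norm_U)
    have nb: "norm (b' t) = V" if "t > 0" for t using nv[OF that] by (simp add: b'_def M.norm_U)
    have V: "V \<ge> 0" by (simp add: V_def)
    have bound: "\<bar>LBINT r:{S<..T}. inner (a' r) (b' r)\<bar> \<le> 2 * (A * V) + A * Kc"
      and intab: "set_integrable lborel {S<..T} (\<lambda>r. inner (a' r) (b' r))" if T: "T \<ge> S" for T
    proof -
      have sa: "set_integrable lborel {S<..T} a'"
        unfolding a'_def using S T by (intro set_integrable_subset[OF pulled(1)[of T]]) auto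
      have da: "a t - a s = (LBINT r:{s<..t}. a' r)" if "S \<le> s" "s \<le> t" "t \<le> T" for s t
        unfolding a_def a'_def using that S by (intro pulled(2)) auto
      have db: "norm (b' t - b' s) \<le> - Kc / t - - Kc / s" if "S \<le> s" "s \<le> t" "t \<le> T" for s t
        using vb[of s t] that S by (simp add: b'_def)
      have c\<phi>: "continuous_on {S..T} (\<lambda>t. - Kc / t)" using S by (intro continuous_intros) auto
      have ba: "norm (a s) \<le> A" if "S \<le> s" "s \<le> T" for s using na that S by auto
      note inc = inner_increment[OF T sa da db c\<phi> ba]
      show "set_integrable lborel {S<..T} (\<lambda>r. inner (a' r) (b' r))" by (rule inc(1))
      have cs: "\<bar>inner (a t) (b' t)\<bar> \<le> A * V" if "t \<ge> S" for t
        using na[of t] nb[of t] that S \<open>A \<ge> 0\<close> by (intro order_trans[OF Cauchy_Schwarz_ineq2] mult_mono) auto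
      have "Kc / T \<ge> 0" "Kc / S \<le> Kc" using Kc S T frac_le[of Kc Kc 1 S] by auto
      then have "- Kc / T - - Kc / S \<le> Kc" by simp
      then have "A * (- Kc / T - - Kc / S) \<le> A * Kc" using \<open>A \<ge> 0\<close> by (intro mult_left_mono) auto
      then show "\<bar>LBINT r:{S<..T}. inner (a' r) (b' r)\<bar> \<le> 2 * (A * V) + A * Kc"
        using inc(2) cs[of T] cs[of S] T by linarith
    qed
    have lower: "\<bar>?J\<bar> / 2 * (2 * T) powr (- 1 / 2) * (T - S) \<le> 2 * (A * V) + A * Kc" if T: "T \<ge> S" for T
    proof -
      let ?m = "\<bar>?J\<bar> / 2 * (2 * T) powr (- 1 / 2)"
      have "(LBINT r:{S<..T}. ?m) \<le> (LBINT r:{S<..T}. sgn ?J * inner (a' r) (b' r))"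
        unfolding set_lebesgue_integral_def
      proof (rule integral_mono_AE)
        show "integrable lborel (\<lambda>r. indicat_real {S<..T} r *\<^sub>R ?m)"
          by (auto intro!: integrable_mult_left integrable_real_indicator simp: T)
        show "integrable lborel (\<lambda>r. indicat_real {S<..T} r *\<^sub>R (sgn ?J * inner (a' r) (b' r)))"
          using set_integrable_mult_right[of "sgn ?J", OF intab[OF T]] unfolding set_integrable_def by simp
        show "AE r in lborel. indicat_real {S<..T} r *\<^sub>R ?m \<le> indicat_real {S<..T} r *\<^sub>R (sgn ?J * inner (a' r) (b' r))"
          using S1(2) u_Lp
        proof eventually_elim
          case (elim r)
          show ?case
          proof (cases "r \<in> {S<..T}")
            case True
            then have r: "r > 0" "r > S1" "r \<le> T" "1 \<le> r" using S by auto
            let ?P = "pairing p c ?b (star_profile \<sigma> r (u r))"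
            have "inner (a' r) (b' r) = (2 * r) powr (- p / 2) * ?P"
              unfolding a'_def b'_def M.U_inner
              using r elim(2) by (intro inner_nonlinearity b v) auto
            then have eq: "sgn ?J * inner (a' r) (b' r) = (sgn ?J * ?P) * (2 * r) powr (- p / 2)" by simp
            have "(2 * T) powr (- 1 / 2) \<le> (2 * T) powr (- p / 2)"
              using r p by (intro powr_mono) auto
            also have "\<dots> \<le> (2 * r) powr (- p / 2)"
              using r p by (intro powr_mono2') auto
            finally have "?m \<le> (sgn ?J * ?P) * (2 * r) powr (- p / 2)"
              using elim(1) r by (intro mult_mono) auto
            then show ?thesis using True by (simp add: eq)
          qed simp
        qed
      qed
      also have "(LBINT r:{S<..T}. ?m) = ?m * (T - S)"
        using T by (simp add: set_lebesgue_integral_def)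
      also have "(LBINT r:{S<..T}. sgn ?J * inner (a' r) (b' r)) = sgn ?J * (LBINT r:{S<..T}. inner (a' r) (b' r))"
        by (rule set_integral_mult_right)
      also have "\<dots> \<le> \<bar>LBINT r:{S<..T}. inner (a' r) (b' r)\<bar>" by (rule sgn_mult_le_abs)
      also note bound[OF T]
      finally show ?thesis .
    qed
    define Y where "Y = 2 * (A * V) + A * Kc"
    have Y: "Y \<ge> 0" using \<open>A \<ge> 0\<close> V Kc by (simp add: Y_def)
    \<comment> \<open>\<open>T \<ge> 2 S\<close> gives \<open>T - S \<ge> T / 2\<close>, and \<open>2 T \<ge> X\<^sup>2\<close> lifts the lower bound to \<open>Y + 1\<close>.\<close>
    define X where "X = 8 * (Y + 1) / \<bar>?J\<bar>"
    have X: "X > 0" using Y J0 by (simp add: X_def)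
    define T where "T = 2 * S + X\<^sup>2"
    have T: "T \<ge> S" "T > 0" using S zero_le_power2[of X] unfolding T_def by linarith+
    have "X\<^sup>2 \<le> 2 * T" using S by (simp add: T_def)
    then have "X \<le> sqrt (2 * T)" by (rule real_le_rsqrt)
    also have "sqrt (2 * T) = 2 * ((2 * T) powr (- 1 / 2) * T)"
    proof -
      have "(2 * T) powr (1 / 2) = (2 * T) powr (- 1 / 2 + 1)" by simp
      also have "\<dots> = (2 * T) powr (- 1 / 2) * (2 * T)" using T by (subst powr_add) simp
      finally show ?thesis using T by (simp add: powr_half_sqrt)
    qed
    also have "\<dots> \<le> 2 * ((2 * T) powr (- 1 / 2) * (2 * (T - S)))"
      using S by (intro mult_left_mono) (auto simp: T_def)
    finally have "X \<le> 4 * ((2 * T) powr (- 1 / 2) * (T - S))" by (simp add: algebra_simps)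
    then have "\<bar>?J\<bar> / 8 * X \<le> \<bar>?J\<bar> / 8 * (4 * ((2 * T) powr (- 1 / 2) * (T - S)))" by (rule mult_left_mono) simp
    also have "\<dots> = \<bar>?J\<bar> / 2 * (2 * T) powr (- 1 / 2) * (T - S)" by simp
    also have "\<dots> \<le> Y" using lower[OF T(1)] by (simp add: Y_def)
    finally show False using J0 by (simp add: X_def)
  qed
  then have "\<Phi> = 0" by (intro pairing_zero_imp_zero[OF p])
  with \<Phi>(2) show ?thesis by simp
qed

section \<open>Both time directions\<close>

lemma AE_lborel_reflect:
  assumes "AE t in lborel. P (t::real)" and \<sigma>: "\<sigma> \<in> {1, -1::real}"
  shows "AE t in lborel. P (\<sigma> * t)"
proof (cases "\<sigma> = 1")
  case False
  have "AE t in distr lborel borel (uminus :: real \<Rightarrow> real). P t"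
    unfolding lborel_distr_uminus by (rule assms(1))
  from AE_distrD[OF _ this] show ?thesis using False \<sigma> by simp
qed (use assms in simp)

lemma AE_lebesgue_on_ray:
  assumes ae: "AE t in lebesgue_on I. P t" and I: "I \<in> sets lebesgue" and \<sigma>: "\<sigma> \<in> {1, -1::real}"
    and ray: "\<And>t. t > 0 \<Longrightarrow> Q t \<Longrightarrow> \<sigma> * t \<in> I"
  shows "AE t in lborel. 0 < t \<and> Q t \<longrightarrow> P (\<sigma> * t)"
proof -
  have "AE t in lebesgue. t \<in> I \<longrightarrow> P t"
    using ae I by (subst (asm) AE_restrict_space_iff) auto
  then have "AE t in lborel. t \<in> I \<longrightarrow> P t" by (simp add: AE_completion_iff)
  from AE_lborel_reflect[OF this \<sigma>] show ?thesis by eventually_elim (use ray in auto)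
qed

lemma star_Lp_norm_two: "star_Lp_norm 2 f = norm f"
proof -
  have "edge_Lp_norm 2 g powr 2 = (norm g)\<^sup>2" for g
  proof -
    have "(LINT x|half_line. norm (rep_half_line_L2 g x) powr 2) = (norm g)\<^sup>2"
      unfolding norm_half_line_L2_eq by (intro Bochner_Integration.integral_cong) auto
    then show ?thesis by (simp add: edge_Lp_norm_def powr_powr)
  qed
  then show ?thesis
    by (simp add: star_Lp_norm_def norm_vec_def L2_set_def powr_half_sqrt sum_nonneg)
qed

lemma edge_integral_le_star_Lp_norm:
  assumes q: "1 \<le> q" and C: "star_Lp_norm (ereal q) f \<le> C"
  shows "(LINT x|half_line. norm (rep_half_line_L2 (f $ j) x) powr q) \<le> C powr q"
proof -
  let ?I = "\<lambda>j. LINT x|half_line. norm (rep_half_line_L2 (f $ j) x) powr q"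
  have I: "?I j \<ge> 0" for j by (intro integral_nonneg_AE AE_I2) simp
  have e: "edge_Lp_norm (ereal q) (f $ j) powr q = ?I j" for j
    using q I[of j] by (simp add: edge_Lp_norm_def powr_powr)
  have "?I j \<le> (\<Sum>j\<in>UNIV. ?I j)" by (rule member_le_sum) (use I in auto)
  also have "\<dots> = star_Lp_norm (ereal q) f powr q"
    using q sum_nonneg[of UNIV ?I] I by (simp add: star_Lp_norm_def e powr_powr)
  also have "\<dots> \<le> C powr q"
    using q C by (intro powr_mono2) (auto simp: star_Lp_norm_def)
  finally show ?thesis .
qed

lemma interval_integrable_imp_Ioc:
  assumes "t \<ge> 0" "interval_lebesgue_integrable lborel (ereal 0) (ereal t) f"
  shows "set_integrable lborel {0<..t} f"
proof (cases "t = 0")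
  case True
  then show ?thesis by (simp add: set_integrable_def)
next
  case False
  then have "{0<..t} = {0<..<t} \<union> {t}" using assms(1) by auto
  moreover have "set_integrable lborel {0<..<t} f"
    using assms by (simp add: interval_lebesgue_integrable_def)
  moreover have "set_integrable lborel {t} f"
  proof -
    have "(\<lambda>x. indicat_real {t} x *\<^sub>R f x) = (\<lambda>x. indicat_real {t} x *\<^sub>R f t)"
      by (auto simp: indicator_def)
    then show ?thesis by (simp add: set_integrable_def)
  qed
  ultimately show ?thesis
    using set_integrable_Un[of lborel "{0<..<t}" f "{t}"] by (simp only:) simp
qed

text \<open>For \<open>\<sigma> = -1\<close> the orientation of the Duhamel integral turns the coupling \<open>i\<lambda>\<close> into \<open>- i\<lambda>\<close>.\<close>

lemma L2_solution_ray:
  assumes sol: "global_solution U lam p u0 u" and \<sigma>: "\<sigma> \<in> {1, -1}" and t: "t \<ge> 0"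
  shows "set_integrable lborel {0<..t} (\<lambda>s. U (\<sigma> * (t - s)) (nonlinearity p (u (\<sigma> * s))))"
    and "u (\<sigma> * t) = U (\<sigma> * t) u0 + scaleC_star (\<i> * of_real (\<sigma> * lam))
      (LBINT s:{0<..t}. U (\<sigma> * (t - s)) (nonlinearity p (u (\<sigma> * s))))"
proof -
  let ?f = "\<lambda>s. U (\<sigma> * t - s) (nonlinearity p (u s))"
  let ?g = "\<lambda>s. U (\<sigma> * (t - s)) (nonlinearity p (u (\<sigma> * s)))"
  have "L2_solution U lam p u0 {- t..t} u"
    using sol t by (simp add: global_solution_def)
  then have "interval_lebesgue_integrable lborel (ereal 0) (ereal (\<sigma> * t)) ?f"
    and eq: "u (\<sigma> * t) = U (\<sigma> * t) u0 + scaleC_star (\<i> * of_real lam) (LBINT s=ereal 0..ereal (\<sigma> * t). ?f s)"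
    using \<sigma> t unfolding L2_solution_def by auto
  then have "interval_lebesgue_integrable lborel (ereal 0) (ereal t) ?g"
    and g: "(LBINT s=ereal 0..ereal (\<sigma> * t). ?f s) = \<sigma> *\<^sub>R (LBINT s=ereal 0..ereal t. ?g s)"
  proof -
    assume int: "interval_lebesgue_integrable lborel (ereal 0) (ereal (\<sigma> * t)) ?f"
    consider "\<sigma> = 1" | "\<sigma> = - 1" using \<sigma> by auto
    then have "interval_lebesgue_integrable lborel (ereal 0) (ereal t) ?g
        \<and> (LBINT s=ereal 0..ereal (\<sigma> * t). ?f s) = \<sigma> *\<^sub>R (LBINT s=ereal 0..ereal t. ?g s)"
    proof cases
      case 1
      then show ?thesis using int by simp
    next
      case 2
      have g: "?g = (\<lambda>s. ?f (- s))" using 2 by (simp add: algebra_simps)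
      have "interval_lebesgue_integrable lborel (ereal (\<sigma> * t)) (ereal 0) ?f"
        using int by (subst interval_integrable_endpoints_reverse)
      then have "interval_lebesgue_integrable lborel (ereal 0) (ereal t) ?g"
        unfolding g using 2 by (subst interval_integrable_mirror) simp
      moreover have "(LBINT s=ereal 0..ereal (\<sigma> * t). ?f s) = - (LBINT s=ereal (\<sigma> * t)..ereal 0. ?f s)"
        by (rule interval_integral_endpoints_reverse)
      moreover have "(LBINT s=ereal (\<sigma> * t)..ereal 0. ?f s) = (LBINT s=ereal 0..ereal t. ?f (- s))"
        using 2 by (subst interval_integral_reflect) simp
      ultimately show ?thesis using 2 g by simp
    qed
    then show "interval_lebesgue_integrable lborel (ereal 0) (ereal t) ?g"
      "(LBINT s=ereal 0..ereal (\<sigma> * t). ?f s) = \<sigma> *\<^sub>R (LBINT s=ereal 0..ereal t. ?g s)" by auto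
  qed
  then show "set_integrable lborel {0<..t} ?g" using t by (intro interval_integrable_imp_Ioc)
  have "scaleC_star (\<i> * of_real lam) (\<sigma> *\<^sub>R x) = scaleC_star (\<i> * of_real (\<sigma> * lam)) x" for x
    by (simp add: scaleC_star_of_real[symmetric] scaleC_star_scaleC mult_ac)
  moreover have "(LBINT s=ereal 0..ereal t. ?g s) = (LBINT s:{0<..t}. ?g s)"
    using t by (subst interval_integral_Ioc) auto
  ultimately show "u (\<sigma> * t) = U (\<sigma> * t) u0 + scaleC_star (\<i> * of_real (\<sigma> * lam)) (LBINT s:{0<..t}. ?g s)"
    unfolding eq g by simp
qed

lemma global_solution_continuous:
  assumes "global_solution U lam p u0 u"
  shows "continuous_on UNIV u"
proof -
  have "isCont u t" for t
  proof -
    have "L2_solution U lam p u0 {- (\<bar>t\<bar> + 1)..\<bar>t\<bar> + 1} u"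
      using assms by (simp add: global_solution_def)
    then have "continuous_on {- (\<bar>t\<bar> + 1)..\<bar>t\<bar> + 1} u" by (simp add: L2_solution_def)
    moreover have "t \<in> interior {- (\<bar>t\<bar> + 1)..\<bar>t\<bar> + 1}" by (simp add: interior_atLeastAtMost_real) arith
    ultimately show ?thesis by (rule continuous_on_interior)
  qed
  then show ?thesis by (simp add: continuous_on_eq_continuous_at)
qed

text \<open>The pair with the space exponent \<open>2p + 2\<close>, for which \<open>\<bar>u\<bar>\<^sup>pu\<close> is in \<open>L\<^sup>2\<close>.\<close>

lemma admissible_power_pair:
  assumes "0 < p"
  shows "admissible (ereal (4 * (p + 1) / p)) (ereal (2 * p + 2))"
proof -
  have two: "(2 :: ereal) = ereal 2" and one: "(1 :: ereal) = ereal 1" by simp_all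
  have "2 \<le> 4 * (p + 1) / p" using assms by (simp add: field_simps)
  moreover have "2 / (4 * (p + 1) / p) = 1 / 2 - 1 / (2 * p + 2)" using assms by (simp add: field_simps)
  moreover have "4 * (p + 1) / p \<noteq> 0" "2 * p + 2 \<noteq> 0" using assms by auto
  moreover have "ereal a / ereal b = ereal (a / b)" if "b \<noteq> 0" for a b :: real
    using that by (simp add: divide_ereal_def divide_inverse)
  ultimately show ?thesis
    using assms unfolding admissible_def two one
    by (simp only: ereal_less_eq ereal_minus zero_neq_numeral not_False_eq_True) simp
qed

lemma global_solution_Lp:
  assumes sol: "global_solution U lam p u0 u" and \<sigma>: "\<sigma> \<in> {1, -1}" and p: "0 < p"
  shows "AE t in lborel. 0 < t \<longrightarrow> star_in_Lp (ereal (2 * p + 2)) (u (\<sigma> * t))"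
proof -
  have "AE t in lborel. 0 < t \<and> t \<le> real n \<longrightarrow> star_in_Lp (ereal (2 * p + 2)) (u (\<sigma> * t))" for n :: nat
  proof (rule AE_lebesgue_on_ray[OF _ _ \<sigma>])
    have "L2_solution U lam p u0 {- real n..real n} u" using sol by (simp add: global_solution_def)
    then show "AE t in lebesgue_on {- real n..real n}. star_in_Lp (ereal (2 * p + 2)) (u t)"
      using admissible_power_pair[OF p] by (auto simp: L2_solution_def in_LqLr_def)
    show "\<sigma> * t \<in> {- real n..real n}" if "t > 0" "t \<le> real n" for t using \<sigma> that by auto
  qed auto
  then have "AE t in lborel. \<forall>n::nat. 0 < t \<and> t \<le> real n \<longrightarrow> star_in_Lp (ereal (2 * p + 2)) (u (\<sigma> * t))"
    unfolding AE_all_countable by blast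
  then show ?thesis
  proof eventually_elim
    case (elim t)
    obtain n :: nat where "t \<le> real n" using real_arch_simple by blast
    with elim show ?case by auto
  qed
qed

lemma no_scattering_along_ray:
  fixes u l :: "real \<Rightarrow> 'n::finite star_L2"
  assumes UM: "generates_unitary_group (star_laplacian (matrix_bc A B)) UM"
    and UK: "generates_unitary_group (star_laplacian kirchhoff_bc) UK"
    and lam: "lam \<in> {1, -1}" and p: "0 < p" "p < 1" and sol: "global_solution UM lam p u0 u"
    and \<sigma>: "\<sigma> \<in> {1, -1}" and I: "I \<in> sets lebesgue" "(\<lambda>t. \<sigma> * t) ` {0<..} \<subseteq> I"
    and q: "1 \<le> q" "q < 2"
    and l2: "in_LqLr \<infinity> 2 I l" and lq: "in_LqLr \<infinity> (ereal q) I l"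
    and lim: "((\<lambda>t. norm (u (\<sigma> * t) - (UK (\<sigma> * t) up + l (\<sigma> * t)))) \<longlongrightarrow> 0) at_top"
  shows "up = 0"
proof -
  have "\<exists>C2. AE t in lebesgue_on I. norm (l t) \<le> C2"
    using l2 unfolding in_LqLr_def star_Lp_norm_two by simp
  then obtain C2 where C2: "AE t in lebesgue_on I. norm (l t) \<le> C2" ..
  have l2': "AE t in lborel. 0 < t \<longrightarrow> norm (l (\<sigma> * t)) \<le> C2"
    using AE_lebesgue_on_ray[OF C2 I(1) \<sigma>, of "\<lambda>t. True"] I(2) by auto
  have "\<exists>C. AE t in lebesgue_on I. star_Lp_norm (ereal q) (l t) \<le> C"
    using lq unfolding in_LqLr_def by simp
  then obtain C where C: "AE t in lebesgue_on I. star_Lp_norm (ereal q) (l t) \<le> C" ..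
  have "AE t in lebesgue_on I. star_in_Lp (ereal q) (l t)" using lq unfolding in_LqLr_def by simp
  with C have Cq: "AE t in lebesgue_on I. \<forall>j. integrable half_line (\<lambda>x. norm (rep_half_line_L2 (l t $ j) x) powr q)
      \<and> (LINT x|half_line. norm (rep_half_line_L2 (l t $ j) x) powr q) \<le> C powr q"
    by eventually_elim (simp add: star_in_Lp_def edge_in_Lp_def edge_integral_le_star_Lp_norm[OF q(1)])
  have lq': "AE t in lborel. 0 < t \<longrightarrow> (\<forall>j. integrable half_line (\<lambda>x. norm (rep_half_line_L2 (l (\<sigma> * t) $ j) x) powr q)
      \<and> (LINT x|half_line. norm (rep_half_line_L2 (l (\<sigma> * t) $ j) x) powr q) \<le> C powr q)"
    using AE_lebesgue_on_ray[OF Cq I(1) \<sigma>, of "\<lambda>t. True"] I(2) by auto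
  have bc: "matrix_bc A B 0 0" by (simp add: matrix_bc_def)
  have \<kappa>: "norm (\<i> * of_real (\<sigma> * lam)) = 1" using \<sigma> lam by (auto simp: norm_mult)
  have cont: "continuous_on {0<..} (\<lambda>t. u (\<sigma> * t))"
    by (rule continuous_on_compose2[OF global_solution_continuous[OF sol]]) (auto intro!: continuous_intros)
  show ?thesis
    by (rule scattering_state_zero[where u = "\<lambda>t. u (\<sigma> * t)" and l = "\<lambda>t. l (\<sigma> * t)",
      OF star_group_of_generates_unitary_group[OF UM \<sigma>] bc star_group_of_generates_unitary_group[OF UK \<sigma>] p q \<kappa> cont
        L2_solution_ray[OF sol \<sigma>] global_solution_Lp[OF sol \<sigma> p(1)] l2' lq' lim])
qed

theorem theorem2p1:
  fixes A B :: "complex^'n^'n"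
    and UM UK :: "real \<Rightarrow> 'n::finite star_L2 \<Rightarrow> 'n star_L2"
    and lam p :: real
    and u0 :: "'n star_L2"
    and u :: "real \<Rightarrow> 'n star_L2"
  assumes "condition_A1 A B"
    and "condition_A2 A B"
    and "generates_unitary_group (star_laplacian (matrix_bc A B)) UM"
    and "generates_unitary_group (star_laplacian kirchhoff_bc) UK"
    and "lam \<in> {1, -1}"
    and "0 < p" and "p < 1"
    and "global_solution UM lam p u0 u"
  shows
    "(\<forall>(up :: 'n star_L2) (q :: real) (l :: real \<Rightarrow> 'n star_L2).
        1 \<le> q \<and> q < 2 \<and>
        in_LqLr \<infinity> 2 {0<..} l \<and> in_LqLr \<infinity> (ereal q) {0<..} l \<and>
        ((\<lambda>t. norm (u t - (UK t up + l t))) \<longlongrightarrow> 0) at_top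
        \<longrightarrow> up = 0) \<and>
     (\<forall>(um :: 'n star_L2) (q :: real) (l :: real \<Rightarrow> 'n star_L2).
        1 \<le> q \<and> q < 2 \<and>
        in_LqLr \<infinity> 2 {..<0} l \<and> in_LqLr \<infinity> (ereal q) {..<0} l \<and>
        ((\<lambda>t. norm (u t - (UK t um + l t))) \<longlongrightarrow> 0) at_bot
        \<longrightarrow> um = 0)"
proof -
  note along_ray = no_scattering_along_ray[OF assms(3-8)]
  show ?thesis
  proof (intro conjI allI impI; elim conjE)
    fix up :: "'n star_L2" and q :: real and l :: "real \<Rightarrow> 'n star_L2"
    assume q: "1 \<le> q" "q < 2" and l: "in_LqLr \<infinity> 2 {0<..} l" "in_LqLr \<infinity> (ereal q) {0<..} l"
      and lim: "((\<lambda>t. norm (u t - (UK t up + l t))) \<longlongrightarrow> 0) at_top"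
    have "((\<lambda>t. norm (u (1 * t) - (UK (1 * t) up + l (1 * t)))) \<longlongrightarrow> 0) at_top"
      using lim by simp
    then show "up = 0" by (rule along_ray[where \<sigma> = 1, OF _ _ _ q l, rotated -1]) auto
  next
    fix um :: "'n star_L2" and q :: real and l :: "real \<Rightarrow> 'n star_L2"
    assume q: "1 \<le> q" "q < 2" and l: "in_LqLr \<infinity> 2 {..<0} l" "in_LqLr \<infinity> (ereal q) {..<0} l"
      and lim: "((\<lambda>t. norm (u t - (UK t um + l t))) \<longlongrightarrow> 0) at_bot"
    have "((\<lambda>t. norm (u (- 1 * t) - (UK (- 1 * t) um + l (- 1 * t)))) \<longlongrightarrow> 0) at_top"
      using lim by (simp add: filterlim_at_bot_mirror)
    then show "um = 0" by (rule along_ray[where \<sigma> = "- 1", OF _ _ _ q l, rotated -1]) auto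
  qed
qed

end
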